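(* There exist a universal constant $c>0$ and a function $\eta:\mathbb{N}\to[0,1]$ with $\eta(d)\to 0$ as $d\to\infty$ such that the following holds. For every integer $d\ge 2$ and every positive integer $m < c\, d^2/\log^4(d)$, if $x^{(1)},x^{(2)},\ldots,x^{(m)}$ are i.i.d. samples from the standard Gaussian $\mathcal{N}(0,I_d)$ on $\mathbb{R}^d$, then with probability at least $1-\eta(d)$ there exists an origin-centered ellipsoid that passes through all of the points $x^{(1)},\ldots,x^{(m)}$.
   Context: An origin-centered ellipsoid in $\mathbb{R}^d$ is a set of the form $\{x\in\mathbb{R}^d : x^\top N x = 1\}$, where $N$ is a symmetric positive definite $d\times d$ real matrix. It passes through a point $x$ if $x$ belongs to this set. Here $\log^4(d)=(\log d)^4$. *)

theory Defs
  imports "HOL-Probability.Probability" "Jordan_Normal_Form.Matrix"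
begin

definition positive_definite_mat :: "nat \<Rightarrow> real mat \<Rightarrow> bool" where
  "positive_definite_mat d N \<longleftrightarrow>
     N \<in> carrier_mat d d \<and> transpose_mat N = N \<and>
     (\<forall>v \<in> carrier_vec d. v \<noteq> 0\<^sub>v d \<longrightarrow> scalar_prod v (N *\<^sub>v v) > 0)"

definition ellipsoid_of_mat :: "nat \<Rightarrow> real mat \<Rightarrow> real vec set" where
  "ellipsoid_of_mat d N = {x \<in> carrier_vec d. scalar_prod x (N *\<^sub>v x) = 1}"

definition origin_centered_ellipsoid :: "nat \<Rightarrow> real vec set \<Rightarrow> bool" where
  "origin_centered_ellipsoid d E \<longleftrightarrow>
     (\<exists>N. positive_definite_mat d N \<and> E = ellipsoid_of_mat d N)"

text \<open>The law N(0, I_d) on R^d. As d is a number and not a type, R^d appears here as the space of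
  coordinate families indexed by \<open>{..<d}\<close>; \<open>vec d\<close> turns such a family into a vector.\<close>

definition std_gaussian :: "nat \<Rightarrow> (nat \<Rightarrow> real) measure" where
  "std_gaussian d = (\<Pi>\<^sub>M i\<in>{..<d}. density lborel (\<lambda>t. ennreal (std_normal_density t)))"

text \<open>The joint law of m i.i.d. samples from N(0, I_d); the j-th sample of an outcome \<open>\<omega>\<close>
  is \<open>vec d (\<omega> j)\<close>, for j in \<open>{..<m}\<close>.\<close>

definition iid_gaussian_samples :: "nat \<Rightarrow> nat \<Rightarrow> (nat \<Rightarrow> nat \<Rightarrow> real) measure" where
  "iid_gaussian_samples d m = (\<Pi>\<^sub>M j\<in>{..<m}. std_gaussian d)"

lemma prob_space_std_gaussian: "prob_space (std_gaussian d)"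
  unfolding std_gaussian_def
  by (intro prob_space_PiM prob_space_normal_density) simp

lemma prob_space_iid_gaussian_samples: "prob_space (iid_gaussian_samples d m)"
  unfolding iid_gaussian_samples_def
  by (intro prob_space_PiM prob_space_std_gaussian)

end

theory Submission
  imports Defs "Jordan_Normal_Form.Determinant" "HOL-Real_Asymp.Real_Asymp"
begin

text \<open>
  Write each sample as \<open>x\<^sub>j = r\<^sub>j u\<^sub>j / sqrt d\<close> with \<open>u\<^sub>j\<close> on the sphere of radius \<open>sqrt d\<close>; the
  radii are independent of the directions. We look for an ellipsoid \<open>N = (s / d) (I + \<Delta>)\<close>, which
  amounts to \<open>u\<^sub>j\<^sup>T \<Delta> u\<^sub>j = b\<^sub>j\<close> where \<open>b\<^sub>j = d (d / (s r\<^sub>j\<^sup>2) - 1)\<close> depends on the radius only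
  and, for the right \<open>s\<close> and after truncation, is centered and of size \<open>sqrt (d log d)\<close>.

  Off its diagonal the Gram matrix \<open>\<langle>u\<^sub>i, u\<^sub>j\<rangle>\<^sup>2\<close> is \<open>d 1 1\<^sup>T\<close> plus a centered matrix \<open>K\<close>. Expanding
  \<open>(K\<^sup>p)\<^sub>i\<^sub>i\<close> by returns to \<open>i\<close> and averaging over the sample \<open>i\<close> alone gives a recursion for the
  trace moments of \<open>K\<close>, hence \<open>\<parallel>K\<parallel> \<le> d\<^sup>2 / 8\<close> with high probability. So the Gram matrix has an
  inverse \<open>P\<close> of norm at most \<open>4 / d\<^sup>2\<close>, and \<open>D\<^sub>j = \<Sum>\<^sub>i P\<^sub>i\<^sub>j u\<^sub>i u\<^sub>i\<^sup>T\<close> satisfies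
  \<open>u\<^sub>l\<^sup>T D\<^sub>j u\<^sub>l = \<delta>\<^sub>j\<^sub>l\<close> and \<open>\<Sum>\<^sub>j D\<^sub>j\<^sup>2 \<le> 48 sqrt m / d\<^sup>2\<close>.

  Given the directions, \<open>\<Delta> = \<Sum>\<^sub>j b\<^sub>j D\<^sub>j\<close> is a sum of fixed matrices with independent bounded centered
  coefficients, and the matrix Khintchine inequality yields \<open>\<parallel>\<Delta>\<parallel> \<le> 1 / 2\<close>, so \<open>I + \<Delta>\<close> is positive definite.
\<close>

section \<open>Self-adjoint operators on a finite index set\<close>

text \<open>Two separations shape the argument. The duals depend on all directions at once, so the
  coefficients b_j are independent of them only after radii and directions have been decoupled.
  Among the directions, a power of the Gram matrix mixes all samples, but the matrix without row i
  is independent of sample i; averaging over that sample is then an explicit Gaussian second moment.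
  No eigenvalues occur: operator norms come from \<open>hs I (T ^^ n) (T ^^ n)\<close>, the trace of
  the power 2n, because the norms of the iterates of a self-adjoint operator are log-convex in the
  exponent. Taking n of order log d makes the dimension factor of the trace harmless. The fourth
  power of the logarithm arises twice. The entries of K are of size up to order d log d, so its
  columns have norm up to sqrt m d log d, and moments of order log d cost another log d; staying
  below d^2 requires sqrt m (log d)^2 to be small against d. For \<Delta>, the square of b_j, of
  order d log d, times the bound sqrt m / d^2 on the sum of squares, times the moment order log d,
  leads to the same requirement.\<close>

definition ip :: "'a set \<Rightarrow> ('a \<Rightarrow> real) \<Rightarrow> ('a \<Rightarrow> real) \<Rightarrow> real" where
  "ip I v w = (\<Sum>i\<in>I. v i * w i)"

definition mv :: "'a set \<Rightarrow> ('a \<Rightarrow> 'a \<Rightarrow> real) \<Rightarrow> ('a \<Rightarrow> real) \<Rightarrow> 'a \<Rightarrow> real" where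
  "mv I A v = (\<lambda>i. \<Sum>k\<in>I. A i k * v k)"

definition bvec :: "'a \<Rightarrow> 'a \<Rightarrow> real" where
  "bvec k = (\<lambda>i. if i = k then 1 else 0)"

text \<open>The Hilbert-Schmidt inner product, that is the trace of the transpose of S composed with
  T. Operators are plain functions, and only their values at indices in I count.\<close>

definition hs :: "'a set \<Rightarrow> (('a \<Rightarrow> real) \<Rightarrow> 'a \<Rightarrow> real) \<Rightarrow> (('a \<Rightarrow> real) \<Rightarrow> 'a \<Rightarrow> real) \<Rightarrow> real" where
  "hs I S T = (\<Sum>l\<in>I. ip I (S (bvec l)) (T (bvec l)))"

text \<open>Linearity is the expansion over basis vectors, evaluated at indices of I only. The
  result thus depends on v through its restriction to I, and functions that differ outside I need
  not be identified.\<close>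

definition lin :: "'a set \<Rightarrow> (('a \<Rightarrow> real) \<Rightarrow> 'a \<Rightarrow> real) \<Rightarrow> bool" where
  "lin I S \<longleftrightarrow> (\<forall>v. \<forall>i\<in>I. S v i = (\<Sum>k\<in>I. v k * S (bvec k) i))"

definition sadj :: "'a set \<Rightarrow> (('a \<Rightarrow> real) \<Rightarrow> 'a \<Rightarrow> real) \<Rightarrow> bool" where
  "sadj I T \<longleftrightarrow> lin I T \<and> (\<forall>v w. ip I (T v) w = ip I v (T w))"

lemma ip_commute: "ip I v w = ip I w v"
  by (simp add: ip_def mult.commute)

lemma ip_nonneg [simp]: "0 \<le> ip I v v"
  by (simp add: ip_def sum_nonneg)

lemma ip_cong: "(\<And>i. i \<in> I \<Longrightarrow> v i = v' i) \<Longrightarrow> (\<And>i. i \<in> I \<Longrightarrow> w i = w' i) \<Longrightarrow> ip I v w = ip I v' w'"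
  by (simp add: ip_def)

lemma ip_Cauchy: "(ip I v w)\<^sup>2 \<le> ip I v v * ip I w w"
  using Cauchy_Schwarz_ineq_sum[of v w I] by (simp add: ip_def power2_eq_square)

lemma ip_bvec: "finite I \<Longrightarrow> i \<in> I \<Longrightarrow> ip I v (bvec i) = v i"
  by (simp add: ip_def bvec_def if_distrib cong: if_cong)

lemma ip_AMGM:
  assumes "c > 0"
  shows "2 * ip I v w \<le> c * ip I v v + ip I w w / c"
proof -
  have "2 * (v i * w i) \<le> c * (v i * v i) + w i * w i / c" for i
  proof -
    have "0 \<le> (c * v i - w i)\<^sup>2 / c" using assms by simp
    also have "\<dots> = c * (v i * v i) + w i * w i / c - 2 * (v i * w i)"
      using assms by (simp add: power2_eq_square field_simps)
    finally show ?thesis by simp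
  qed
  then have "(\<Sum>i\<in>I. 2 * (v i * w i)) \<le> (\<Sum>i\<in>I. c * (v i * v i) + w i * w i / c)"
    by (intro sum_mono) auto
  then show ?thesis
    by (simp add: ip_def sum.distrib sum_distrib_left sum_divide_distrib)
qed

lemma ip_sum_right: "ip I v (\<lambda>i. \<Sum>k\<in>J. c k * w k i) = (\<Sum>k\<in>J. c k * ip I v (w k))"
proof -
  have "ip I v (\<lambda>i. \<Sum>k\<in>J. c k * w k i) = (\<Sum>i\<in>I. \<Sum>k\<in>J. c k * (v i * w k i))"
    by (simp add: ip_def sum_distrib_left mult_ac)
  also have "\<dots> = (\<Sum>k\<in>J. c k * ip I v (w k))"
    by (subst sum.swap) (simp add: ip_def sum_distrib_left)
  finally show ?thesis .
qed

lemma linD: "lin I S \<Longrightarrow> i \<in> I \<Longrightarrow> S v i = (\<Sum>k\<in>I. v k * S (bvec k) i)"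
  by (simp add: lin_def)

lemma lin_id: "finite I \<Longrightarrow> lin I id"
  by (auto simp: lin_def bvec_def if_distrib cong: if_cong)

lemma lin_mv: "finite I \<Longrightarrow> lin I (mv I A)"
  by (auto simp: lin_def mv_def bvec_def if_distrib mult.commute cong: if_cong)

lemma lin_comp:
  assumes "lin I S" "lin I T"
  shows "lin I (S \<circ> T)"
  unfolding lin_def
proof (intro allI ballI)
  fix v i assume i: "i \<in> I"
  have "(S \<circ> T) v i = (\<Sum>k\<in>I. (\<Sum>l\<in>I. v l * T (bvec l) k) * S (bvec k) i)"
    using linD[OF assms(1) i, of "T v"] by (simp add: linD[OF assms(2), of _ v])
  also have "\<dots> = (\<Sum>l\<in>I. v l * (\<Sum>k\<in>I. T (bvec l) k * S (bvec k) i))"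
    unfolding sum_distrib_left sum_distrib_right by (subst sum.swap) (simp add: mult_ac)
  also have "\<dots> = (\<Sum>l\<in>I. v l * (S \<circ> T) (bvec l) i)"
    by (intro sum.cong refl) (simp only: o_apply linD[OF assms(1) i, symmetric])
  finally show "(S \<circ> T) v i = (\<Sum>k\<in>I. v k * (S \<circ> T) (bvec k) i)" .
qed

lemma lin_funpow: "finite I \<Longrightarrow> lin I T \<Longrightarrow> lin I (T ^^ n)"
  by (induction n) (auto intro: lin_id lin_comp)

lemma sadj_lin: "sadj I T \<Longrightarrow> lin I T"
  by (simp add: sadj_def)

lemma sadj_ip: "sadj I T \<Longrightarrow> ip I (T v) w = ip I v (T w)"
  by (simp add: sadj_def)

lemma sadj_mv:
  assumes "finite I" "\<And>i k. i \<in> I \<Longrightarrow> k \<in> I \<Longrightarrow> A i k = A k i"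
  shows "sadj I (mv I A)"
proof -
  have "ip I (mv I A v) w = ip I v (mv I A w)" for v w
  proof -
    have "ip I (mv I A v) w = (\<Sum>i\<in>I. \<Sum>k\<in>I. A i k * v k * w i)"
      by (simp add: ip_def mv_def sum_distrib_right)
    also have "\<dots> = (\<Sum>k\<in>I. \<Sum>i\<in>I. A k i * v k * w i)"
      by (subst sum.swap) (intro sum.cong refl, simp add: assms(2))
    also have "\<dots> = ip I v (mv I A w)"
      by (simp add: ip_def mv_def sum_distrib_left mult_ac)
    finally show ?thesis .
  qed
  then show ?thesis using assms(1) by (simp add: sadj_def lin_mv)
qed

lemma ip_funpow:
  assumes "sadj I T"
  shows "ip I ((T ^^ n) v) w = ip I v ((T ^^ n) w)"
proof (induction n arbitrary: w)
  case (Suc n)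
  have "ip I ((T ^^ Suc n) v) w = ip I ((T ^^ n) v) (T w)" by (simp add: sadj_ip[OF assms])
  also have "\<dots> = ip I v ((T ^^ Suc n) w)" by (simp only: Suc funpow_Suc_right o_apply)
  finally show ?case .
qed simp

lemma sadj_funpow: "finite I \<Longrightarrow> sadj I T \<Longrightarrow> sadj I (T ^^ n)"
  unfolding sadj_def[of I "T ^^ n"] using ip_funpow lin_funpow sadj_lin by blast

lemma hs_commute: "hs I S T = hs I T S"
  by (simp add: hs_def ip_commute)

lemma hs_nonneg [simp]: "0 \<le> hs I S S"
  by (simp add: hs_def sum_nonneg)

lemma hs_AMGM: "c > 0 \<Longrightarrow> 2 * hs I S T \<le> c * hs I S S + hs I T T / c"
  unfolding hs_def sum_distrib_left sum_divide_distrib sum.distrib[symmetric]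
  by (intro sum_mono ip_AMGM)

lemma hs_left: "sadj I X \<Longrightarrow> hs I (X \<circ> S) T = hs I S (X \<circ> T)"
  by (simp add: hs_def sadj_ip)

text \<open>\<open>X\<close> has a symmetric matrix in the standard basis. In contrast to
  \<open>hs_left\<close> the other two operators have to be linear, because
  \<open>X (bvec l)\<close> is expanded in basis vectors under them.\<close>

lemma hs_right:
  assumes "finite I" "sadj I X" "lin I S" "lin I T"
  shows "hs I (S \<circ> X) T = hs I S (T \<circ> X)"
proof -
  have sym: "X (bvec k) l = X (bvec l) k" if "k \<in> I" "l \<in> I" for k l
    using sadj_ip[OF assms(2), of "bvec k" "bvec l"] that assms(1)
    by (metis ip_commute ip_bvec)
  have *: "ip I (A (bvec l)) (B (X (bvec l))) = (\<Sum>k\<in>I. X (bvec l) k * ip I (A (bvec l)) (B (bvec k)))"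
    if "lin I B" for A B l
  proof -
    have "ip I (A (bvec l)) (B (X (bvec l))) = ip I (A (bvec l)) (\<lambda>i. \<Sum>k\<in>I. X (bvec l) k * B (bvec k) i)"
      by (intro ip_cong refl linD[OF that])
    then show ?thesis by (simp add: ip_sum_right)
  qed
  have "hs I (S \<circ> X) T = (\<Sum>l\<in>I. \<Sum>k\<in>I. X (bvec l) k * ip I (T (bvec l)) (S (bvec k)))"
    unfolding hs_def comp_def by (intro sum.cong refl) (subst ip_commute, rule *[OF assms(3)])
  also have "\<dots> = (\<Sum>k\<in>I. \<Sum>l\<in>I. X (bvec k) l * ip I (S (bvec k)) (T (bvec l)))"
    by (subst sum.swap) (intro sum.cong refl, simp add: sym ip_commute)
  also have "\<dots> = hs I S (T \<circ> X)"
    unfolding hs_def comp_def by (intro sum.cong refl) (rule *[OF assms(4), symmetric])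
  finally show ?thesis .
qed

text \<open>Both sides equal \<open>hs I (D \<circ> D) (E \<circ> E)\<close>:
  \<open>hs_right\<close> carries the inner factor and \<open>hs_left\<close> the outer one to the
  other argument.\<close>

lemma hs_comp_swap:
  assumes "finite I" "sadj I D" "sadj I E"
  shows "hs I (E \<circ> D) (E \<circ> D) = hs I (D \<circ> E) (D \<circ> E)"
proof -
  note l = sadj_lin[OF assms(2)] sadj_lin[OF assms(3)]
  have 1: "hs I (E \<circ> D) (E \<circ> D) = hs I (D \<circ> D) (E \<circ> E)" if "sadj I D" "sadj I E" for D E
  proof -
    note l = sadj_lin[OF that(1)] sadj_lin[OF that(2)]
    have "hs I (E \<circ> D) (E \<circ> D) = hs I ((E \<circ> D) \<circ> D) E"
      using hs_right[OF assms(1) that(1), of "E \<circ> D" E] l by (simp add: lin_comp)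
    also have "\<dots> = hs I (D \<circ> D) (E \<circ> E)"
      using hs_left[OF that(2), of "D \<circ> D" E] by (simp add: comp_assoc)
    finally show ?thesis .
  qed
  show ?thesis using 1[OF assms(2,3)] 1[OF assms(3,2)] by (simp add: hs_commute)
qed

section \<open>Convexity in the exponent; operator norms from trace moments\<close>

text \<open>At the leftmost maximiser b, if it is an interior point, convexity forces the value at b
  - 1 to be maximal as well, a contradiction. Later uses reduce an intermediate exponent to the two
  extreme ones, in place of complex interpolation.\<close>

lemma discrete_convex_le_max:
  fixes g :: "nat \<Rightarrow> real"
  assumes conv: "\<And>a. 0 < a \<Longrightarrow> a < n \<Longrightarrow> 2 * g a \<le> g (a - 1) + g (a + 1)" and "a \<le> n"
  shows "g a \<le> max (g 0) (g n)"
proof (rule ccontr)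
  assume neg: "\<not> ?thesis"
  define M where "M = Max (g ` {..n})"
  have M: "g b \<le> M" if "b \<le> n" for b using that by (auto simp: M_def)
  have "M \<in> g ` {..n}" unfolding M_def by (intro Max_in) auto
  then have ex: "\<exists>b. b \<le> n \<and> g b = M" by auto
  define b where "b = (LEAST b. b \<le> n \<and> g b = M)"
  have b: "b \<le> n" "g b = M" using LeastI_ex[OF ex] by (auto simp: b_def)
  have least: "g b' \<noteq> M" if "b' < b" for b'
    using not_less_Least[of b' "\<lambda>b. b \<le> n \<and> g b = M"] that b by (auto simp: b_def)
  have "max (g 0) (g n) < M" using neg M[OF assms(2)] by linarith
  then have "g 0 < M" "g n < M" by simp_all
  then have "b \<noteq> 0" "b \<noteq> n" using b(2) by (metis less_irrefl)+
  then have "0 < b" "b < n" using b by simp_all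
  then have "2 * g b \<le> g (b - 1) + g (b + 1)" by (intro conv)
  moreover have "g (b + 1) \<le> M" using \<open>b < n\<close> by (intro M) auto
  moreover have "g (b - 1) \<le> M" "g (b - 1) \<noteq> M" using \<open>0 < b\<close> \<open>b < n\<close> least[of "b - 1"] by (auto intro!: M)
  ultimately show False using b by simp
qed

text \<open>The normalised squared norm of \<open>(T ^^ a) v\<close> is convex in a, because
  self-adjointness turns the squared norm at a into the inner product of the iterates a - 1 and a +
  1. At 0 its value is that of v, so a bound at exponent n descends to all smaller
  exponents.\<close>

lemma funpow_norm_bound:
  assumes T: "sadj I T" and y: "y > 0"
    and n: "ip I ((T ^^ n) v) ((T ^^ n) v) \<le> y ^ (2 * n) * ip I v v" and a: "a \<le> n"
  shows "ip I ((T ^^ a) v) ((T ^^ a) v) \<le> y ^ (2 * a) * ip I v v"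
proof -
  define g where "g a = ip I ((T ^^ a) v) ((T ^^ a) v) / y ^ (2 * a)" for a
  have "2 * g a \<le> g (a - 1) + g (a + 1)" if a: "0 < a" for a
  proof -
    obtain b where b: "a = Suc b" using a gr0_conv_Suc by auto
    have "2 * ip I ((T ^^ a) v) ((T ^^ a) v) = 2 * ip I ((T ^^ b) v) ((T ^^ (a + 1)) v)"
      by (simp add: b sadj_ip[OF T])
    also have "\<dots> \<le> y\<^sup>2 * ip I ((T ^^ b) v) ((T ^^ b) v) + ip I ((T ^^ (a + 1)) v) ((T ^^ (a + 1)) v) / y\<^sup>2"
      using y by (intro ip_AMGM) simp
    finally have "2 * ip I ((T ^^ a) v) ((T ^^ a) v) / y ^ (2 * a) \<le>
      (y\<^sup>2 * ip I ((T ^^ b) v) ((T ^^ b) v) + ip I ((T ^^ (a + 1)) v) ((T ^^ (a + 1)) v) / y\<^sup>2) / y ^ (2 * a)"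
      using y by (intro divide_right_mono) auto
    also have "\<dots> = g (a - 1) + g (a + 1)"
      using y by (simp add: g_def b field_simps power2_eq_square)
    finally show ?thesis by (simp add: g_def)
  qed
  then have "g a \<le> max (g 0) (g n)" using a by (intro discrete_convex_le_max) auto
  moreover have "g 0 = ip I v v" by (simp add: g_def)
  moreover have "g n \<le> ip I v v" using n y by (simp add: g_def field_simps)
  ultimately have "g a \<le> ip I v v" by simp
  then show ?thesis using y by (simp add: g_def field_simps)
qed

text \<open>Self-adjointness splits \<open>T ^^ a\<close> evenly between the two arguments; both
  halves have exponent at most n, where the norm bound applies.\<close>

lemma funpow_moment_bound:
  assumes T: "sadj I T" and y: "y > 0"
    and n: "ip I ((T ^^ n) v) ((T ^^ n) v) \<le> y ^ (2 * n) * ip I v v" and a: "a \<le> 2 * n"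
  shows "\<bar>ip I v ((T ^^ a) v)\<bar> \<le> y ^ a * ip I v v"
proof -
  define b c where "b = a div 2" and "c = a - b"
  have bc: "b \<le> n" "c \<le> n" "a = b + c" using a by (auto simp: b_def c_def)
  have "ip I v ((T ^^ a) v) = ip I ((T ^^ b) v) ((T ^^ c) v)"
    by (simp add: bc funpow_add ip_funpow[OF T])
  then have "(ip I v ((T ^^ a) v))\<^sup>2 \<le> ip I ((T ^^ b) v) ((T ^^ b) v) * ip I ((T ^^ c) v) ((T ^^ c) v)"
    using ip_Cauchy by metis
  also have "\<dots> \<le> (y ^ (2 * b) * ip I v v) * (y ^ (2 * c) * ip I v v)"
    using y bc by (intro mult_mono funpow_norm_bound[OF T y n]) auto
  also have "\<dots> = (y ^ a * ip I v v)\<^sup>2"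
    by (simp add: bc power_add power_mult power2_eq_square mult_ac power_mult_distrib)
  finally show ?thesis using y by (intro power2_le_imp_le[of "\<bar>_\<bar>"]) auto
qed

lemma hs_funpow_bound:
  assumes I: "finite I" and T: "sadj I T"
  shows "ip I ((T ^^ n) v) ((T ^^ n) v) \<le> hs I (T ^^ n) (T ^^ n) * ip I v v"
proof -
  have "ip I ((T ^^ n) v) ((T ^^ n) v) = (\<Sum>i\<in>I. (ip I v ((T ^^ n) (bvec i)))\<^sup>2)"
  proof -
    have "(T ^^ n) v i = ip I v ((T ^^ n) (bvec i))" if "i \<in> I" for i
      using ip_funpow[OF T, of n v "bvec i"] ip_bvec[OF I that] by simp
    then show ?thesis by (simp add: ip_def power2_eq_square)
  qed
  also have "\<dots> \<le> (\<Sum>i\<in>I. ip I v v * ip I ((T ^^ n) (bvec i)) ((T ^^ n) (bvec i)))"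
    by (intro sum_mono ip_Cauchy)
  finally show ?thesis by (simp add: hs_def sum_distrib_left mult_ac)
qed

text \<open>The Hilbert-Schmidt norm bounds the n-th iterate, and convexity in the exponent then
  plays the part of the n-th root by descending to exponent 1. Every operator norm of the
  development is obtained in this way from a trace moment or from a Frobenius norm.\<close>

lemma opnorm_from_hs:
  assumes I: "finite I" and T: "sadj I T" and y: "y > 0" and n: "n \<ge> 1"
    and hs: "hs I (T ^^ n) (T ^^ n) \<le> y ^ (2 * n)"
  shows "ip I (T v) (T v) \<le> y\<^sup>2 * ip I v v"
proof -
  have "ip I ((T ^^ n) v) ((T ^^ n) v) \<le> y ^ (2 * n) * ip I v v"
    using hs_funpow_bound[OF I T, of n v] mult_right_mono[OF hs, of "ip I v v"] by simp
  from funpow_norm_bound[OF T y this n] show ?thesis by simp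
qed

section \<open>Powers of a matrix decomposed at the visits to one index\<close>

lemma one_plus_inverse_power_le:
  assumes "q \<ge> 1"
  shows "(1 + 1 / real q) ^ q \<le> 3"
proof -
  have "(1 + 1 / real q) ^ q \<le> exp (1 / real q) ^ q"
    by (intro power_mono) (auto intro: exp_ge_add_one_self)
  also have "\<dots> = exp 1" using assms by (simp add: exp_of_nat_mult[symmetric])
  also have "\<dots> \<le> 3" by (rule exp_le)
  finally show ?thesis .
qed

lemma mv_remove: "finite I \<Longrightarrow> i \<in> I \<Longrightarrow> mv I K v l = K l i * v i + mv (I - {i}) K v l"
  by (simp add: mv_def sum.remove)

lemma mv_cong: "(\<And>k. k \<in> I \<Longrightarrow> v k = v' k) \<Longrightarrow> mv I K v = mv I K v'"
  by (simp add: mv_def)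

lemma mv_sum: "mv I K (\<lambda>l. \<Sum>a\<in>J. c a * w a l) l = (\<Sum>a\<in>J. c a * mv I K (w a) l)"
  unfolding mv_def sum_distrib_left by (subst sum.swap) (simp add: mult_ac)

text \<open>Walks from i to l are split at their last visit to i: it happens at time j - 1 - a, the
  next step leaves through column i of \<open>K\<close>, and the remaining a steps stay in
  \<open>I - {i}\<close>.\<close>

lemma renewal_vector:
  assumes "finite I" "i \<in> I" "l \<in> I - {i}"
  shows "((mv I K ^^ j) (bvec i)) l =
    (\<Sum>a<j. ((mv I K ^^ (j - 1 - a)) (bvec i)) i * ((mv (I - {i}) K ^^ a) (\<lambda>l. K l i)) l)"
  using assms(3)
proof (induction j arbitrary: l)
  case 0
  then show ?case by (simp add: bvec_def)
next
  case (Suc j)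
  define w where "w j = (mv I K ^^ j) (bvec i)" for j
  define u where "u a = (mv (I - {i}) K ^^ a) (\<lambda>l. K l i)" for a
  have IH: "w j l = (\<Sum>a<j. w (j - 1 - a) i * u a l)" if "l \<in> I - {i}" for l
    using Suc.IH[OF that] by (simp add: w_def u_def)
  have wS: "w (Suc j) = mv I K (w j)" by (simp add: w_def)
  have uS: "u (Suc a) = mv (I - {i}) K (u a)" for a by (simp add: u_def)
  have "w (Suc j) l = K l i * w j i + mv (I - {i}) K (w j) l"
    unfolding wS by (rule mv_remove[OF assms(1,2)])
  also have "mv (I - {i}) K (w j) = mv (I - {i}) K (\<lambda>l. \<Sum>a<j. w (j - 1 - a) i * u a l)"
    by (rule mv_cong) (rule IH)
  also have "\<dots> l = (\<Sum>a<j. w (j - 1 - a) i * u (Suc a) l)"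
    by (simp only: mv_sum uS)
  also have "K l i * w j i + \<dots> = (\<Sum>a<Suc j. w (Suc j - 1 - a) i * u a l)"
    by (simp add: sum.lessThan_Suc_shift u_def mult.commute del: sum.lessThan_Suc)
  finally show ?case by (simp only: w_def u_def)
qed

text \<open>A closed walk ends with a step through row i, which is column i by symmetry, and
  \<open>K i i = 0\<close> excludes the loop at i. Index i enters an excursion weight through its
  column only; the operator between the two columns does not see i, which is what allows averaging
  over sample i.\<close>

lemma renewal:
  assumes I: "finite I" "i \<in> I" and K: "\<And>l. l \<in> I \<Longrightarrow> K i l = K l i" "K i i = 0"
  shows "((mv I K ^^ Suc j) (bvec i)) i =
    (\<Sum>a<j. ((mv I K ^^ (j - 1 - a)) (bvec i)) i *
      ip (I - {i}) (\<lambda>l. K l i) ((mv (I - {i}) K ^^ a) (\<lambda>l. K l i)))"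
proof -
  let ?w = "(mv I K ^^ j) (bvec i)"
  have "((mv I K ^^ Suc j) (bvec i)) i = mv (I - {i}) K ?w i"
    using mv_remove[OF I, of K ?w i] K(2) by simp
  also have "\<dots> = ip (I - {i}) (\<lambda>l. K l i) ?w"
    unfolding ip_def mv_def by (intro sum.cong refl) (simp add: K(1))
  also have "\<dots> = ip (I - {i}) (\<lambda>l. K l i) (\<lambda>l. \<Sum>a<j. ((mv I K ^^ (j - 1 - a)) (bvec i)) i *
      ((mv (I - {i}) K ^^ a) (\<lambda>l. K l i)) l)"
    by (intro ip_cong refl renewal_vector[OF I])
  finally show ?thesis by (simp only: ip_sum_right)
qed

text \<open>Geometric excursion weights of rate y and total size s^2 make the returns grow at rate
  at most y + s, since the sum of y^a against powers of y + s telescopes. The bound at q + 2 keeps N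
  as a factor instead of replacing it by s^2; \<open>diagonal_power_bound\<close> needs this to turn
  N times a power of y back into a squared norm.\<close>

lemma renewal_sequence_bound:
  fixes c \<mu> :: "nat \<Rightarrow> real"
  assumes c0: "\<bar>c 0\<bar> \<le> 1" and c: "\<And>j. c (Suc j) = (\<Sum>a<j. c (j - 1 - a) * \<mu> a)"
    and \<mu>: "\<And>a. a \<le> q \<Longrightarrow> \<bar>\<mu> a\<bar> \<le> y ^ a * N" and N: "0 \<le> N" "N \<le> s\<^sup>2" and y: "y > 0" and s: "s > 0"
  shows "j \<le> q + 1 \<Longrightarrow> \<bar>c j\<bar> \<le> (y + s) ^ j"
    and "\<bar>c (q + 2)\<bar> \<le> (real q + 1) * N * (y + s) ^ q"
proof -
  show *: "\<bar>c j\<bar> \<le> (y + s) ^ j" if "j \<le> q + 1" for j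
    using that
  proof (induction j rule: less_induct)
    case (less j)
    show ?case
    proof (cases j)
      case 0
      then show ?thesis using c0 by simp
    next
      case (Suc i)
      have "\<bar>c (Suc i)\<bar> \<le> (\<Sum>a<i. \<bar>c (i - 1 - a)\<bar> * \<bar>\<mu> a\<bar>)"
        unfolding c by (rule order_trans[OF sum_abs]) (simp add: abs_mult)
      also have "\<dots> \<le> (\<Sum>a<i. (y + s) ^ (i - 1 - a) * (y ^ a * s\<^sup>2))"
      proof (intro sum_mono mult_mono)
        fix a assume a: "a \<in> {..<i}"
        show "\<bar>c (i - 1 - a)\<bar> \<le> (y + s) ^ (i - 1 - a)" using a less.prems Suc by (intro less.IH) auto
        have "\<bar>\<mu> a\<bar> \<le> y ^ a * N" using a less.prems Suc by (intro \<mu>) auto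
        also have "\<dots> \<le> y ^ a * s\<^sup>2" using N y by (intro mult_left_mono) auto
        finally show "\<bar>\<mu> a\<bar> \<le> y ^ a * s\<^sup>2" .
      qed (use y s in auto)
      \<comment> \<open>One of the two factors s is written as (y + s) - y, so that the identity for
        differences of powers applies.\<close>
      also have "\<dots> = s * (((y + s) - y) * (\<Sum>a<i. (y + s) ^ (i - Suc a) * y ^ a))"
        by (simp add: sum_distrib_left power2_eq_square mult_ac)
      also have "((y + s) - y) * (\<Sum>a<i. (y + s) ^ (i - Suc a) * y ^ a) = (y + s) ^ i - y ^ i"
        using power_diff_sumr2[of y i "y + s"] by simp
      also have "s * \<dots> \<le> (y + s) * (y + s) ^ i"
        using y s by (intro mult_mono) (auto intro: power_mono)
      finally show ?thesis by (simp add: Suc)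
    qed
  qed
  have "\<bar>c (Suc (q + 1))\<bar> \<le> (\<Sum>a<q+1. \<bar>c (q + 1 - 1 - a)\<bar> * \<bar>\<mu> a\<bar>)"
    unfolding c by (rule order_trans[OF sum_abs]) (simp add: abs_mult)
  also have "\<dots> \<le> (\<Sum>a<q+1. N * (y + s) ^ q)"
  proof (intro sum_mono)
    fix a assume a: "a \<in> {..<q+1}"
    have "\<bar>c (q + 1 - 1 - a)\<bar> * \<bar>\<mu> a\<bar> \<le> (y + s) ^ (q - a) * ((y + s) ^ a * N)"
    proof (intro mult_mono)
      show "\<bar>c (q + 1 - 1 - a)\<bar> \<le> (y + s) ^ (q - a)" using *[of "q - a"] by simp
      have "\<bar>\<mu> a\<bar> \<le> y ^ a * N" using a by (intro \<mu>) auto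
      also have "\<dots> \<le> (y + s) ^ a * N" using N y s by (intro mult_right_mono power_mono) auto
      finally show "\<bar>\<mu> a\<bar> \<le> (y + s) ^ a * N" .
    qed (use y s in auto)
    also have "\<dots> = N * (y + s) ^ (q - a + a)" by (simp add: power_add)
    finally show "\<bar>c (q + 1 - 1 - a)\<bar> * \<bar>\<mu> a\<bar> \<le> N * (y + s) ^ q" using a by simp
  qed
  finally show "\<bar>c (q + 2)\<bar> \<le> (real q + 1) * N * (y + s) ^ q" by (simp add: algebra_simps)
qed

text \<open>The rate y of \<open>renewal_sequence_bound\<close> is free. It is chosen so that y^(2n)
  is the ratio of the squared norms of w and of column i, but at least 2 n s; above this threshold,
  adding s to y changes y^(2n) by a factor of at most 3. The outcome is quadratic in column i apart
  from a deterministic term.\<close>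

lemma diagonal_power_bound:
  fixes n :: nat
  assumes I: "finite I" "i \<in> I" and K: "\<And>l h. l \<in> I \<Longrightarrow> h \<in> I \<Longrightarrow> K h l = K l h" "K i i = 0"
    and s: "s > 0" and N: "ip (I - {i}) (\<lambda>l. K l i) (\<lambda>l. K l i) \<le> s\<^sup>2"
  defines "w \<equiv> (mv (I - {i}) K ^^ n) (\<lambda>l. K l i)"
  shows "((mv I K ^^ (2 * n + 2)) (bvec i)) i
    \<le> 3 * (2 * real n + 1) * (ip (I - {i}) w w + s\<^sup>2 * (2 * real n * s) ^ (2 * n))"
proof -
  let ?c = "\<lambda>j. ((mv I K ^^ j) (bvec i)) i" and ?A = "mv (I - {i}) K" and ?k = "\<lambda>l. K l i"
  let ?J = "I - {i}" and ?N = "ip (I - {i}) (\<lambda>l. K l i) (\<lambda>l. K l i)"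
  have fin: "finite ?J" using I by simp
  have A: "sadj ?J ?A" by (rule sadj_mv[OF fin]) (use K in auto)
  have main: "?c (2 * n + 2) \<le> (2 * real n + 1) * ?N * (y + s) ^ (2 * n)"
    if y: "y > 0" and "ip ?J w w \<le> y ^ (2 * n) * ?N" for y
  proof -
    have "\<bar>?c (2 * n + 2)\<bar> \<le> (real (2 * n) + 1) * ?N * (y + s) ^ (2 * n)"
    proof (rule renewal_sequence_bound(2)[where \<mu> = "\<lambda>a. ip ?J ?k ((?A ^^ a) ?k)"])
      show "\<bar>?c 0\<bar> \<le> 1" by (simp add: bvec_def)
      show "?c (Suc j) = (\<Sum>a<j. ?c (j - 1 - a) * ip ?J ?k ((?A ^^ a) ?k))" for j
        by (rule renewal[OF I]) (use K I in auto)
      show "\<bar>ip ?J ?k ((?A ^^ a) ?k)\<bar> \<le> y ^ a * ?N" if "a \<le> 2 * n" for a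
        using that \<open>ip ?J w w \<le> _\<close> unfolding w_def by (intro funpow_moment_bound[OF A y, of n]) auto
    qed (use y s N in auto)
    then show ?thesis by simp
  qed
  have pow3: "(y + s) ^ (2 * n) \<le> 3 * y ^ (2 * n)" if y: "2 * real n * s \<le> y" "n \<ge> 1" for y
  proof -
    have "0 < 2 * real n * s" using y s by simp
    then have y0: "y > 0" using y by linarith
    have "y + s \<le> y * (1 + 1 / real (2 * n))" using y by (simp add: field_simps)
    then have "(y + s) ^ (2 * n) \<le> (y * (1 + 1 / real (2 * n))) ^ (2 * n)"
      using y0 s by (intro power_mono) auto
    also have "\<dots> = y ^ (2 * n) * (1 + 1 / real (2 * n)) ^ (2 * n)" by (simp add: power_mult_distrib)
    also have "\<dots> \<le> y ^ (2 * n) * 3"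
      using y0 y by (intro mult_left_mono one_plus_inverse_power_le) auto
    finally show ?thesis by simp
  qed
  show ?thesis
  \<comment> \<open>At n = 0 the threshold \<open>2 * real n * s\<close> is 0 and no valid rate; the
    exponent 2n is 0 too, so the rate 1 serves.\<close>
  proof (cases "n = 0")
    case True
    then have "?c (2 * n + 2) \<le> ?N" "ip ?J w w = ?N" using main[of 1] by (auto simp: w_def)
    moreover have "c \<le> N \<Longrightarrow> W = N \<Longrightarrow> 0 \<le> N \<Longrightarrow> 0 < S \<Longrightarrow> c \<le> 3 * (W + S)" for c N W S :: real
      by (rule order_trans[of _ N]) auto
    ultimately have "?c (2 * n + 2) \<le> 3 * (ip ?J w w + s\<^sup>2)" using s by (metis ip_nonneg zero_less_power)
    then show ?thesis using True by simp
  next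
    case False
    then have n: "n \<ge> 1" by simp
    let ?y0 = "2 * real n * s"
    have y0: "?y0 > 0" using n s by simp
    show ?thesis
    proof (cases "ip ?J w w \<le> ?y0 ^ (2 * n) * ?N")
      case True
      have "?c (2 * n + 2) \<le> (2 * real n + 1) * ?N * (?y0 + s) ^ (2 * n)"
        by (rule main[OF y0 True])
      also have "\<dots> \<le> (2 * real n + 1) * s\<^sup>2 * (3 * ?y0 ^ (2 * n))"
        using N s y0 n by (intro mult_mono pow3) auto
      also have "\<dots> \<le> 3 * (2 * real n + 1) * (ip ?J w w + s\<^sup>2 * ?y0 ^ (2 * n))"
        by (simp add: algebra_simps)
      finally show ?thesis .
    next
      case False
      \<comment> \<open>A vanishing column would make w vanish, against the failed inequality; hence
        the ratio that defines y makes sense.\<close>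
      have "ip ?J w w \<le> hs ?J (?A ^^ n) (?A ^^ n) * ?N"
        unfolding w_def by (rule hs_funpow_bound[OF fin A])
      then have "?N \<noteq> 0" using False by (metis mult_zero_right)
      then have N0: "?N > 0" by (simp add: order_less_le)
      define y where "y = root (2 * n) (ip ?J w w / ?N)"
      have ypow: "y ^ (2 * n) = ip ?J w w / ?N" unfolding y_def using n N0 by (intro real_root_pow_pos2) auto
      have "?y0 ^ (2 * n) < y ^ (2 * n)" unfolding ypow using False N0 by (simp add: field_simps)
      moreover have "y \<ge> 0" unfolding y_def by (intro real_root_ge_zero divide_nonneg_nonneg ip_nonneg)
      ultimately have y: "?y0 < y" using y0 power_less_imp_less_base by blast
      have "?c (2 * n + 2) \<le> (2 * real n + 1) * ?N * (y + s) ^ (2 * n)"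
        using less_trans[OF y0 y] N0 by (intro main) (auto simp: ypow)
      also have "\<dots> \<le> (2 * real n + 1) * ?N * (3 * y ^ (2 * n))"
        using y n N0 by (intro mult_left_mono pow3) auto
      also have "\<dots> = 3 * (2 * real n + 1) * ip ?J w w"
        unfolding ypow using N0 by simp
      also have "\<dots> \<le> 3 * (2 * real n + 1) * (ip ?J w w + s\<^sup>2 * ?y0 ^ (2 * n))"
        using s by (intro mult_left_mono) auto
      finally show ?thesis .
    qed
  qed
qed

lemma hs_funpow_diag:
  assumes "finite I" "sadj I T"
  shows "hs I (T ^^ n) (T ^^ n) = (\<Sum>l\<in>I. (T ^^ (2 * n)) (bvec l) l)"
  unfolding hs_def
proof (intro sum.cong refl)
  fix l assume l: "l \<in> I"
  have "ip I ((T ^^ n) (bvec l)) ((T ^^ n) (bvec l)) = ip I (bvec l) ((T ^^ (2 * n)) (bvec l))"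
    by (simp add: ip_funpow[OF assms(2)] mult_2 funpow_add)
  then show "ip I ((T ^^ n) (bvec l)) ((T ^^ n) (bvec l)) = (T ^^ (2 * n)) (bvec l) l"
    by (metis ip_commute ip_bvec assms(1) l)
qed

text \<open>The trace of the power 2n + 2 is a sum of diagonal entries, and each of them is bounded
  by excursions that avoid its own index.\<close>

lemma hs_funpow_recursion:
  assumes I: "finite I" and K: "\<And>l h. l \<in> I \<Longrightarrow> h \<in> I \<Longrightarrow> K h l = K l h" "\<And>i. i \<in> I \<Longrightarrow> K i i = 0"
    and s: "s > 0" and N: "\<And>i. i \<in> I \<Longrightarrow> ip (I - {i}) (\<lambda>l. K l i) (\<lambda>l. K l i) \<le> s\<^sup>2"
  shows "hs I (mv I K ^^ Suc n) (mv I K ^^ Suc n)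
    \<le> (\<Sum>i\<in>I. 3 * (2 * real n + 1) *
         (ip (I - {i}) ((mv (I - {i}) K ^^ n) (\<lambda>l. K l i)) ((mv (I - {i}) K ^^ n) (\<lambda>l. K l i))
          + s\<^sup>2 * (2 * real n * s) ^ (2 * n)))"
proof -
  have T: "sadj I (mv I K)" by (rule sadj_mv[OF I]) (use K in auto)
  have "2 * Suc n = 2 * n + 2" by simp
  then show ?thesis
    unfolding hs_funpow_diag[OF I T] by (simp only:) (intro sum_mono diagonal_power_bound I K s N)
qed

section \<open>Traces with a repeated factor and differences of powers\<close>

lemma hs_abs_AMGM: "2 * \<bar>hs I S T\<bar> \<le> hs I S S + hs I T T"
proof -
  have "hs I (\<lambda>v i. - S v i) T = - hs I S T" "hs I (\<lambda>v i. - S v i) (\<lambda>v i. - S v i) = hs I S S"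
    by (simp_all add: hs_def ip_def sum_negf)
  then show ?thesis using hs_AMGM[of 1 I S T] hs_AMGM[of 1 I "\<lambda>v i. - S v i" T] by simp
qed

text \<open>A discrete three-lines argument: \<open>g a\<close>, the squared norm of X^a D Y^(n -
  a), is convex in a, since a factor X can be moved to one argument and a factor Y to the other. The
  trace with exponents q and r is such a square if both are even, and in absolute value at most the
  mean of two neighbouring ones if both are odd.\<close>

lemma hs_sandwich_bound:
  assumes I: "finite I" and D: "sadj I D" and X: "sadj I X" and Y: "sadj I Y" and qr: "q + r = 2 * n"
  shows "\<bar>hs I D ((X ^^ q) \<circ> D \<circ> (Y ^^ r))\<bar> \<le> hs I ((X ^^ n) \<circ> D) ((X ^^ n) \<circ> D) + hs I (D \<circ> (Y ^^ n)) (D \<circ> (Y ^^ n))"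
proof -
  define F where "F a b = (X ^^ a) \<circ> D \<circ> (Y ^^ b)" for a b
  define g where "g a = hs I (F a (n - a)) (F a (n - a))" for a
  have linF: "lin I (F a b)" for a b
    unfolding F_def using I D X Y by (intro lin_comp lin_funpow sadj_lin) auto
  have left: "hs I (F (a + a') b) T = hs I (F a b) ((X ^^ a') \<circ> T)" for a a' b T
    using hs_left[OF sadj_funpow[OF I X, of a'], of "F a b" T]
    by (simp add: F_def funpow_add comp_assoc add.commute[of a])
  have right: "hs I (F a (b + b')) T = hs I (F a b) (T \<circ> (Y ^^ b'))" if "lin I T" for a b b' T
    using hs_right[OF I sadj_funpow[OF I Y, of b'] linF[of a b] that]
    by (simp add: F_def funpow_add comp_assoc)
  have XF: "(X ^^ a') \<circ> F a b = F (a' + a) b" and FY: "F a b \<circ> (Y ^^ b') = F a (b + b')" for a a' b b'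
    by (simp_all add: F_def funpow_add comp_assoc)
  have conv: "2 * g a \<le> g (a - 1) + g (a + 1)" if a: "0 < a" "a < n" for a
  proof -
    obtain b where b: "a = Suc b" using a gr0_conv_Suc by auto
    obtain c where c: "n = Suc (Suc (b + c))" using a b
      by (metis add_Suc less_iff_Suc_add)
    have "g a = hs I (F (b + 1) (c + 1)) (F (b + 1) (c + 1))" by (simp add: g_def b c)
    also have "\<dots> = hs I (F b (c + 1)) (F (b + 2) c \<circ> (Y ^^ 1))"
      unfolding left FY XF by (simp add: numeral_2_eq_2)
    also have "\<dots> = hs I (F b (c + 2)) (F (b + 2) c)"
      using right[OF linF, of b "c + 1" 1 "b + 2" c] by simp
    finally have "2 * g a \<le> hs I (F b (c + 2)) (F b (c + 2)) + hs I (F (b + 2) c) (F (b + 2) c)"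
      using hs_AMGM[of 1 I "F b (c + 2)" "F (b + 2) c"] by simp
    then show ?thesis by (simp add: g_def b c)
  qed
  have g: "g a \<le> g 0 + g n" if "a \<le> n" for a
  proof -
    have "g a \<le> max (g 0) (g n)" using conv that by (rule discrete_convex_le_max)
    moreover have "g 0 \<ge> 0" "g n \<ge> 0" by (simp_all add: g_def)
    ultimately show ?thesis by linarith
  qed
  have D': "hs I D T = hs I (F 0 0) T" for T by (simp add: F_def)
  have eq: "hs I D ((X ^^ q) \<circ> D \<circ> (Y ^^ r)) = hs I (F a b) (F a' b')"
    if "q = a' + a" "r = b' + b" for a b a' b'
  proof -
    have "hs I (F a b) (F a' b') = hs I (F 0 b) ((X ^^ a) \<circ> F a' b')"
      using left[of 0 a b] by simp
    also have "\<dots> = hs I (F 0 0) (F (a + a') b' \<circ> (Y ^^ b))"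
      unfolding XF using right[OF linF, of 0 0 b] by simp
    finally show ?thesis unfolding FY D' using that by (simp add: F_def add.commute)
  qed
  have "\<bar>hs I D ((X ^^ q) \<circ> D \<circ> (Y ^^ r))\<bar> \<le> g 0 + g n"
  proof (cases "even q")
    case True
    then have "even r" using qr by presburger
    then obtain a b where ab: "q = a + a" "r = b + b" using True by (metis evenE mult_2)
    then have "n - a = b" "a \<le> n" using qr by auto
    then have "hs I D ((X ^^ q) \<circ> D \<circ> (Y ^^ r)) = g a" using eq[OF ab] by (simp add: g_def)
    moreover have "g a \<ge> 0" by (simp add: g_def)
    ultimately show ?thesis using g[OF \<open>a \<le> n\<close>] by simp
  next
    case False
    then have "odd r" using qr by presburger
    then obtain a b where ab: "q = a + (a + 1)" "r = (b + 1) + b" using False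
      by (metis oddE mult_2 add.assoc add.commute)
    then have n: "n - (a + 1) = b" "n - a = b + 1" "a \<le> n" "a + 1 \<le> n" using qr by auto
    have "2 * \<bar>hs I (F (a + 1) b) (F a (b + 1))\<bar> \<le> g (a + 1) + g a"
      unfolding g_def n by (rule hs_abs_AMGM)
    then show ?thesis using g[OF n(3)] g[OF n(4)] unfolding eq[OF ab] by linarith
  qed
  also have "g 0 + g n = hs I ((X ^^ n) \<circ> D) ((X ^^ n) \<circ> D) + hs I (D \<circ> (Y ^^ n)) (D \<circ> (Y ^^ n))"
    by (simp add: g_def F_def)
  finally show ?thesis .
qed

text \<open>Telescoping over the position at which X gives way to Y. The left vector w is arbitrary
  because the induction strips a factor X off to that side.\<close>

lemma ip_funpow_diff:
  assumes X: "sadj I X" and XY: "\<And>v i. i \<in> I \<Longrightarrow> X v i = Y v i + t * D v i"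
  shows "ip I w ((X ^^ N) v) - ip I w ((Y ^^ N) v) = t * (\<Sum>q<N. ip I w ((X ^^ q) (D ((Y ^^ (N - 1 - q)) v))))"
proof (induction N arbitrary: w)
  case (Suc N)
  have step: "ip I w (X u) = ip I w (Y u) + t * ip I w (D u)" for u
  proof -
    have "ip I w (X u) = ip I w (\<lambda>i. Y u i + t * D u i)" by (intro ip_cong refl XY)
    then show ?thesis by (simp add: ip_def sum.distrib sum_distrib_left algebra_simps)
  qed
  have "ip I w ((X ^^ Suc N) v) = ip I (X w) ((X ^^ N) v)"
    by (simp add: sadj_ip[OF X])
  also have "\<dots> = ip I (X w) ((Y ^^ N) v) + t * (\<Sum>q<N. ip I (X w) ((X ^^ q) (D ((Y ^^ (N - 1 - q)) v))))"
    using Suc[of "X w"] by simp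
  also have "\<dots> = ip I w (X ((Y ^^ N) v)) + t * (\<Sum>q<N. ip I w ((X ^^ Suc q) (D ((Y ^^ (N - 1 - q)) v))))"
    by (simp add: sadj_ip[OF X])
  finally show ?case
    unfolding step by (simp add: sum.lessThan_Suc_shift algebra_simps del: sum.lessThan_Suc)
qed simp

text \<open>Each term of the telescoped difference contains D a second time, with powers of X and Y
  of total exponent 2n around it, which is the shape of \<open>hs_sandwich_bound\<close>.\<close>

lemma hs_funpow_diff_bound:
  assumes I: "finite I" and D: "sadj I D" and X: "sadj I X" and Y: "sadj I Y"
    and XY: "\<And>v i. i \<in> I \<Longrightarrow> X v i = Y v i + t * D v i"
  shows "\<bar>hs I D (X ^^ (2 * n + 1)) - hs I D (Y ^^ (2 * n + 1))\<bar>
    \<le> \<bar>t\<bar> * (2 * real n + 1) * (hs I ((X ^^ n) \<circ> D) ((X ^^ n) \<circ> D) + hs I (D \<circ> (Y ^^ n)) (D \<circ> (Y ^^ n)))"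
proof -
  let ?M = "hs I ((X ^^ n) \<circ> D) ((X ^^ n) \<circ> D) + hs I (D \<circ> (Y ^^ n)) (D \<circ> (Y ^^ n))"
  have "hs I D (X ^^ (2 * n + 1)) - hs I D (Y ^^ (2 * n + 1)) =
    t * (\<Sum>q<2*n+1. hs I D ((X ^^ q) \<circ> D \<circ> (Y ^^ (2 * n - q))))"
  proof -
    have "ip I w ((X ^^ (2 * n + 1)) v) - ip I w ((Y ^^ (2 * n + 1)) v) =
      t * (\<Sum>q<2*n+1. ip I w ((X ^^ q) (D ((Y ^^ (2 * n - q)) v))))" for w v
      using ip_funpow_diff[where D = D, OF X, of Y t w "2 * n + 1" v] XY by simp
    then show ?thesis
      unfolding hs_def sum_subtractf[symmetric] by (subst sum.swap) (simp only: sum_distrib_left o_apply)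
  qed
  then have "\<bar>hs I D (X ^^ (2 * n + 1)) - hs I D (Y ^^ (2 * n + 1))\<bar>
     \<le> \<bar>t\<bar> * (\<Sum>q<2*n+1. \<bar>hs I D ((X ^^ q) \<circ> D \<circ> (Y ^^ (2 * n - q)))\<bar>)"
    by (simp add: abs_mult mult_left_mono sum_abs del: sum.lessThan_Suc)
  also have "\<dots> \<le> \<bar>t\<bar> * (\<Sum>q<2*n+1. ?M)"
    using I D X Y by (intro mult_left_mono sum_mono hs_sandwich_bound) auto
  finally show ?thesis by (simp add: algebra_simps)
qed

section \<open>A matrix Khintchine inequality\<close>

text \<open>Bounded measurable functions form an algebra and are integrable for every finite
  measure. The integrands of the Khintchine argument are polynomials in bounded coefficients, so
  this single predicate settles their integrability.\<close>

definition bmeas :: "'a measure \<Rightarrow> ('a \<Rightarrow> real) \<Rightarrow> bool" where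
  "bmeas M f \<longleftrightarrow> f \<in> borel_measurable M \<and> (\<exists>C. \<forall>x\<in>space M. \<bar>f x\<bar> \<le> C)"

lemma bmeas_measurable: "bmeas M f \<Longrightarrow> f \<in> borel_measurable M"
  by (simp add: bmeas_def)

lemma bmeas_const [intro]: "bmeas M (\<lambda>_. c)"
  by (auto simp: bmeas_def)

lemma bmeas_add [intro]:
  assumes "bmeas M f" "bmeas M g"
  shows "bmeas M (\<lambda>x. f x + g x)"
proof -
  obtain C D where C: "\<And>x. x \<in> space M \<Longrightarrow> \<bar>f x\<bar> \<le> C" "\<And>x. x \<in> space M \<Longrightarrow> \<bar>g x\<bar> \<le> D"
    using assms unfolding bmeas_def by blast
  have "\<bar>f x + g x\<bar> \<le> C + D" if "x \<in> space M" for x using C[OF that] by linarith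
  then show ?thesis using assms by (auto simp: bmeas_def)
qed

lemma bmeas_mult [intro]:
  assumes "bmeas M f" "bmeas M g"
  shows "bmeas M (\<lambda>x. f x * g x)"
proof -
  obtain C D where C: "\<And>x. x \<in> space M \<Longrightarrow> \<bar>f x\<bar> \<le> C" "\<And>x. x \<in> space M \<Longrightarrow> \<bar>g x\<bar> \<le> D"
    using assms unfolding bmeas_def by blast
  have "\<bar>f x * g x\<bar> \<le> C * D" if "x \<in> space M" for x
  proof -
    have "0 \<le> C" using C(1)[OF that] by linarith
    then show ?thesis unfolding abs_mult using C[OF that] by (intro mult_mono) auto
  qed
  then show ?thesis using assms by (auto simp: bmeas_def)
qed

lemma bmeas_sum [intro]: "(\<And>i. i \<in> I \<Longrightarrow> bmeas M (f i)) \<Longrightarrow> bmeas M (\<lambda>x. \<Sum>i\<in>I. f i x)"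
  by (induction I rule: infinite_finite_induct) auto

lemma bmeas_diff [intro]:
  assumes "bmeas M f" "bmeas M g"
  shows "bmeas M (\<lambda>x. f x - g x)"
  using bmeas_add[OF assms(1) bmeas_mult[OF bmeas_const[of M "-1"] assms(2)]] by simp

lemma bmeas_comp:
  assumes "bmeas N f" "g \<in> measurable M N"
  shows "bmeas M (\<lambda>x. f (g x))"
proof -
  obtain C where "\<And>x. x \<in> space N \<Longrightarrow> \<bar>f x\<bar> \<le> C" using assms by (auto simp: bmeas_def)
  then have "\<forall>x\<in>space M. \<bar>f (g x)\<bar> \<le> C" using measurable_space[OF assms(2)] by blast
  then show ?thesis using assms measurable_compose[OF assms(2)] by (auto simp: bmeas_def)
qed

lemma (in finite_measure) bmeas_integrable: "bmeas M f \<Longrightarrow> integrable M f"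
  unfolding bmeas_def using integrable_const_bound[of f] by (metis AE_I2 real_norm_def)

lemma mv_apply: "mv I A v i = (\<Sum>k\<in>I. A i k * v k)"
  by (simp add: mv_def)

lemma bmeas_mv_funpow:
  assumes "\<And>i k. i \<in> I \<Longrightarrow> k \<in> I \<Longrightarrow> bmeas M (\<lambda>x. A x i k)"
  shows "i \<in> I \<Longrightarrow> bmeas M (\<lambda>x. (mv I (A x) ^^ n) v i)"
proof (induction n arbitrary: i)
  case (Suc n)
  have "bmeas M (\<lambda>x. \<Sum>k\<in>I. A x i k * (mv I (A x) ^^ n) v k)"
    by (intro bmeas_sum bmeas_mult assms Suc)
  moreover have "(mv I (A x) ^^ Suc n) v i = (\<Sum>k\<in>I. A x i k * (mv I (A x) ^^ n) v k)" for x
    by (simp only: funpow.simps o_apply) (rule mv_apply)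
  ultimately show ?case by (simp only:)
qed auto

lemma bmeas_ip: "(\<And>i. i \<in> I \<Longrightarrow> bmeas M (\<lambda>x. v x i)) \<Longrightarrow> (\<And>i. i \<in> I \<Longrightarrow> bmeas M (\<lambda>x. w x i)) \<Longrightarrow>
    bmeas M (\<lambda>x. ip I (v x) (w x))"
  unfolding ip_def by (intro bmeas_sum bmeas_mult)

section \<open>Resampling one coordinate of a product measure\<close>

lemma resample_distr:
  assumes "prob_space \<mu>" "j \<in> J"
  shows "distr (\<mu> \<Otimes>\<^sub>M PiM J (\<lambda>_. \<mu>)) (PiM J (\<lambda>_. \<mu>)) (\<lambda>(y, \<xi>). \<xi>(j := y)) = PiM J (\<lambda>_. \<mu>)"
  using distr_pair_PiM_eq_PiM[of J "\<lambda>_. \<mu>" j] assms by (simp add: insert_absorb)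

lemma measurable_resample:
  assumes "j \<in> J"
  shows "(\<lambda>(y, \<xi>). \<xi>(j := y)) \<in> measurable (\<mu> \<Otimes>\<^sub>M PiM J (\<lambda>_. \<mu>)) (PiM J (\<lambda>_. \<mu>))"
proof -
  have "(\<lambda>p. (snd p)(j := fst p)) \<in> measurable (\<mu> \<Otimes>\<^sub>M PiM J (\<lambda>_. \<mu>)) (PiM J (\<lambda>_. \<mu>))"
    using assms by (intro measurable_fun_upd[where J = J]) (auto simp: insert_absorb)
  then show ?thesis by (simp add: case_prod_beta')
qed

text \<open>Fubini in one coordinate without splitting the index set: overwriting coordinate j by an
  independent copy preserves the law, so j can be averaged while the other coordinates stay
  fixed.\<close>

lemma resample_nn_integral:
  assumes "prob_space \<mu>" "j \<in> J" and f: "f \<in> borel_measurable (PiM J (\<lambda>_. \<mu>))"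
  shows "(\<integral>\<^sup>+\<xi>. f \<xi> \<partial>PiM J (\<lambda>_. \<mu>)) = (\<integral>\<^sup>+\<xi>. \<integral>\<^sup>+y. f (\<xi>(j := y)) \<partial>\<mu> \<partial>PiM J (\<lambda>_. \<mu>))"
proof -
  interpret mu: prob_space \<mu> by fact
  interpret Q: prob_space "PiM J (\<lambda>_. \<mu>)" by (intro prob_space_PiM assms)
  interpret P: pair_sigma_finite \<mu> "PiM J (\<lambda>_. \<mu>)" ..
  note [measurable] = measurable_resample[OF assms(2), of \<mu>] f
  have "(\<integral>\<^sup>+\<xi>. f \<xi> \<partial>PiM J (\<lambda>_. \<mu>)) = (\<integral>\<^sup>+p. f (case p of (y, \<xi>) \<Rightarrow> \<xi>(j := y)) \<partial>(\<mu> \<Otimes>\<^sub>M PiM J (\<lambda>_. \<mu>)))"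
    by (subst resample_distr[OF assms(1,2), symmetric]) (rule nn_integral_distr, measurable)
  also have "\<dots> = (\<integral>\<^sup>+\<xi>. \<integral>\<^sup>+y. f (\<xi>(j := y)) \<partial>\<mu> \<partial>PiM J (\<lambda>_. \<mu>))"
    by (subst P.nn_integral_snd[symmetric]) auto
  finally show ?thesis .
qed

lemma resample_integral:
  assumes "prob_space \<mu>" "j \<in> J" and f: "bmeas (PiM J (\<lambda>_. \<mu>)) f"
  shows "(\<integral>p. f ((snd p)(j := fst p)) \<partial>(\<mu> \<Otimes>\<^sub>M PiM J (\<lambda>_. \<mu>))) = (\<integral>\<xi>. f \<xi> \<partial>PiM J (\<lambda>_. \<mu>))"
    "bmeas (\<mu> \<Otimes>\<^sub>M PiM J (\<lambda>_. \<mu>)) (\<lambda>p. f ((snd p)(j := fst p)))"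
proof -
  have m: "(\<lambda>p. (snd p)(j := fst p)) \<in> measurable (\<mu> \<Otimes>\<^sub>M PiM J (\<lambda>_. \<mu>)) (PiM J (\<lambda>_. \<mu>))"
    using measurable_resample[OF assms(2), of \<mu>] by (simp add: case_prod_beta')
  have "(\<integral>\<xi>. f \<xi> \<partial>PiM J (\<lambda>_. \<mu>)) = (\<integral>\<xi>. f \<xi> \<partial>distr (\<mu> \<Otimes>\<^sub>M PiM J (\<lambda>_. \<mu>)) (PiM J (\<lambda>_. \<mu>)) (\<lambda>p. (snd p)(j := fst p)))"
    using resample_distr[OF assms(1,2)] by (simp add: case_prod_beta')
  also have "\<dots> = (\<integral>p. f ((snd p)(j := fst p)) \<partial>(\<mu> \<Otimes>\<^sub>M PiM J (\<lambda>_. \<mu>)))"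
    by (rule integral_distr[OF m bmeas_measurable[OF f]])
  finally show "(\<integral>p. f ((snd p)(j := fst p)) \<partial>(\<mu> \<Otimes>\<^sub>M PiM J (\<lambda>_. \<mu>))) = (\<integral>\<xi>. f \<xi> \<partial>PiM J (\<lambda>_. \<mu>))" ..
  show "bmeas (\<mu> \<Otimes>\<^sub>M PiM J (\<lambda>_. \<mu>)) (\<lambda>p. f ((snd p)(j := fst p)))" by (rule bmeas_comp[OF f m])
qed

lemma integral_snd_coordinate:
  assumes "prob_space \<mu>" "prob_space Q" and f: "bmeas Q f"
  shows "(\<integral>p. f (snd p) \<partial>(\<mu> \<Otimes>\<^sub>M Q)) = (\<integral>\<xi>. f \<xi> \<partial>Q)" "bmeas (\<mu> \<Otimes>\<^sub>M Q) (\<lambda>p. f (snd p))"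
proof -
  interpret mu: prob_space \<mu> by fact
  interpret Q: prob_space Q by fact
  interpret P: pair_prob_space \<mu> Q ..
  show b: "bmeas (\<mu> \<Otimes>\<^sub>M Q) (\<lambda>p. f (snd p))" by (rule bmeas_comp[OF f]) simp
  have "integrable (\<mu> \<Otimes>\<^sub>M Q) (\<lambda>(y, \<xi>). f \<xi>)"
    using P.P.bmeas_integrable[OF b] by (simp add: case_prod_beta')
  from P.integral_snd[OF this] show "(\<integral>p. f (snd p) \<partial>(\<mu> \<Otimes>\<^sub>M Q)) = (\<integral>\<xi>. f \<xi> \<partial>Q)"
    by (simp add: case_prod_beta' mu.prob_space)
qed

text \<open>Once the copy y has been integrated out, the function F does not depend on coordinate j,
  and the centered factor \<beta> of that coordinate splits off. This is the comparison term that
  \<open>Khintchine_step\<close> subtracts for free.\<close>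

lemma decoupled_integral_zero:
  assumes "prob_space \<mu>" "j \<in> J" and h: "bmeas (PiM J (\<lambda>_. \<mu>)) h"
    and \<beta>: "bmeas \<mu> \<beta>" "(\<integral>y. \<beta> y \<partial>\<mu>) = 0"
  shows "(\<integral>p. \<beta> (snd p j) * h ((snd p)(j := fst p)) \<partial>(\<mu> \<Otimes>\<^sub>M PiM J (\<lambda>_. \<mu>))) = 0"
proof -
  let ?Q = "PiM J (\<lambda>_. \<mu>)"
  interpret mu: prob_space \<mu> by fact
  interpret Q: prob_space ?Q by (intro prob_space_PiM assms)
  interpret P: pair_prob_space \<mu> ?Q ..
  define F where "F \<xi> = (\<integral>y. h (\<xi>(j := y)) \<partial>\<mu>)" for \<xi>
  obtain C where C: "\<And>\<xi>. \<xi> \<in> space ?Q \<Longrightarrow> \<bar>h \<xi>\<bar> \<le> C" using h by (auto simp: bmeas_def)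
  note hb = resample_integral(2)[OF assms(1,2) h]
  have upd: "\<xi>(j := y) \<in> space ?Q" if "\<xi> \<in> space ?Q" "y \<in> space \<mu>" for \<xi> y
    using that assms(2) by (auto simp: space_PiM PiE_iff extensional_def)
  have "(\<lambda>(\<xi>, y). h (\<xi>(j := y))) \<in> borel_measurable (?Q \<Otimes>\<^sub>M \<mu>)"
  proof -
    have "(\<lambda>q. (\<lambda>p. h ((snd p)(j := fst p))) (snd q, fst q)) \<in> borel_measurable (?Q \<Otimes>\<^sub>M \<mu>)"
      by (rule measurable_compose[OF _ bmeas_measurable[OF hb]]) simp
    then show ?thesis by (simp add: case_prod_beta')
  qed
  then have Fm: "F \<in> borel_measurable ?Q"
    unfolding F_def by (rule mu.borel_measurable_lebesgue_integral)
  have "\<bar>F \<xi>\<bar> \<le> C" if "\<xi> \<in> space ?Q" for \<xi>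
  proof -
    have i: "integrable \<mu> (\<lambda>y. h (\<xi>(j := y)))"
    proof (rule mu.bmeas_integrable, unfold bmeas_def, intro conjI exI ballI)
      have "(\<lambda>y. (y, \<xi>)) \<in> measurable \<mu> (\<mu> \<Otimes>\<^sub>M ?Q)" using that by simp
      from measurable_compose[OF this bmeas_measurable[OF hb]]
      show "(\<lambda>y. h (\<xi>(j := y))) \<in> borel_measurable \<mu>" by simp
    qed (use C upd that in auto)
    have "\<bar>F \<xi>\<bar> \<le> (\<integral>y. \<bar>h (\<xi>(j := y))\<bar> \<partial>\<mu>)" unfolding F_def by (rule integral_abs_bound)
    also have "\<dots> \<le> (\<integral>y. C \<partial>\<mu>)" using i C upd[OF that] by (intro integral_mono) auto
    finally show ?thesis by (simp add: mu.prob_space)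
  qed
  then have Fb: "bmeas ?Q F" using Fm by (auto simp: bmeas_def)
  have \<beta>c: "bmeas ?Q (\<lambda>\<xi>. \<beta> (\<xi> j))" using assms(2) by (intro bmeas_comp[OF \<beta>(1)]) simp
  have \<beta>s: "bmeas (\<mu> \<Otimes>\<^sub>M ?Q) (\<lambda>p. \<beta> (snd p j))" by (rule integral_snd_coordinate(2)[OF assms(1) _ \<beta>c]) unfold_locales
  have "integrable (\<mu> \<Otimes>\<^sub>M ?Q) (\<lambda>(y, \<xi>). \<beta> (\<xi> j) * h (\<xi>(j := y)))"
    using P.P.bmeas_integrable[OF bmeas_mult[OF \<beta>s hb]] by (simp add: case_prod_beta')
  from P.integral_snd[OF this]
  have "(\<integral>p. \<beta> (snd p j) * h ((snd p)(j := fst p)) \<partial>(\<mu> \<Otimes>\<^sub>M ?Q)) = (\<integral>\<xi>. \<beta> (\<xi> j) * F \<xi> \<partial>?Q)"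
    by (simp add: case_prod_beta' F_def)
  \<comment> \<open>Coordinate j is resampled a second time: \<open>F\<close> ignores it, so \<beta>
    and \<open>F\<close> now live on independent factors.\<close>
  also have "\<dots> = (\<integral>p. \<beta> (((snd p)(j := fst p)) j) * F ((snd p)(j := fst p)) \<partial>(\<mu> \<Otimes>\<^sub>M ?Q))"
    by (rule resample_integral(1)[OF assms(1,2), symmetric]) (intro bmeas_mult \<beta>c Fb)
  also have "\<dots> = (\<integral>p. \<beta> (fst p) * F (snd p) \<partial>(\<mu> \<Otimes>\<^sub>M ?Q))" by (simp add: F_def)
  also have "\<dots> = (\<integral>\<xi>. (\<integral>y. \<beta> y * F \<xi> \<partial>\<mu>) \<partial>?Q)"
  proof -
    have "bmeas (\<mu> \<Otimes>\<^sub>M ?Q) (\<lambda>p. \<beta> (fst p) * F (snd p))"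
      by (intro bmeas_mult bmeas_comp[OF \<beta>(1)] bmeas_comp[OF Fb]) auto
    then have "integrable (\<mu> \<Otimes>\<^sub>M ?Q) (\<lambda>(y, \<xi>). \<beta> y * F \<xi>)"
      using P.P.bmeas_integrable by (simp add: case_prod_beta')
    from P.integral_snd[OF this] show ?thesis by (simp add: case_prod_beta')
  qed
  also have "\<dots> = 0" using \<beta>(2) by simp
  finally show ?thesis .
qed

section \<open>The moment recursion for random sums of matrices\<close>

lemma hs_mv_funpow_odd:
  assumes I: "finite I" and T: "sadj I (mv I (\<lambda>i k. \<Sum>j\<in>J. c j * A j i k))"
  defines "X \<equiv> mv I (\<lambda>i k. \<Sum>j\<in>J. c j * A j i k)"
  shows "hs I (X ^^ Suc n) (X ^^ Suc n) = (\<Sum>j\<in>J. c j * hs I (mv I (A j)) (X ^^ (2 * n + 1)))"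
proof -
  note T = T[folded X_def]
  have "hs I ((X ^^ n) \<circ> X) (X ^^ Suc n) = hs I X (X ^^ (2 * n + 1))"
    using hs_left[OF sadj_funpow[OF I T, of n], of X "X ^^ Suc n"]
    by (simp only: funpow_add[symmetric]) (simp add: mult_2)
  moreover have "X v i = (\<Sum>j\<in>J. c j * mv I (A j) v i)" for v i
    unfolding X_def mv_def sum_distrib_left sum_distrib_right
    by (subst sum.swap) (simp add: mult_ac)
  then have "hs I X T = (\<Sum>j\<in>J. c j * hs I (mv I (A j)) T)" for T
  proof -
    have "ip I (X v) w = (\<Sum>j\<in>J. c j * ip I (mv I (A j) v) w)" for v w
      using ip_sum_right[of I w c "\<lambda>j. mv I (A j) v" J] \<open>\<And>v i. X v i = _\<close>
      by (simp add: ip_commute[of I w] ip_def mult.commute)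
    then show ?thesis unfolding hs_def sum_distrib_left by (subst sum.swap) simp
  qed
  ultimately show ?thesis by (simp only: funpow_Suc_right)
qed

text \<open>An exchangeable pair takes the place of integration by parts. One factor of the trace of
  X^(2n + 2) is expanded into the \<open>A j\<close>; subtracting the same expression with
  coordinate j resampled costs nothing, and the difference of the odd powers brings in a second
  \<open>A j\<close>. The bound 4 B^2 combines \<bar>\<beta>\<bar> at most B, a change of \<beta> by
  at most 2 B, and two terms of equal law; summation over j produces \<sigma>.\<close>

lemma Khintchine_step:
  fixes A :: "'j \<Rightarrow> 'a \<Rightarrow> 'a \<Rightarrow> real"
  assumes \<mu>: "prob_space \<mu>" and fin: "finite I" "finite J"
    and \<beta>: "\<beta> \<in> borel_measurable \<mu>" "\<And>y. \<bar>\<beta> y\<bar> \<le> B" "(\<integral>y. \<beta> y \<partial>\<mu>) = 0"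
    and A: "\<And>j i k. j \<in> J \<Longrightarrow> i \<in> I \<Longrightarrow> k \<in> I \<Longrightarrow> A j i k = A j k i"
    and \<sigma>: "\<And>v. (\<Sum>j\<in>J. ip I (mv I (A j) v) (mv I (A j) v)) \<le> \<sigma> * ip I v v"
  defines "X \<equiv> \<lambda>\<xi>. mv I (\<lambda>i k. \<Sum>j\<in>J. \<beta> (\<xi> j) * A j i k)"
  shows "(\<integral>\<xi>. hs I (X \<xi> ^^ Suc n) (X \<xi> ^^ Suc n) \<partial>PiM J (\<lambda>_. \<mu>))
    \<le> 4 * B\<^sup>2 * (2 * real n + 1) * \<sigma> * (\<integral>\<xi>. hs I (X \<xi> ^^ n) (X \<xi> ^^ n) \<partial>PiM J (\<lambda>_. \<mu>))"
    and "bmeas (PiM J (\<lambda>_. \<mu>)) (\<lambda>\<xi>. hs I (X \<xi> ^^ n) (X \<xi> ^^ n))"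
proof -
  let ?Q = "PiM J (\<lambda>_. \<mu>)" and ?D = "\<lambda>j. mv I (A j)"
  interpret mu: prob_space \<mu> by fact
  interpret Q: prob_space ?Q by (intro prob_space_PiM \<mu>)
  interpret P: pair_prob_space \<mu> ?Q ..
  have B0: "0 \<le> B" using \<beta>(2)[of undefined] by linarith
  have \<beta>b: "bmeas \<mu> \<beta>" using \<beta> by (auto simp: bmeas_def)
  have \<beta>c: "bmeas ?Q (\<lambda>\<xi>. \<beta> (\<xi> j))" if "j \<in> J" for j
    using that by (intro bmeas_comp[OF \<beta>b]) simp
  have Xb: "bmeas ?Q (\<lambda>\<xi>. (X \<xi> ^^ n) v i)" if "i \<in> I" for n v i
    unfolding X_def
    by (rule bmeas_mv_funpow[OF _ that]) (intro bmeas_sum bmeas_mult bmeas_const \<beta>c)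
  have D: "sadj I (?D j)" if "j \<in> J" for j
    by (rule sadj_mv[OF fin(1)]) (use A that in auto)
  have X: "sadj I (X \<xi>)" for \<xi>
    unfolding X_def by (rule sadj_mv[OF fin(1)]) (use A in \<open>auto intro!: sum.cong\<close>)
  have Tb: "bmeas ?Q (\<lambda>\<xi>. hs I (X \<xi> ^^ n) (X \<xi> ^^ n))" for n
    unfolding hs_def by (intro bmeas_sum bmeas_ip Xb)
  then show "bmeas ?Q (\<lambda>\<xi>. hs I (X \<xi> ^^ n) (X \<xi> ^^ n))" .
  have DXb: "bmeas ?Q (\<lambda>\<xi>. hs I (?D j) (X \<xi> ^^ n))" for j n
    unfolding hs_def by (intro bmeas_sum bmeas_ip Xb) auto
  have mvb: "bmeas M (\<lambda>\<xi>. mv I B (v \<xi>) i)" if "\<And>i. i \<in> I \<Longrightarrow> bmeas M (\<lambda>\<xi>. v \<xi> i)" for M B i and v :: "'z \<Rightarrow> 'a \<Rightarrow> real"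
    unfolding mv_def using that by (intro bmeas_sum bmeas_mult) auto
  define H where "H j \<xi> = hs I (?D j \<circ> (X \<xi> ^^ n)) (?D j \<circ> (X \<xi> ^^ n))" for j \<xi>
  have Hb: "bmeas ?Q (H j)" for j
    unfolding H_def hs_def comp_def by (intro bmeas_sum bmeas_ip mvb Xb)
  have H0: "0 \<le> H j \<xi>" for j \<xi> by (simp add: H_def)
  define N where "N = 2 * n + 1"
  have one: "(\<integral>\<xi>. \<beta> (\<xi> j) * hs I (?D j) (X \<xi> ^^ N) \<partial>?Q) \<le> 4 * B\<^sup>2 * (2 * real n + 1) * (\<integral>\<xi>. H j \<xi> \<partial>?Q)"
    if j: "j \<in> J" for j
  proof -
    let ?h = "\<lambda>\<xi>. hs I (?D j) (X \<xi> ^^ N)" and ?u = "\<lambda>p. (snd p)(j := fst p)"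
    note s1 = integral_snd_coordinate[OF \<mu> Q.prob_space_axioms]
    have b1: "bmeas (\<mu> \<Otimes>\<^sub>M ?Q) (\<lambda>p. \<beta> (snd p j) * ?h (snd p))"
      by (rule s1(2)) (intro bmeas_mult \<beta>c j DXb)
    have b2: "bmeas (\<mu> \<Otimes>\<^sub>M ?Q) (\<lambda>p. \<beta> (snd p j) * ?h (?u p))"
      by (intro bmeas_mult s1(2)[OF \<beta>c[OF j]] resample_integral(2)[OF \<mu> j DXb])
    have b3: "bmeas (\<mu> \<Otimes>\<^sub>M ?Q) (\<lambda>p. H j (snd p))" by (rule s1(2)[OF Hb])
    have b4: "bmeas (\<mu> \<Otimes>\<^sub>M ?Q) (\<lambda>p. H j (?u p))" by (rule resample_integral(2)[OF \<mu> j Hb])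
    have "(\<integral>\<xi>. \<beta> (\<xi> j) * ?h \<xi> \<partial>?Q) = (\<integral>p. \<beta> (snd p j) * ?h (snd p) \<partial>(\<mu> \<Otimes>\<^sub>M ?Q))"
      by (rule s1(1)[symmetric]) (intro bmeas_mult \<beta>c j DXb)
    also have "\<dots> = (\<integral>p. \<beta> (snd p j) * ?h (snd p) \<partial>(\<mu> \<Otimes>\<^sub>M ?Q)) - (\<integral>p. \<beta> (snd p j) * ?h (?u p) \<partial>(\<mu> \<Otimes>\<^sub>M ?Q))"
      using decoupled_integral_zero[OF \<mu> j DXb \<beta>b \<beta>(3)] by simp
    also have "\<dots> = (\<integral>p. \<beta> (snd p j) * ?h (snd p) - \<beta> (snd p j) * ?h (?u p) \<partial>(\<mu> \<Otimes>\<^sub>M ?Q))"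
      by (rule Bochner_Integration.integral_diff[symmetric]) (intro P.P.bmeas_integrable b1 b2)+
    also have "\<dots> \<le> (\<integral>p. 2 * B\<^sup>2 * (2 * real n + 1) * (H j (snd p) + H j (?u p)) \<partial>(\<mu> \<Otimes>\<^sub>M ?Q))"
    proof (intro integral_mono P.P.bmeas_integrable bmeas_diff b1 b2 bmeas_mult bmeas_const bmeas_add b3 b4)
      fix p assume "p \<in> space (\<mu> \<Otimes>\<^sub>M ?Q)"
      define \<xi> y where "\<xi> = snd p" and "y = fst p"
      let ?Y = "X (\<xi>(j := y))" and ?t = "\<beta> (\<xi> j) - \<beta> y"
      have XY: "X \<xi> v i = ?Y v i + ?t * ?D j v i" for v i
      proof -
        have "(\<Sum>l\<in>J. \<beta> (\<xi> l) * A l i k) = (\<Sum>l\<in>J. \<beta> ((\<xi>(j := y)) l) * A l i k) + ?t * A j i k" for k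
          by (simp add: sum.remove[OF fin(2) j] algebra_simps)
        then show ?thesis by (simp add: X_def mv_def distrib_right sum.distrib sum_distrib_left mult.assoc)
      qed
      \<comment> \<open>In one of the two terms the power stands to the left of \<open>?D j\<close>.
        Exchanging the factors under the norm gives both terms the form \<open>H j\<close>, and this
        makes them identically distributed.\<close>
      have swap: "hs I ((X \<xi> ^^ n) \<circ> ?D j) ((X \<xi> ^^ n) \<circ> ?D j) = H j \<xi>"
        unfolding H_def by (rule hs_comp_swap[OF fin(1) D[OF j] sadj_funpow[OF fin(1) X]])
      have "\<beta> (\<xi> j) * ?h \<xi> - \<beta> (\<xi> j) * ?h (\<xi>(j := y)) \<le> \<bar>\<beta> (\<xi> j)\<bar> * \<bar>?h \<xi> - ?h (\<xi>(j := y))\<bar>"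
        by (metis abs_ge_self abs_mult right_diff_distrib)
      also have "\<dots> \<le> B * (\<bar>?t\<bar> * (2 * real n + 1) * (H j \<xi> + H j (\<xi>(j := y))))"
        using hs_funpow_diff_bound[OF fin(1) D[OF j] X X XY, of n, folded N_def] \<beta>(2) B0
        unfolding swap by (intro mult_mono) (auto simp: H_def)
      also have "\<dots> \<le> B * ((2 * B) * (2 * real n + 1) * (H j \<xi> + H j (\<xi>(j := y))))"
        using \<beta>(2)[of "\<xi> j"] \<beta>(2)[of y] B0 H0[of j]
        by (intro mult_left_mono mult_right_mono) (auto intro: add_nonneg_nonneg)
      finally show "\<beta> (snd p j) * ?h (snd p) - \<beta> (snd p j) * ?h (?u p)
          \<le> 2 * B\<^sup>2 * (2 * real n + 1) * (H j (snd p) + H j (?u p))"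
        by (simp add: \<xi>_def y_def power2_eq_square mult_ac)
    qed
    also have "\<dots> = 2 * B\<^sup>2 * (2 * real n + 1) * ((\<integral>p. H j (snd p) \<partial>(\<mu> \<Otimes>\<^sub>M ?Q)) + (\<integral>p. H j (?u p) \<partial>(\<mu> \<Otimes>\<^sub>M ?Q)))"
      by (subst Bochner_Integration.integral_add[symmetric]) (auto intro: P.P.bmeas_integrable b3 b4)
    also have "\<dots> = 4 * B\<^sup>2 * (2 * real n + 1) * (\<integral>\<xi>. H j \<xi> \<partial>?Q)"
      unfolding s1(1)[OF Hb] resample_integral(1)[OF \<mu> j Hb] by simp
    finally show ?thesis .
  qed
  have "(\<integral>\<xi>. hs I (X \<xi> ^^ Suc n) (X \<xi> ^^ Suc n) \<partial>?Q) = (\<integral>\<xi>. (\<Sum>j\<in>J. \<beta> (\<xi> j) * hs I (?D j) (X \<xi> ^^ N)) \<partial>?Q)"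
    unfolding X_def N_def by (subst hs_mv_funpow_odd[OF fin(1) X[unfolded X_def]]) (rule refl)
  also have "\<dots> = (\<Sum>j\<in>J. (\<integral>\<xi>. \<beta> (\<xi> j) * hs I (?D j) (X \<xi> ^^ N) \<partial>?Q))"
    by (intro Bochner_Integration.integral_sum Q.bmeas_integrable bmeas_mult \<beta>c DXb)
  also have "\<dots> \<le> (\<Sum>j\<in>J. 4 * B\<^sup>2 * (2 * real n + 1) * (\<integral>\<xi>. H j \<xi> \<partial>?Q))"
    by (intro sum_mono one)
  also have "\<dots> = 4 * B\<^sup>2 * (2 * real n + 1) * (\<integral>\<xi>. (\<Sum>j\<in>J. H j \<xi>) \<partial>?Q)"
    by (subst Bochner_Integration.integral_sum) (auto intro: Q.bmeas_integrable Hb simp: sum_distrib_left)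
  also have "\<dots> \<le> 4 * B\<^sup>2 * (2 * real n + 1) * (\<integral>\<xi>. \<sigma> * hs I (X \<xi> ^^ n) (X \<xi> ^^ n) \<partial>?Q)"
  proof (intro mult_left_mono integral_mono Q.bmeas_integrable bmeas_sum Hb bmeas_mult bmeas_const Tb)
    fix \<xi>
    have "(\<Sum>j\<in>J. H j \<xi>) = (\<Sum>l\<in>I. \<Sum>j\<in>J. ip I (?D j ((X \<xi> ^^ n) (bvec l))) (?D j ((X \<xi> ^^ n) (bvec l))))"
      unfolding H_def hs_def by (subst sum.swap) simp
    also have "\<dots> \<le> (\<Sum>l\<in>I. \<sigma> * ip I ((X \<xi> ^^ n) (bvec l)) ((X \<xi> ^^ n) (bvec l)))"
      by (intro sum_mono \<sigma>)
    finally show "(\<Sum>j\<in>J. H j \<xi>) \<le> \<sigma> * hs I (X \<xi> ^^ n) (X \<xi> ^^ n)" by (simp add: hs_def sum_distrib_left)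
  qed simp
  finally show "(\<integral>\<xi>. hs I (X \<xi> ^^ Suc n) (X \<xi> ^^ Suc n) \<partial>?Q)
    \<le> 4 * B\<^sup>2 * (2 * real n + 1) * \<sigma> * (\<integral>\<xi>. hs I (X \<xi> ^^ n) (X \<xi> ^^ n) \<partial>?Q)" by simp
qed

text \<open>Below N the factor 2 n + 1 of each step is at most 2 N, and the trace of the identity
  contributes the dimension. With N of the order of its logarithm, the dimension becomes a constant
  after the root is taken.\<close>

lemma Khintchine_moment:
  fixes A :: "'j \<Rightarrow> 'a \<Rightarrow> 'a \<Rightarrow> real"
  assumes \<mu>: "prob_space \<mu>" and fin: "finite I" "finite J"
    and \<beta>: "\<beta> \<in> borel_measurable \<mu>" "\<And>y. \<bar>\<beta> y\<bar> \<le> B" "(\<integral>y. \<beta> y \<partial>\<mu>) = 0"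
    and A: "\<And>j i k. j \<in> J \<Longrightarrow> i \<in> I \<Longrightarrow> k \<in> I \<Longrightarrow> A j i k = A j k i"
    and \<sigma>: "\<And>v. (\<Sum>j\<in>J. ip I (mv I (A j) v) (mv I (A j) v)) \<le> \<sigma> * ip I v v" "0 \<le> \<sigma>"
  defines "X \<equiv> \<lambda>\<xi>. mv I (\<lambda>i k. \<Sum>j\<in>J. \<beta> (\<xi> j) * A j i k)"
  shows "n \<le> N \<Longrightarrow> (\<integral>\<xi>. hs I (X \<xi> ^^ n) (X \<xi> ^^ n) \<partial>PiM J (\<lambda>_. \<mu>)) \<le> real (card I) * (8 * B\<^sup>2 * real N * \<sigma>) ^ n"
proof (induction n)
  case 0
  interpret Q: prob_space "PiM J (\<lambda>_. \<mu>)" by (intro prob_space_PiM \<mu>)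
  have bvec_self: "bvec l l = 1" for l :: 'a by (simp add: bvec_def)
  have "hs I (\<lambda>v. v) (\<lambda>v. v) = real (card I)"
    using fin(1) bvec_self by (simp add: hs_def ip_bvec)
  then show ?case by (simp add: Q.prob_space id_def)
next
  case (Suc n)
  have pos: "0 \<le> (\<integral>\<xi>. hs I (X \<xi> ^^ n) (X \<xi> ^^ n) \<partial>PiM J (\<lambda>_. \<mu>))"
    by (intro integral_nonneg_AE) simp
  have "(\<integral>\<xi>. hs I (X \<xi> ^^ Suc n) (X \<xi> ^^ Suc n) \<partial>PiM J (\<lambda>_. \<mu>))
    \<le> 4 * B\<^sup>2 * (2 * real n + 1) * \<sigma> * (\<integral>\<xi>. hs I (X \<xi> ^^ n) (X \<xi> ^^ n) \<partial>PiM J (\<lambda>_. \<mu>))"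
    unfolding X_def by (rule Khintchine_step(1)[OF \<mu> fin \<beta> A \<sigma>(1)])
  also have "\<dots> \<le> 4 * B\<^sup>2 * (2 * real N) * \<sigma> * (real (card I) * (8 * B\<^sup>2 * real N * \<sigma>) ^ n)"
    using Suc.prems \<sigma>(2) pos by (intro mult_mono Suc.IH) auto
  also have "\<dots> = real (card I) * (8 * B\<^sup>2 * real N * \<sigma>) ^ Suc n" by simp
  finally show ?case .
qed

section \<open>Gaussian moments and tails\<close>

abbreviation gauss1 :: "real measure" where
  "gauss1 \<equiv> density lborel (\<lambda>t. ennreal (std_normal_density t))"

lemma prob_space_gauss1: "prob_space gauss1"
  by (rule prob_space_normal_density) simp

lemma product_sigma_finite_gauss1: "product_sigma_finite (\<lambda>_. gauss1)"
  by (simp add: product_sigma_finite_def prob_space_gauss1 prob_space_imp_sigma_finite)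

lemma nn_integral_normal_density: "\<sigma> > 0 \<Longrightarrow> (\<integral>\<^sup>+x. ennreal (normal_density m \<sigma> x) \<partial>lborel) = 1"
  by (subst nn_integral_eq_integral) (auto simp: integral_normal_density)

section \<open>Exponential moments of a single Gaussian variable\<close>

lemma gauss1_mgf_linear: "(\<integral>\<^sup>+x. ennreal (exp (l * x)) \<partial>gauss1) = ennreal (exp (l\<^sup>2 / 2))"
proof -
  have eq: "std_normal_density x * exp (l * x) = exp (l\<^sup>2 / 2) * normal_density l 1 x" for x
  proof -
    have "- x\<^sup>2 / 2 + l * x = l\<^sup>2 / 2 + - (x - l)\<^sup>2 / 2" by (simp add: power2_eq_square field_simps)
    then have "exp (- x\<^sup>2 / 2) * exp (l * x) = exp (l\<^sup>2 / 2) * exp (- (x - l)\<^sup>2 / 2)"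
      by (simp only: exp_add[symmetric])
    then show ?thesis by (simp add: normal_density_def field_simps)
  qed
  have "(\<integral>\<^sup>+x. ennreal (exp (l * x)) \<partial>gauss1) = (\<integral>\<^sup>+x. ennreal (std_normal_density x * exp (l * x)) \<partial>lborel)"
    by (subst nn_integral_density) (auto simp: ennreal_mult)
  also have "\<dots> = ennreal (exp (l\<^sup>2 / 2)) * (\<integral>\<^sup>+x. ennreal (normal_density l 1 x) \<partial>lborel)"
    unfolding eq by (subst nn_integral_cmult[symmetric]) (auto simp: ennreal_mult)
  finally show ?thesis by (simp add: nn_integral_normal_density)
qed

text \<open>The factor exp (s x^2) turns the density into a multiple of the centered normal density
  of variance 1 / (1 - 2 s), and that multiple is the integral.\<close>

lemma gauss1_mgf_square:
  assumes "s < 1 / 2"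
  shows "(\<integral>\<^sup>+x. ennreal (exp (s * x\<^sup>2)) \<partial>gauss1) = ennreal (1 / sqrt (1 - 2 * s))"
proof -
  define \<sigma> where "\<sigma> = 1 / sqrt (1 - 2 * s)"
  have \<sigma>: "\<sigma> > 0" "\<sigma>\<^sup>2 = 1 / (1 - 2 * s)" using assms by (auto simp: \<sigma>_def power_divide)
  have eq: "std_normal_density x * exp (s * x\<^sup>2) = \<sigma> * normal_density 0 \<sigma> x" for x
  proof -
    have "- x\<^sup>2 / 2 + s * x\<^sup>2 = - (x - 0)\<^sup>2 / (2 * \<sigma>\<^sup>2)" using assms unfolding \<sigma>(2) by (simp add: field_simps)
    then have "exp (- x\<^sup>2 / 2) * exp (s * x\<^sup>2) = exp (- (x - 0)\<^sup>2 / (2 * \<sigma>\<^sup>2))"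
      by (simp only: exp_add[symmetric])
    moreover have "sqrt (2 * pi * \<sigma>\<^sup>2) = sqrt (2 * pi) * \<sigma>" using \<sigma>(1) by (simp add: real_sqrt_mult)
    ultimately show ?thesis using \<sigma>(1) by (simp add: normal_density_def)
  qed
  have "(\<integral>\<^sup>+x. ennreal (exp (s * x\<^sup>2)) \<partial>gauss1) = (\<integral>\<^sup>+x. ennreal (std_normal_density x * exp (s * x\<^sup>2)) \<partial>lborel)"
    by (subst nn_integral_density) (auto simp: ennreal_mult)
  also have "\<dots> = ennreal \<sigma> * (\<integral>\<^sup>+x. ennreal (normal_density 0 \<sigma> x) \<partial>lborel)"
    unfolding eq using \<sigma>(1) by (subst nn_integral_cmult[symmetric]) (auto simp: ennreal_mult)
  finally show ?thesis using \<sigma>(1) by (simp add: nn_integral_normal_density \<sigma>_def)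
qed

text \<open>A second-order bound on the logarithm for both signs of s, so that one Chernoff argument
  covers both tails of the squared norm; the constant 4 is not sharp.\<close>

lemma inverse_sqrt_one_minus_le:
  fixes s :: real
  assumes "\<bar>s\<bar> \<le> 1 / 4"
  shows "1 / sqrt (1 - 2 * s) \<le> exp (s + 4 * s\<^sup>2)"
proof -
  have pos: "1 - 2 * s > 0" using assms by linarith
  have "- (2 * s) - 2 * (2 * s)\<^sup>2 \<le> ln (1 - 2 * s)"
  proof (cases "s \<ge> 0")
    case True
    then show ?thesis using assms ln_one_minus_pos_lower_bound[of "2 * s"] by simp
  next
    case False
    then have "- (2 * s) - 4 * (s * s) \<le> ln (1 - 2 * s)"
      using assms ln_one_plus_pos_lower_bound[of "- 2 * s"] by (simp add: power2_eq_square)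
    moreover have "- (2 * s) - 2 * (2 * s)\<^sup>2 = - (2 * s) - 8 * (s * s)" by (simp add: power2_eq_square)
    moreover have "0 \<le> s * s" by simp
    ultimately show ?thesis by linarith
  qed
  then have "- ln (1 - 2 * s) / 2 \<le> s + 4 * s\<^sup>2" by (simp add: power2_eq_square)
  then have "exp (- ln (1 - 2 * s) / 2) \<le> exp (s + 4 * s\<^sup>2)" by simp
  moreover have "1 / sqrt (1 - 2 * s) = exp (- ln (1 - 2 * s) / 2)"
    using pos by (simp add: ln_sqrt[symmetric] exp_minus inverse_eq_divide)
  ultimately show ?thesis by simp
qed

section \<open>The Gaussian law on coordinate families and its tails\<close>

lemma space_std_gaussian: "space (std_gaussian d) = ({..<d} \<rightarrow>\<^sub>E UNIV)"
  by (simp add: std_gaussian_def space_PiM)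

lemma sets_std_gaussian: "sets (std_gaussian d) = sets (PiM {..<d} (\<lambda>_. borel))"
  unfolding std_gaussian_def by (intro sets_PiM_cong) auto

lemma measurable_std_gaussian_component [measurable]:
  "i < d \<Longrightarrow> (\<lambda>x. x i) \<in> borel_measurable (std_gaussian d)"
  unfolding measurable_cong_sets[OF sets_std_gaussian refl] by measurable

lemma measurable_std_gaussian_ip [measurable]:
  "(\<lambda>x. ip {..<d} x y) \<in> borel_measurable (std_gaussian d)"
  "(\<lambda>x. ip {..<d} x x) \<in> borel_measurable (std_gaussian d)"
  unfolding ip_def by measurable

lemma std_gaussian_prod:
  assumes "\<And>i. i < d \<Longrightarrow> f i \<in> borel_measurable borel"
  shows "(\<integral>\<^sup>+x. (\<Prod>i<d. f i (x i)) \<partial>std_gaussian d) = (\<Prod>i<d. \<integral>\<^sup>+x. f i x \<partial>gauss1)"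
proof -
  interpret product_sigma_finite "\<lambda>_. gauss1" by (rule product_sigma_finite_gauss1)
  show ?thesis unfolding std_gaussian_def using assms by (intro product_nn_integral_prod) auto
qed

lemma emeasure_le_nn_integral:
  assumes "A \<in> sets M" "\<And>x. x \<in> A \<Longrightarrow> 1 \<le> f x"
  shows "emeasure M A \<le> (\<integral>\<^sup>+x. f x \<partial>M)"
proof -
  have "emeasure M A = (\<integral>\<^sup>+x. indicator A x \<partial>M)" using assms(1) by simp
  also have "\<dots> \<le> (\<integral>\<^sup>+x. f x \<partial>M)"
    using assms(2) by (intro nn_integral_mono) (auto simp: indicator_def)
  finally show ?thesis .
qed

text \<open>Two-sided Chernoff bound. The factor exp (- l t) sits inside the integrand, so that
  nothing is divided in the extended reals, and one hypothesis over r of absolute value l covers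
  both signs.\<close>

lemma emeasure_abs_ge_le:
  assumes f: "f \<in> borel_measurable M" and l: "l > 0" and e: "0 \<le> e"
    and mgf: "\<And>r. \<bar>r\<bar> = l \<Longrightarrow> (\<integral>\<^sup>+x. ennreal (exp (r * f x - l * t)) \<partial>M) \<le> ennreal e"
  shows "emeasure M {x \<in> space M. t \<le> \<bar>f x\<bar>} \<le> ennreal (2 * e)"
proof -
  let ?E = "\<lambda>r x. ennreal (exp (r * f x - l * t))"
  have m: "?E r \<in> borel_measurable M" for r using f by measurable
  have "emeasure M {x \<in> space M. t \<le> \<bar>f x\<bar>} \<le> (\<integral>\<^sup>+x. ?E l x + ?E (- l) x \<partial>M)"
  proof (rule emeasure_le_nn_integral)
    show "{x \<in> space M. t \<le> \<bar>f x\<bar>} \<in> sets M"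
      by (intro borel_measurable_le borel_measurable_const borel_measurable_abs f)
    fix x assume "x \<in> {x \<in> space M. t \<le> \<bar>f x\<bar>}"
    then consider "t \<le> f x" | "t \<le> - f x" by fastforce
    then show "1 \<le> ?E l x + ?E (- l) x"
    proof cases
      case 1
      then have "l * t \<le> l * f x" using l by (intro mult_left_mono) auto
      then have "1 \<le> ?E l x" by simp
      then show ?thesis by (rule add_increasing2[rotated]) simp
    next
      case 2
      then have "l * t \<le> l * - f x" using l by (intro mult_left_mono) auto
      then have "1 \<le> ?E (- l) x" by simp
      then show ?thesis by (rule add_increasing[rotated]) simp
    qed
  qed
  also have "\<dots> = (\<integral>\<^sup>+x. ?E l x \<partial>M) + (\<integral>\<^sup>+x. ?E (- l) x \<partial>M)" by (rule nn_integral_add[OF m m])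
  also have "\<dots> \<le> ennreal e + ennreal e" using l by (intro add_mono mgf) auto
  also have "\<dots> = ennreal (2 * e)" using e by (simp add: ennreal_plus[symmetric] del: ennreal_plus)
  finally show ?thesis .
qed

lemma std_gaussian_mgf_square:
  assumes "\<bar>s\<bar> \<le> 1 / 4"
  shows "(\<integral>\<^sup>+x. ennreal (exp (s * (ip {..<d} x x - real d) - c)) \<partial>std_gaussian d) \<le> ennreal (exp (4 * s\<^sup>2 * real d - c))"
proof -
  have eq: "ennreal (exp (s * (ip {..<d} x x - real d) - c)) = ennreal (exp (- s * real d - c)) * (\<Prod>i<d. ennreal (exp (s * (x i)\<^sup>2)))" for x
  proof -
    have "exp (s * (ip {..<d} x x - real d) - c) = exp (- s * real d - c) * (\<Prod>i<d. exp (s * (x i)\<^sup>2))"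
      by (simp add: exp_sum[symmetric] exp_add[symmetric] ip_def power2_eq_square sum_distrib_left algebra_simps)
    then show ?thesis by (simp add: ennreal_mult prod_nonneg prod_ennreal)
  qed
  have "(\<integral>\<^sup>+x. ennreal (exp (s * (ip {..<d} x x - real d) - c)) \<partial>std_gaussian d)
      = ennreal (exp (- s * real d - c)) * (\<Prod>i<d. \<integral>\<^sup>+x. ennreal (exp (s * x\<^sup>2)) \<partial>gauss1)"
    unfolding eq by (subst nn_integral_cmult)
      (measurable, subst std_gaussian_prod[where f = "\<lambda>i x. ennreal (exp (s * x\<^sup>2))"], measurable)
  also have "\<dots> \<le> ennreal (exp (- s * real d - c)) * (\<Prod>i<d. ennreal (exp (s + 4 * s\<^sup>2)))"
    using assms by (intro mult_left_mono prod_mono_ennreal)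
      (auto simp: gauss1_mgf_square intro!: ennreal_leI inverse_sqrt_one_minus_le)
  also have "\<dots> = ennreal (exp (4 * s\<^sup>2 * real d - c))"
    by (simp add: ennreal_power ennreal_mult'[symmetric] exp_of_nat_mult[symmetric] exp_add[symmetric] algebra_simps)
  finally show ?thesis .
qed

lemma std_gaussian_norm_tail:
  assumes t: "0 < t" "t \<le> real d"
  shows "emeasure (std_gaussian d) {x \<in> space (std_gaussian d). t \<le> \<bar>ip {..<d} x x - real d\<bar>} \<le> ennreal (2 * exp (- t\<^sup>2 / (16 * real d)))"
proof (rule emeasure_abs_ge_le)
  \<comment> \<open>The minimiser of \<open>4 * s\<^sup>2 * real d - s * t\<close>; since t is at
    most d, it stays within the range 1 / 4 of the exponential moment.\<close>
  define s where "s = t / (8 * real d)"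
  have d: "real d > 0" using t by linarith
  show s0: "s > 0" using t d by (simp add: s_def)
  fix r assume r: "\<bar>r\<bar> = s"
  have "\<bar>r\<bar> \<le> 1 / 4" unfolding r using t d by (simp add: s_def field_simps)
  then have "(\<integral>\<^sup>+x. ennreal (exp (r * (ip {..<d} x x - real d) - s * t)) \<partial>std_gaussian d) \<le> ennreal (exp (4 * r\<^sup>2 * real d - s * t))"
    by (rule std_gaussian_mgf_square)
  also have "r\<^sup>2 = s\<^sup>2" using r by (metis power2_abs)
  also have "4 * s\<^sup>2 * real d - s * t = - t\<^sup>2 / (16 * real d)" using d by (simp add: s_def power2_eq_square field_simps)
  finally show "(\<integral>\<^sup>+x. ennreal (exp (r * (ip {..<d} x x - real d) - s * t)) \<partial>std_gaussian d) \<le> ennreal (exp (- t\<^sup>2 / (16 * real d)))" .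
qed (auto intro!: borel_measurable_diff measurable_std_gaussian_ip(2))

text \<open>For fixed y the inner product is a centered Gaussian of variance |y|^2. An upper bound v
  of the variance is enough, and this matters because y will be another sample, whose norm is
  controlled but not fixed.\<close>

lemma std_gaussian_ip_tail:
  assumes t: "0 < t" and y: "ip {..<d} y y \<le> v" "v > 0"
  shows "emeasure (std_gaussian d) {x \<in> space (std_gaussian d). t \<le> \<bar>ip {..<d} x y\<bar>} \<le> ennreal (2 * exp (- t\<^sup>2 / (2 * v)))"
proof -
  define l where "l = t / v"
  have l: "l > 0" using t y by (simp add: l_def)
  have mgf: "(\<integral>\<^sup>+x. ennreal (exp (r * ip {..<d} x y - l * t)) \<partial>std_gaussian d) \<le> ennreal (exp (- t\<^sup>2 / (2 * v)))"
    if "\<bar>r\<bar> = l" for r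
  proof -
    have r: "r\<^sup>2 = l\<^sup>2" using that by (metis power2_abs)
    have eq: "ennreal (exp (r * ip {..<d} x y - l * t)) = ennreal (exp (- l * t)) * (\<Prod>i<d. ennreal (exp ((r * y i) * x i)))" for x
    proof -
      have "exp (r * ip {..<d} x y - l * t) = exp (- l * t) * (\<Prod>i<d. exp ((r * y i) * x i))"
        by (simp add: exp_sum[symmetric] exp_add[symmetric] ip_def sum_distrib_left algebra_simps)
      then show ?thesis by (simp add: ennreal_mult prod_nonneg prod_ennreal)
    qed
    have "(\<integral>\<^sup>+x. ennreal (exp (r * ip {..<d} x y - l * t)) \<partial>std_gaussian d)
        = ennreal (exp (- l * t)) * (\<Prod>i<d. \<integral>\<^sup>+x. ennreal (exp ((r * y i) * x)) \<partial>gauss1)"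
      unfolding eq by (subst nn_integral_cmult)
        (measurable, subst std_gaussian_prod[where f = "\<lambda>i x. ennreal (exp ((r * y i) * x))"], measurable)
    also have "\<dots> = ennreal (exp (- l * t)) * (\<Prod>i<d. ennreal (exp ((r * y i)\<^sup>2 / 2)))"
      by (simp only: gauss1_mgf_linear)
    also have "\<dots> = ennreal (exp (l\<^sup>2 * ip {..<d} y y / 2 - l * t))"
    proof -
      have "(\<Sum>i<d. (r * y i)\<^sup>2 / 2) = l\<^sup>2 * ip {..<d} y y / 2"
        by (simp add: ip_def power_mult_distrib r sum_distrib_left sum_divide_distrib power2_eq_square[of "y _"])
      then show ?thesis
        by (simp add: prod_ennreal exp_sum[symmetric] ennreal_mult'[symmetric] exp_add[symmetric])
    qed
    also have "\<dots> \<le> ennreal (exp (l\<^sup>2 * v / 2 - l * t))"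
      using y by (intro ennreal_leI) (auto intro!: mult_left_mono divide_right_mono)
    also have "l\<^sup>2 * v / 2 - l * t = - t\<^sup>2 / (2 * v)" using y by (simp add: l_def power2_eq_square field_simps)
    finally show ?thesis .
  qed
  show ?thesis
    by (rule emeasure_abs_ge_le[OF measurable_std_gaussian_ip(1) l _ mgf]) simp
qed

section \<open>Moments of order four and quadratic forms\<close>

definition gmom :: "nat \<Rightarrow> real" where "gmom k = (\<integral>x. x ^ k \<partial>gauss1)"

lemma gauss1_power: "integrable gauss1 (\<lambda>x. x ^ k)" "gmom k = (\<integral>x. std_normal_density x * x ^ k \<partial>lborel)"
proof -
  show "integrable gauss1 (\<lambda>x. x ^ k)"
    by (subst integrable_density) (auto intro: integrable_std_normal_moment)
  show "gmom k = (\<integral>x. std_normal_density x * x ^ k \<partial>lborel)"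
    unfolding gmom_def by (subst integral_density) auto
qed

lemma gmom_simps: "gmom 0 = 1" "gmom (Suc 0) = 0" "gmom 2 = 1" "gmom 3 = 0" "gmom 4 = 3"
  using integral_std_normal_moment_even[of 0] integral_std_normal_moment_odd[of 0]
    integral_std_normal_moment_even[of 1] integral_std_normal_moment_odd[of 1] integral_std_normal_moment_even[of 2]
  by (simp_all add: gauss1_power(2) fact_numeral)

lemma gmom_Suc: "gmom (Suc (Suc 0)) = 1" "gmom (Suc (Suc (Suc 0))) = 0" "gmom (Suc (Suc (Suc (Suc 0)))) = 3"
  using gmom_simps(3-5) by (simp_all add: eval_nat_numeral)

lemma std_gaussian_monomial:
  "integrable (std_gaussian d) (\<lambda>x. \<Prod>i<d. x i ^ k i)"
  "(\<integral>x. (\<Prod>i<d. x i ^ k i) \<partial>std_gaussian d) = (\<Prod>i<d. gmom (k i))"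
proof -
  interpret product_sigma_finite "\<lambda>_. gauss1" by (rule product_sigma_finite_gauss1)
  show "integrable (std_gaussian d) (\<lambda>x. \<Prod>i<d. x i ^ k i)"
    unfolding std_gaussian_def by (intro product_integrable_prod gauss1_power) auto
  show "(\<integral>x. (\<Prod>i<d. x i ^ k i) \<partial>std_gaussian d) = (\<Prod>i<d. gmom (k i))"
    unfolding std_gaussian_def gmom_def by (intro product_integral_prod gauss1_power) auto
qed

text \<open>Isserlis' formula for four factors, with one summand per pairing. Writing the monomial
  with multiplicities \<open>k i\<close> reduces the integral to a product over the distinct
  indices, and finitely many coincidence patterns remain.\<close>

lemma std_gaussian_moment4:
  assumes "a < d" "b < d" "c < d" "e < d"
  shows "integrable (std_gaussian d) (\<lambda>x. x a * x b * x c * x e)"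
    "(\<integral>x. x a * x b * x c * x e \<partial>std_gaussian d) =
      of_bool (a = b \<and> c = e) + of_bool (a = c \<and> b = e) + of_bool (a = e \<and> b = c)"
proof -
  define k :: "nat \<Rightarrow> nat" where "k i = of_bool (i = a) + of_bool (i = b) + of_bool (i = c) + of_bool (i = e)" for i
  have one: "(\<Prod>i<d. x i ^ of_bool (i = j)) = (x j :: real)" if "j < d" for x j
  proof -
    have "(\<Prod>i<d. x i ^ of_bool (i = j)) = (\<Prod>i<d. if i = j then x i else 1)"
      by (intro prod.cong) auto
    then show ?thesis using that by simp
  qed
  have eq: "x a * x b * x c * x e = (\<Prod>i<d. x i ^ k i)" for x :: "nat \<Rightarrow> real"
    by (simp add: k_def power_add prod.distrib one assms)
  show "integrable (std_gaussian d) (\<lambda>x. x a * x b * x c * x e)"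
    unfolding eq by (rule std_gaussian_monomial)
  have "(\<integral>x. x a * x b * x c * x e \<partial>std_gaussian d) = (\<Prod>i<d. gmom (k i))"
    unfolding eq by (rule std_gaussian_monomial)
  also have "\<dots> = (\<Prod>i\<in>{a, b, c, e}. gmom (k i))"
    using assms by (intro prod.mono_neutral_right) (auto simp: k_def gmom_simps(1))
  also have "\<dots> = of_bool (a = b \<and> c = e) + of_bool (a = c \<and> b = e) + of_bool (a = e \<and> b = c)"
    by (cases "a = b"; cases "a = c"; cases "a = e"; cases "b = c"; cases "b = e"; cases "c = e")
       (auto simp: k_def gmom_simps gmom_Suc prod.insert_if)
  finally show "(\<integral>x. x a * x b * x c * x e \<partial>std_gaussian d) =
      of_bool (a = b \<and> c = e) + of_bool (a = c \<and> b = e) + of_bool (a = e \<and> b = c)" .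
qed

text \<open>Of the three pairings, one yields the squared trace, which vanishes, and each of the
  other two yields the squared Frobenius norm, the last one by symmetry of \<open>W\<close>.\<close>

lemma std_gaussian_quadratic_form:
  fixes W :: "nat \<Rightarrow> nat \<Rightarrow> real"
  assumes sym: "\<And>a b. a < d \<Longrightarrow> b < d \<Longrightarrow> W a b = W b a" and tr: "(\<Sum>a<d. W a a) = 0"
  shows "(\<integral>\<^sup>+x. ennreal ((\<Sum>a<d. \<Sum>b<d. W a b * x a * x b)\<^sup>2) \<partial>std_gaussian d) = ennreal (2 * (\<Sum>a<d. \<Sum>b<d. (W a b)\<^sup>2))"
proof -
  let ?D = "{..<d}"
  have eq: "(\<Sum>a<d. \<Sum>b<d. W a b * x a * x b)\<^sup>2 =
      (\<Sum>a<d. \<Sum>b<d. \<Sum>c<d. \<Sum>e<d. (W a b * W c e) * (x a * x b * x c * x e))" for x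
    unfolding power2_eq_square sum_distrib_right sum_distrib_left
    by (intro sum.cong refl) (simp add: mult_ac)
  have int: "integrable (std_gaussian d) (\<lambda>x. (\<Sum>a<d. \<Sum>b<d. W a b * x a * x b)\<^sup>2)"
    unfolding eq by (intro Bochner_Integration.integrable_sum integrable_mult_right std_gaussian_moment4) auto
  have "(\<integral>x. (\<Sum>a<d. \<Sum>b<d. W a b * x a * x b)\<^sup>2 \<partial>std_gaussian d) =
    (\<Sum>a<d. \<Sum>b<d. \<Sum>c<d. \<Sum>e<d. (W a b * W c e) * (of_bool (a = b \<and> c = e) + of_bool (a = c \<and> b = e) + of_bool (a = e \<and> b = c)))"
    unfolding eq
    by (subst Bochner_Integration.integral_sum,
        fastforce intro!: Bochner_Integration.integrable_sum integrable_mult_right std_gaussian_moment4,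
        intro sum.cong refl)+
       (simp add: std_gaussian_moment4)
  also have "\<dots> = (\<Sum>a<d. \<Sum>b<d. \<Sum>c<d. \<Sum>e<d. if a = b then (if e = c then W a b * W c e else 0) else 0)
      + (\<Sum>a<d. \<Sum>b<d. \<Sum>c<d. \<Sum>e<d. if c = a then (if e = b then W a b * W c e else 0) else 0)
      + (\<Sum>a<d. \<Sum>b<d. \<Sum>c<d. \<Sum>e<d. if c = b then (if e = a then W a b * W c e else 0) else 0)"
    unfolding sum.distrib[symmetric] by (intro sum.cong refl) (auto simp: of_bool_def)
  also have "(\<Sum>a<d. \<Sum>b<d. \<Sum>c<d. \<Sum>e<d. if a = b then (if e = c then W a b * W c e else 0) else 0)
      = (\<Sum>a<d. \<Sum>b<d. if b = a then W a a * (\<Sum>c<d. W c c) else 0)"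
    by (intro sum.cong refl) (auto simp: sum_distrib_left)
  also have "\<dots> = 0" unfolding tr by simp
  also have "(\<Sum>a<d. \<Sum>b<d. \<Sum>c<d. \<Sum>e<d. if c = a then (if e = b then W a b * W c e else 0) else 0)
      = (\<Sum>a<d. \<Sum>b<d. (W a b)\<^sup>2)"
  proof (intro sum.cong refl)
    fix a b assume "a \<in> ?D" "b \<in> ?D"
    have "(\<Sum>c<d. \<Sum>e<d. if c = a then (if e = b then W a b * W c e else 0) else 0)
        = (\<Sum>c<d. if c = a then (\<Sum>e<d. if e = b then W a b * W c e else 0) else 0)"
      by (intro sum.cong refl) auto
    then show "(\<Sum>c<d. \<Sum>e<d. if c = a then (if e = b then W a b * W c e else 0) else 0) = (W a b)\<^sup>2"
      using \<open>a \<in> ?D\<close> \<open>b \<in> ?D\<close> by (simp add: power2_eq_square)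
  qed
  also have "(\<Sum>a<d. \<Sum>b<d. \<Sum>c<d. \<Sum>e<d. if c = b then (if e = a then W a b * W c e else 0) else 0)
      = (\<Sum>a<d. \<Sum>b<d. (W a b)\<^sup>2)"
  proof (intro sum.cong refl)
    fix a b assume "a \<in> ?D" "b \<in> ?D"
    have "(\<Sum>c<d. \<Sum>e<d. if c = b then (if e = a then W a b * W c e else 0) else 0)
        = (\<Sum>c<d. if c = b then (\<Sum>e<d. if e = a then W a b * W c e else 0) else 0)"
      by (intro sum.cong refl) auto
    then show "(\<Sum>c<d. \<Sum>e<d. if c = b then (if e = a then W a b * W c e else 0) else 0) = (W a b)\<^sup>2"
      using \<open>a \<in> ?D\<close> \<open>b \<in> ?D\<close> sym[of a b] by (simp add: power2_eq_square)
  qed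
  finally show ?thesis by (subst nn_integral_eq_integral[OF int]) auto
qed

section \<open>Independence of norm and direction\<close>

abbreviation lebd :: "nat \<Rightarrow> (nat \<Rightarrow> real) measure" where
  "lebd d \<equiv> PiM {..<d} (\<lambda>_. lborel)"

abbreviation nrm :: "nat \<Rightarrow> (nat \<Rightarrow> real) \<Rightarrow> real" where
  "nrm d x \<equiv> sqrt (ip {..<d} x x)"

lemma product_sigma_finite_lborel: "product_sigma_finite (\<lambda>_. lborel :: real measure)"
  by (simp add: product_sigma_finite_def sigma_finite_lborel)

lemma sets_lebd: "sets (lebd d) = sets (PiM {..<d} (\<lambda>_. borel))"
  by (intro sets_PiM_cong) auto

lemma measurable_lebd_std_gaussian: "measurable (lebd d) N = measurable (std_gaussian d) N"
  by (intro measurable_cong_sets) (simp_all add: sets_lebd sets_std_gaussian)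

lemma space_lebd: "space (lebd d) = ({..<d} \<rightarrow>\<^sub>E UNIV)"
  by (simp add: space_PiM)

text \<open>Written over the product of Lebesgue measures, the density is a function of the norm
  alone; the independence of norm and direction rests on this form.\<close>

lemma std_gaussian_eq_density:
  "std_gaussian d = density (lebd d) (\<lambda>x. ennreal ((1 / sqrt (2 * pi)) ^ d * exp (- (nrm d x)\<^sup>2 / 2)))"
proof -
  interpret G: product_sigma_finite "\<lambda>_. gauss1" by (rule product_sigma_finite_gauss1)
  interpret L: product_sigma_finite "\<lambda>_. lborel :: real measure" by (rule product_sigma_finite_lborel)
  let ?h = "\<lambda>x. ennreal ((1 / sqrt (2 * pi)) ^ d * exp (- (nrm d x)\<^sup>2 / 2))"
  have m: "?h \<in> borel_measurable (lebd d)"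
    unfolding measurable_lebd_std_gaussian by measurable
  have h: "?h x = (\<Prod>i<d. ennreal (std_normal_density (x i)))" for x
  proof -
    have "(1 / sqrt (2 * pi)) ^ d * exp (- (nrm d x)\<^sup>2 / 2) = (\<Prod>i<d. std_normal_density (x i))"
    proof -
      have "(nrm d x)\<^sup>2 = (\<Sum>i<d. (x i)\<^sup>2)"
        unfolding real_sqrt_pow2[OF ip_nonneg] by (simp add: ip_def power2_eq_square)
      then have "exp (- (nrm d x)\<^sup>2 / 2) = (\<Prod>i<d. exp (- (x i)\<^sup>2 / 2))"
        by (simp only: exp_sum[OF finite_lessThan, symmetric] sum_divide_distrib[symmetric] sum_negf)
      then show ?thesis by (simp only: std_normal_density_def prod.distrib prod_constant card_lessThan)
    qed
    then show ?thesis by (simp add: prod_ennreal)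
  qed
  have "density (lebd d) ?h = std_gaussian d"
    unfolding std_gaussian_def
  proof (rule G.PiM_eqI)
    show "sets (density (lebd d) ?h) = sets (PiM {..<d} (\<lambda>_. gauss1))"
      by (simp, intro sets_PiM_cong) auto
    fix A assume A: "\<And>i. i \<in> {..<d} \<Longrightarrow> A i \<in> sets gauss1"
    have "emeasure (density (lebd d) ?h) (Pi\<^sub>E {..<d} A) = (\<integral>\<^sup>+x. ?h x * indicator (Pi\<^sub>E {..<d} A) x \<partial>lebd d)"
      using A by (intro emeasure_density m sets_PiM_I_finite) auto
    also have "\<dots> = (\<integral>\<^sup>+x. (\<Prod>i<d. ennreal (std_normal_density (x i)) * indicator (A i) (x i)) \<partial>lebd d)"
    proof (rule nn_integral_cong)
      fix x assume "x \<in> space (lebd d)"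
      then have "indicator (Pi\<^sub>E {..<d} A) x = (\<Prod>i<d. indicator (A i) (x i) :: ennreal)"
        by (auto simp: indicator_def space_lebd PiE_iff)
      then show "?h x * indicator (Pi\<^sub>E {..<d} A) x = (\<Prod>i<d. ennreal (std_normal_density (x i)) * indicator (A i) (x i))"
        unfolding h by (simp add: prod.distrib)
    qed
    also have "\<dots> = (\<Prod>i<d. \<integral>\<^sup>+x. ennreal (std_normal_density x) * indicator (A i) x \<partial>lborel)"
      using A by (intro L.product_nn_integral_prod) auto
    also have "\<dots> = (\<Prod>i<d. emeasure gauss1 (A i))"
      using A by (intro prod.cong refl emeasure_density[symmetric]) auto
    finally show "emeasure (density (lebd d) ?h) (Pi\<^sub>E {..<d} A) = (\<Prod>i<d. emeasure gauss1 (A i))" .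
  qed simp
  then show ?thesis by simp
qed

section \<open>Scaling, cones and the radial part of Lebesgue measure\<close>

text \<open>The restriction keeps the result among the extensional functions, which form the space
  of \<open>lebd d\<close>.\<close>

definition scl :: "nat \<Rightarrow> real \<Rightarrow> (nat \<Rightarrow> real) \<Rightarrow> nat \<Rightarrow> real" where
  "scl d c x = (\<lambda>i\<in>{..<d}. c * x i)"

lemma measurable_scl [measurable]: "scl d c \<in> measurable (lebd d) (lebd d)"
  unfolding scl_def by (rule measurable_restrict) measurable

lemma ip_scl: "ip {..<d} (scl d c x) (scl d c x) = c\<^sup>2 * ip {..<d} x x"
  by (simp add: ip_def scl_def power2_eq_square sum_distrib_left mult_ac)

lemma nrm_scl: "c > 0 \<Longrightarrow> nrm d (scl d c x) = c * nrm d x"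
  by (simp add: ip_scl real_sqrt_mult)

text \<open>The pushforward under scaling, multiplied by c^d, agrees with \<open>lebd d\<close> on
  boxes, where c^d splits into one factor c per coordinate.\<close>

lemma lebd_scl: 
  assumes c: "c > 0" and S: "S \<in> sets (lebd d)"
  shows "emeasure (lebd d) S = ennreal (c ^ d) * emeasure (lebd d) {x \<in> space (lebd d). scl d c x \<in> S}"
proof -
  interpret L: product_sigma_finite "\<lambda>_. lborel :: real measure" by (rule product_sigma_finite_lborel)
  let ?P = "density (distr (lebd d) (lebd d) (scl d c)) (\<lambda>_. ennreal (c ^ d))"
  have val: "emeasure ?P S = ennreal (c ^ d) * emeasure (lebd d) {x \<in> space (lebd d). scl d c x \<in> S}"
    if "S \<in> sets (lebd d)" for S
  proof -
    have "emeasure ?P S = ennreal (c ^ d) * emeasure (distr (lebd d) (lebd d) (scl d c)) S"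
      using that by (subst emeasure_density) (auto simp: nn_integral_cmult)
    then show ?thesis
      using that by (subst (asm) emeasure_distr) (auto simp: vimage_def Int_def conj_commute)
  qed
  have "?P = lebd d"
  proof (rule L.PiM_eqI)
    fix A :: "nat \<Rightarrow> real set" assume A: "\<And>i. i \<in> {..<d} \<Longrightarrow> A i \<in> sets lborel"
    have box: "Pi\<^sub>E {..<d} A \<in> sets (lebd d)" by (rule sets_PiM_I_finite) (use A in simp_all)
    have "{x \<in> space (lebd d). scl d c x \<in> Pi\<^sub>E {..<d} A} = Pi\<^sub>E {..<d} (\<lambda>i. {t. c * t \<in> A i})"
      unfolding space_lebd scl_def restrict_PiE_iff by (rule Set.set_eqI) (simp add: PiE_iff, blast)
    then have "emeasure ?P (Pi\<^sub>E {..<d} A) = ennreal (c ^ d) * emeasure (lebd d) (Pi\<^sub>E {..<d} (\<lambda>i. {t. c * t \<in> A i}))"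
      using val[OF box] by simp
    also have "emeasure (lebd d) (Pi\<^sub>E {..<d} (\<lambda>i. {t. c * t \<in> A i})) = (\<Prod>i<d. emeasure lborel {t. c * t \<in> A i})"
    proof (rule L.emeasure_PiM)
      fix i assume "i \<in> {..<d}"
      then have "A i \<in> sets borel" using A by auto
      moreover have "(\<lambda>t. c * t) \<in> borel_measurable borel" by measurable
      ultimately have "(\<lambda>t. c * t) -` A i \<inter> space borel \<in> sets borel" by (rule measurable_sets[rotated])
      then show "{t. c * t \<in> A i} \<in> sets lborel" by (simp add: vimage_def)
    qed simp
    also have "ennreal (c ^ d) * \<dots> = (\<Prod>i<d. ennreal c * emeasure lborel {t. c * t \<in> A i})"
      using c by (simp add: prod.distrib ennreal_power)
    also have "\<dots> = (\<Prod>i<d. emeasure lborel (A i))"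
    proof (intro prod.cong refl)
      fix i assume "i \<in> {..<d}"
      then have A': "A i \<in> sets borel" using A by auto
      have "emeasure (distr lborel borel ((*) c)) (A i) = emeasure lborel {t. c * t \<in> A i}"
        using A' by (subst emeasure_distr) (auto simp: vimage_def)
      then have "emeasure lborel {t. c * t \<in> A i} = ennreal (inverse c) * emeasure lborel (A i)"
        using A' c lborel_distr_mult[of c] by (simp add: emeasure_density nn_integral_cmult)
      then show "ennreal c * emeasure lborel {t. c * t \<in> A i} = emeasure lborel (A i)"
        using c by (simp add: mult.assoc[symmetric] ennreal_mult'[symmetric])
    qed
    finally show "emeasure ?P (Pi\<^sub>E {..<d} A) = (\<Prod>i\<in>{..<d}. emeasure lborel (A i))" .
  qed simp_all
  then show ?thesis using val[OF S] by simp
qed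

lemma lebd_ball_finite: "emeasure (lebd d) {x \<in> space (lebd d). nrm d x < R} < \<infinity>"
proof -
  interpret L: product_sigma_finite "\<lambda>_. lborel :: real measure" by (rule product_sigma_finite_lborel)
  have "{x \<in> space (lebd d). nrm d x < R} \<subseteq> Pi\<^sub>E {..<d} (\<lambda>_. {-R..R})"
  proof
    fix x assume x: "x \<in> {x \<in> space (lebd d). nrm d x < R}"
    have "- R \<le> x i \<and> x i \<le> R" if "i < d" for i
    proof -
      have "x i * x i \<le> ip {..<d} x x"
        unfolding ip_def using that by (intro member_le_sum) auto
      then have "\<bar>x i\<bar> \<le> nrm d x" by (intro real_le_rsqrt) (simp add: power2_eq_square)
      then show ?thesis using x by auto
    qed
    then show "x \<in> Pi\<^sub>E {..<d} (\<lambda>_. {-R..R})" using x by (simp add: space_lebd PiE_iff)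
  qed
  then have "emeasure (lebd d) {x \<in> space (lebd d). nrm d x < R} \<le> emeasure (lebd d) (Pi\<^sub>E {..<d} (\<lambda>_. {-R..R}))"
    by (rule emeasure_mono) (rule sets_PiM_I_finite, simp_all)
  also have "\<dots> = (\<Prod>i<d. emeasure lborel {-R..R})" by (intro L.emeasure_PiM) auto
  also have "\<dots> < \<infinity>"
  proof -
    have "emeasure lborel {-R..R} = ennreal (max 0 (2 * R))" by (simp add: emeasure_lborel_Icc_eq max_def)
    then show ?thesis by (simp add: power_less_top_ennreal)
  qed
  finally show ?thesis .
qed

lemma measurable_nrm [measurable]: "nrm d \<in> borel_measurable (lebd d)"
  unfolding measurable_lebd_std_gaussian by measurable

lemma lebd_ball_sets: "{x \<in> space (lebd d). nrm d x < R} \<in> sets (lebd d)"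
  by measurable

text \<open>Scaling by R leaves a cone invariant and takes the unit ball to the ball of radius
  R.\<close>

lemma lebd_cone_ball:
  assumes C: "C \<in> sets (lebd d)" and cone: "\<And>c x. c > 0 \<Longrightarrow> x \<in> space (lebd d) \<Longrightarrow> scl d c x \<in> C \<longleftrightarrow> x \<in> C" and R: "R > 0"
  shows "emeasure (lebd d) (C \<inter> {x \<in> space (lebd d). nrm d x < R}) =
    ennreal (R ^ d) * emeasure (lebd d) (C \<inter> {x \<in> space (lebd d). nrm d x < 1})"
proof -
  let ?T = "space (lebd d)"
  have "emeasure (lebd d) (C \<inter> {x \<in> ?T. nrm d x < R}) = ennreal (R ^ d) *
      emeasure (lebd d) {x \<in> ?T. scl d R x \<in> C \<inter> {x \<in> ?T. nrm d x < R}}"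
    using C by (intro lebd_scl R sets.Int lebd_ball_sets)
  also have "{x \<in> ?T. scl d R x \<in> C \<inter> {x \<in> ?T. nrm d x < R}} = C \<inter> {x \<in> ?T. nrm d x < 1}"
  proof (rule Set.set_eqI)
    fix x
    have "scl d R x \<in> ?T" by (simp add: scl_def space_lebd)
    moreover have "nrm d (scl d R x) < R \<longleftrightarrow> nrm d x < 1" using R by (simp add: nrm_scl)
    moreover have "x \<in> C \<Longrightarrow> x \<in> ?T" using sets.sets_into_space[OF C] by blast
    ultimately show "x \<in> {x \<in> ?T. scl d R x \<in> C \<inter> {x \<in> ?T. nrm d x < R}} \<longleftrightarrow> x \<in> C \<inter> {x \<in> ?T. nrm d x < 1}"
      using cone[OF R, of x] by blast
  qed
  finally show ?thesis .
qed

text \<open>A cone meets the balls around the origin in sets of measure proportional to the measures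
  of these balls, so Lebesgue measure restricted to the cone has, up to a constant factor, the same
  radial part as Lebesgue measure itself.\<close>

lemma cone_radial_measure:
  assumes A: "A \<in> sets (lebd d)" and cone: "\<And>c x. c > 0 \<Longrightarrow> x \<in> space (lebd d) \<Longrightarrow> scl d c x \<in> A \<longleftrightarrow> x \<in> A"
    and B: "B \<in> sets borel"
  defines "k \<equiv> \<lambda>A. emeasure (lebd d) (A \<inter> {x \<in> space (lebd d). nrm d x < 1})"
  shows "distr (density (lebd d) (\<lambda>x. k (space (lebd d)) * indicator A x)) borel (nrm d)
    = distr (density (lebd d) (\<lambda>x. k A)) borel (nrm d)"
proof -
  let ?T = "space (lebd d)"
  have T: "?T \<in> sets (lebd d)" by simp
  note ball = lebd_ball_sets
  have Tcone: "scl d c x \<in> ?T \<longleftrightarrow> x \<in> ?T" if "x \<in> ?T" for c x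
    using that by (simp add: scl_def space_lebd)
  let ?M = "distr (density (lebd d) (\<lambda>x. k ?T * indicator A x)) borel (nrm d)"
  let ?N = "distr (density (lebd d) (\<lambda>x. k A)) borel (nrm d)"
  have M: "emeasure ?M X = k ?T * emeasure (lebd d) (A \<inter> {x \<in> ?T. nrm d x \<in> X})" if "X \<in> sets borel" for X
  proof -
    have "emeasure ?M X = (\<integral>\<^sup>+x. k ?T * indicator (A \<inter> {x \<in> ?T. nrm d x \<in> X}) x \<partial>lebd d)"
      using that A by (subst emeasure_distr)
        (auto simp: emeasure_density intro!: nn_integral_cong split: split_indicator)
    then show ?thesis using that A by (simp add: nn_integral_cmult)
  qed
  have N: "emeasure ?N X = k A * emeasure (lebd d) {x \<in> ?T. nrm d x \<in> X}" if "X \<in> sets borel" for X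
  proof -
    have "emeasure ?N X = (\<integral>\<^sup>+x. k A * indicator {x \<in> ?T. nrm d x \<in> X} x \<partial>lebd d)"
      using that by (subst emeasure_distr)
        (auto simp: emeasure_density intro!: nn_integral_cong split: split_indicator)
    then show ?thesis using that by (simp add: nn_integral_cmult)
  qed
  have kT: "k ?T < \<infinity>" "k A < \<infinity>"
  proof -
    show *: "k ?T < \<infinity>" using lebd_ball_finite[of d 1] by (simp add: k_def Int_absorb1)
    have "k A \<le> k ?T" unfolding k_def using sets.sets_into_space[OF A] by (intro emeasure_mono sets.Int T ball) auto
    then show "k A < \<infinity>" using * by (rule le_less_trans)
  qed
  have sets_eq: "sets (borel :: real measure) = sigma_sets UNIV (range lessThan)"
    by (subst borel_Iio) (rule sets_measure_of, simp)
  \<comment> \<open>The open half-lines up to R generate the Borel sets and are stable under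
    intersection. For positive R both measures assign them R^d times the product of
    \<open>k ?T\<close> and \<open>k A\<close>, otherwise 0.\<close>
  show "?M = ?N"
  proof (rule measure_eqI_generator_eq[where E = "range lessThan" and \<Omega> = UNIV and A = "\<lambda>n. {..<real n}"])
    show "Int_stable (range (lessThan :: real \<Rightarrow> _))"
    proof -
      have "{..<a} \<inter> {..<b} \<in> range lessThan" for a b :: real
        by (rule range_eqI[of _ _ "min a b"]) auto
      then show ?thesis by (auto simp: Int_stable_def)
    qed
    show "sets ?M = sigma_sets UNIV (range lessThan)" "sets ?N = sigma_sets UNIV (range lessThan)"
      by (simp_all only: sets_distr sets_eq)
    show "emeasure ?M X = emeasure ?N X" if "X \<in> range lessThan" for X
    proof -
      obtain R where X: "X = {..<R}" using \<open>X \<in> range lessThan\<close> by auto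
      then have Xb: "X \<in> sets borel" by simp
      show ?thesis
      proof (cases "R > 0")
        case True
        then show ?thesis
          using lebd_cone_ball[OF A cone True] lebd_cone_ball[OF T Tcone True]
          unfolding M[OF Xb] N[OF Xb] by (simp add: X k_def Int_absorb1 mult_ac)
      next
        case False
        have nn: "0 \<le> nrm d x" for x by simp
        have "\<not> nrm d x < R" for x using False nn[of x] by linarith
        then show ?thesis unfolding M[OF Xb] N[OF Xb] by (simp add: X)
      qed
    qed
    show "emeasure ?M {..<real n} \<noteq> \<infinity>" for n
    proof -
      have "emeasure (lebd d) (A \<inter> {x \<in> ?T. nrm d x < real n}) \<le> emeasure (lebd d) {x \<in> ?T. nrm d x < real n}"
        by (intro emeasure_mono ball) auto
      also have "\<dots> < \<infinity>" by (rule lebd_ball_finite)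
      finally have "emeasure (lebd d) (A \<inter> {x \<in> ?T. nrm d x < real n}) \<noteq> \<infinity>" by simp
      moreover have "k ?T \<noteq> \<infinity>" using kT by simp
      moreover have "emeasure ?M {..<real n} = k ?T * emeasure (lebd d) (A \<inter> {x \<in> ?T. nrm d x < real n})"
        by (subst M) auto
      ultimately show ?thesis by (simp only: infinity_ennreal_def ennreal_mult_eq_top_iff) simp
    qed
    show "(\<Union>n. {..<real n}) = UNIV" by (auto intro: reals_Archimedean2)
  qed auto
qed

text \<open>A cone is an event about the direction. Lebesgue measure on it has a radial part
  proportional to that of the whole space, and the Gaussian density is radial, so the proportion
  persists under the Gaussian law; choosing the whole line for the radial set identifies it with the
  probability of \<open>A\<close>.\<close>

lemma std_gaussian_radius_indep:
  assumes A: "A \<in> sets (lebd d)" and cone: "\<And>c x. c > 0 \<Longrightarrow> x \<in> space (lebd d) \<Longrightarrow> scl d c x \<in> A \<longleftrightarrow> x \<in> A"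
    and B: "B \<in> sets borel"
  shows "emeasure (std_gaussian d) (A \<inter> {x \<in> space (lebd d). nrm d x \<in> B}) =
    emeasure (std_gaussian d) A * emeasure (std_gaussian d) {x \<in> space (lebd d). nrm d x \<in> B}"
proof -
  let ?T = "space (lebd d)" and ?\<mu> = "std_gaussian d"
  define k where "k A = emeasure (lebd d) (A \<inter> {x \<in> ?T. nrm d x < 1})" for A
  define \<phi> :: "real \<Rightarrow> ennreal" where "\<phi> r = ennreal ((1 / sqrt (2 * pi)) ^ d * exp (- r\<^sup>2 / 2))" for r
  have \<phi>m [measurable]: "\<phi> \<in> borel_measurable borel" unfolding \<phi>_def by measurable
  interpret prob_space ?\<mu> by (rule prob_space_std_gaussian)
  have \<mu>: "emeasure ?\<mu> S = (\<integral>\<^sup>+x. \<phi> (nrm d x) * indicator S x \<partial>lebd d)" if "S \<in> sets (lebd d)" for S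
  proof -
    have "std_gaussian d = density (lebd d) (\<lambda>x. \<phi> (nrm d x))" unfolding \<phi>_def by (rule std_gaussian_eq_density)
    then show ?thesis using that by (simp only:) (rule emeasure_density[OF measurable_compose[OF measurable_nrm \<phi>m]])
  qed
  have Bs: "{x \<in> ?T. nrm d x \<in> B} \<in> sets (lebd d)" if "B \<in> sets borel" for B
    using that by measurable
  have key: "k ?T * emeasure ?\<mu> (A \<inter> {x \<in> ?T. nrm d x \<in> B}) = k A * emeasure ?\<mu> {x \<in> ?T. nrm d x \<in> B}"
    if B: "B \<in> sets borel" for B
  proof -
    have [measurable]: "A \<in> sets (lebd d)" "B \<in> sets borel" by fact+
    have "k ?T * emeasure ?\<mu> (A \<inter> {x \<in> ?T. nrm d x \<in> B}) = (\<integral>\<^sup>+x. k ?T * (\<phi> (nrm d x) * indicator (A \<inter> {x \<in> ?T. nrm d x \<in> B}) x) \<partial>lebd d)"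
      using A Bs[OF B] by (subst \<mu>) (auto intro!: nn_integral_cmult[symmetric])
    also have "\<dots> = (\<integral>\<^sup>+x. (k ?T * indicator A x) * (\<phi> (nrm d x) * indicator B (nrm d x)) \<partial>lebd d)"
      by (rule nn_integral_cong) (simp add: indicator_def)
    also have "\<dots> = (\<integral>\<^sup>+r. \<phi> r * indicator B r \<partial>distr (density (lebd d) (\<lambda>x. k ?T * indicator A x)) borel (nrm d))"
      by (subst nn_integral_distr, simp, simp, subst nn_integral_density) simp_all
    also have "\<dots> = (\<integral>\<^sup>+r. \<phi> r * indicator B r \<partial>distr (density (lebd d) (\<lambda>x. k A)) borel (nrm d))"
      using cone_radial_measure[OF A cone B] by (simp add: k_def)
    also have "\<dots> = (\<integral>\<^sup>+x. k A * (\<phi> (nrm d x) * indicator B (nrm d x)) \<partial>lebd d)"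
      by (subst nn_integral_distr, simp, simp, subst nn_integral_density) simp_all
    also have "\<dots> = k A * (\<integral>\<^sup>+x. \<phi> (nrm d x) * indicator {x \<in> ?T. nrm d x \<in> B} x \<partial>lebd d)"
      by (subst nn_integral_cmult[symmetric]) (auto intro!: nn_integral_cong simp: indicator_def)
    also have "\<dots> = k A * emeasure ?\<mu> {x \<in> ?T. nrm d x \<in> B}"
      by (subst \<mu>[OF Bs[OF B]]) (rule refl)
    finally show ?thesis .
  qed
  have sp: "?T = space ?\<mu>" by (simp add: space_lebd space_std_gaussian)
  have AT: "A \<subseteq> ?T" using A by (rule sets.sets_into_space)
  have kA: "k ?T * emeasure ?\<mu> A = k A"
    using key[of UNIV] AT emeasure_space_1 by (simp add: Int_absorb2 sp)
  have "k ?T < \<infinity>" using lebd_ball_finite[of d 1] by (simp add: k_def Int_absorb1)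
  \<comment> \<open>Cancelling \<open>k ?T\<close> requires it to be non-zero. Were the unit ball
    null, scaling would make all balls and hence the whole space null, and the Gaussian law would
    have no mass.\<close>
  moreover have "k ?T \<noteq> 0"
  proof
    assume k0: "k ?T = 0"
    have Tcone: "scl d c x \<in> ?T \<longleftrightarrow> x \<in> ?T" if "x \<in> ?T" for c x
      using that by (simp add: scl_def space_lebd)
    have "emeasure (lebd d) {x \<in> ?T. nrm d x < real (Suc n)} = 0" for n
    proof -
      have "emeasure (lebd d) (?T \<inter> {x \<in> ?T. nrm d x < real (Suc n)}) = 0"
        using lebd_cone_ball[OF _ Tcone, of "real (Suc n)"] k0 unfolding k_def by simp
      then show ?thesis by (simp add: Int_absorb1)
    qed
    then have "(\<Union>n. {x \<in> ?T. nrm d x < real (Suc n)}) \<in> null_sets (lebd d)"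
      by (intro null_sets_UN) (simp add: null_sets_def lebd_ball_sets)
    moreover have "(\<Union>n. {x \<in> ?T. nrm d x < real (Suc n)}) = ?T"
    proof -
      have "\<exists>n. nrm d x < real (Suc n)" for x
        using reals_Archimedean2[of "nrm d x"] by (metis less_trans of_nat_less_iff lessI)
      then show ?thesis by blast
    qed
    ultimately have "?T \<in> null_sets (lebd d)" by (simp only:)
    then have "emeasure ?\<mu> ?T = 0"
      by (subst \<mu>) (simp, rule nn_integral_null_set)
    then show False using emeasure_space_1 by (simp add: sp)
  qed
  moreover have "k ?T * emeasure ?\<mu> (A \<inter> {x \<in> ?T. nrm d x \<in> B}) =
      k ?T * (emeasure ?\<mu> A * emeasure ?\<mu> {x \<in> ?T. nrm d x \<in> B})"
    using key[OF B] by (simp add: kA[symmetric] mult.assoc)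
  ultimately show ?thesis unfolding ennreal_mult_cancel_left by auto
qed

section \<open>Exchanging the radii for independent ones\<close>

definition rescale :: "nat \<Rightarrow> (nat \<Rightarrow> real) \<Rightarrow> (nat \<Rightarrow> real) \<Rightarrow> nat \<Rightarrow> real" where
  "rescale d y x = (\<lambda>i\<in>{..<d}. nrm d y * (x i / nrm d x))"

lemma measurable_nrm_std_gaussian [measurable]: "nrm d \<in> borel_measurable (std_gaussian d)"
  using measurable_nrm unfolding measurable_lebd_std_gaussian .

lemma measurable_into_std_gaussian:
  assumes "\<And>i. i < d \<Longrightarrow> (\<lambda>x. f x i) \<in> borel_measurable M"
  shows "(\<lambda>x. \<lambda>i\<in>{..<d}. f x i) \<in> measurable M (std_gaussian d)"
  unfolding std_gaussian_def using assms by (intro measurable_restrict) auto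

lemma ip_eq_0D: "finite I \<Longrightarrow> ip I x x = 0 \<Longrightarrow> i \<in> I \<Longrightarrow> x i = 0"
  unfolding ip_def by (subst (asm) sum_nonneg_eq_0_iff) auto

text \<open>The joint law of direction and norm is the product of its marginals, so the norm may as
  well be taken from an independent copy \<open>y\<close>.\<close>

lemma std_gaussian_rescale:
  assumes f: "f \<in> borel_measurable (std_gaussian d)"
  shows "(\<integral>\<^sup>+x. f x \<partial>std_gaussian d) = (\<integral>\<^sup>+x. \<integral>\<^sup>+y. f (rescale d y x) \<partial>std_gaussian d \<partial>std_gaussian d)"
proof -
  let ?\<mu> = "std_gaussian d" and ?dir = "\<lambda>x. \<lambda>i\<in>{..<d}. x i / nrm d x"
  interpret prob_space ?\<mu> by (rule prob_space_std_gaussian)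
  define G where "G = (\<lambda>(u, r). f (\<lambda>i\<in>{..<d}. r * u i))"
  have dm [measurable]: "?dir \<in> measurable ?\<mu> ?\<mu>"
    by (rule measurable_into_std_gaussian) measurable
  have "(\<lambda>p. \<lambda>i\<in>{..<d}. snd p * fst p i) \<in> measurable (?\<mu> \<Otimes>\<^sub>M borel) ?\<mu>"
  proof (rule measurable_into_std_gaussian)
    fix i assume "i < d"
    then have "(\<lambda>p. fst p i) \<in> borel_measurable (?\<mu> \<Otimes>\<^sub>M (borel :: real measure))"
      by (intro measurable_compose[OF measurable_fst measurable_std_gaussian_component])
    then show "(\<lambda>p. snd p * fst p i) \<in> borel_measurable (?\<mu> \<Otimes>\<^sub>M borel)" by measurable
  qed
  then have Gm: "G \<in> borel_measurable (?\<mu> \<Otimes>\<^sub>M borel)"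
    unfolding G_def case_prod_beta' by (rule measurable_compose[OF _ f])
  have sp: "space (lebd d) = space ?\<mu>" by (simp add: space_lebd space_std_gaussian)
  have st: "sets (lebd d) = sets ?\<mu>" by (simp add: sets_lebd sets_std_gaussian)
  have prod: "distr ?\<mu> ?\<mu> ?dir \<Otimes>\<^sub>M distr ?\<mu> borel (nrm d) = distr ?\<mu> (?\<mu> \<Otimes>\<^sub>M borel) (\<lambda>x. (?dir x, nrm d x))"
  proof (rule pair_measure_eqI)
    show "sigma_finite_measure (distr ?\<mu> ?\<mu> ?dir)" by (intro prob_space_imp_sigma_finite prob_space_distr dm)
    show "sigma_finite_measure (distr ?\<mu> borel (nrm d))"
      by (intro prob_space_imp_sigma_finite prob_space_distr measurable_nrm_std_gaussian)
    show "sets (distr ?\<mu> ?\<mu> ?dir \<Otimes>\<^sub>M distr ?\<mu> borel (nrm d)) = sets (distr ?\<mu> (?\<mu> \<Otimes>\<^sub>M borel) (\<lambda>x. (?dir x, nrm d x)))"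
      by (simp cong: sets_pair_measure_cong)
    fix A B assume "A \<in> sets (distr ?\<mu> ?\<mu> ?dir)" "B \<in> sets (distr ?\<mu> borel (nrm d))"
    then have A: "A \<in> sets ?\<mu>" and B: "B \<in> sets borel" by auto
    let ?A = "?dir -` A \<inter> space ?\<mu>" and ?B = "nrm d -` B \<inter> space ?\<mu>"
    \<comment> \<open>\<open>?dir\<close> is invariant under positive scaling, so events about it
      are cones.\<close>
    have "emeasure ?\<mu> (?A \<inter> {x \<in> space (lebd d). nrm d x \<in> B}) = emeasure ?\<mu> ?A * emeasure ?\<mu> {x \<in> space (lebd d). nrm d x \<in> B}"
    proof (rule std_gaussian_radius_indep)
      show "?A \<in> sets (lebd d)" unfolding st using A dm by (rule measurable_sets[rotated])
      fix c :: real and x assume c: "c > 0" and x: "x \<in> space (lebd d)"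
      have "?dir (scl d c x) = ?dir x"
      proof (rule restrict_ext)
        fix i assume "i \<in> {..<d}"
        then show "scl d c x i / nrm d (scl d c x) = x i / nrm d x"
          unfolding nrm_scl[OF c] using c by (simp add: scl_def)
      qed
      moreover have "scl d c x \<in> space ?\<mu>" by (simp add: scl_def space_std_gaussian)
      ultimately show "scl d c x \<in> ?A \<longleftrightarrow> x \<in> ?A" using x by (simp add: sp)
    qed fact
    moreover have "{x \<in> space (lebd d). nrm d x \<in> B} = ?B" by (auto simp: sp)
    moreover have "(\<lambda>x. (?dir x, nrm d x)) -` (A \<times> B) \<inter> space ?\<mu> = ?A \<inter> ?B" by auto
    moreover have "(\<lambda>x. (?dir x, nrm d x)) \<in> measurable ?\<mu> (?\<mu> \<Otimes>\<^sub>M borel)"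
      by (intro measurable_Pair dm measurable_nrm_std_gaussian)
    ultimately show "emeasure (distr ?\<mu> ?\<mu> ?dir) A * emeasure (distr ?\<mu> borel (nrm d)) B =
        emeasure (distr ?\<mu> (?\<mu> \<Otimes>\<^sub>M borel) (\<lambda>x. (?dir x, nrm d x))) (A \<times> B)"
      using A B by (simp add: emeasure_distr[OF dm A] emeasure_distr[OF measurable_nrm_std_gaussian B] emeasure_distr)
  qed
  have "(\<integral>\<^sup>+x. f x \<partial>?\<mu>) = (\<integral>\<^sup>+x. G (?dir x, nrm d x) \<partial>?\<mu>)"
  proof (rule nn_integral_cong)
    fix x assume x: "x \<in> space ?\<mu>"
    \<comment> \<open>This also holds for x of norm 0, where both sides are 0 by the convention for
      division by 0; no null set has to be removed.\<close>
    have "(\<lambda>i\<in>{..<d}. nrm d x * ?dir x i) = x"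
    proof (rule ext)
      fix i show "(\<lambda>i\<in>{..<d}. nrm d x * ?dir x i) i = x i"
      proof (cases "i < d")
        case True
        then show ?thesis using ip_eq_0D[of "{..<d}" x i] by auto
      next
        case False
        then show ?thesis using x by (auto simp: space_std_gaussian PiE_iff extensional_def)
      qed
    qed
    then show "f x = G (?dir x, nrm d x)" by (simp add: G_def)
  qed
  also have "\<dots> = (\<integral>\<^sup>+p. G p \<partial>distr ?\<mu> (?\<mu> \<Otimes>\<^sub>M borel) (\<lambda>x. (?dir x, nrm d x)))"
  proof (rule nn_integral_distr[symmetric])
    show "(\<lambda>x. (?dir x, nrm d x)) \<in> measurable ?\<mu> (?\<mu> \<Otimes>\<^sub>M borel)"
      by (intro measurable_Pair dm measurable_nrm_std_gaussian)
    show "G \<in> borel_measurable (distr ?\<mu> (?\<mu> \<Otimes>\<^sub>M borel) (\<lambda>x. (?dir x, nrm d x)))" using Gm by simp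
  qed
  also have "\<dots> = (\<integral>\<^sup>+u. \<integral>\<^sup>+r. G (u, r) \<partial>distr ?\<mu> borel (nrm d) \<partial>distr ?\<mu> ?\<mu> ?dir)"
  proof -
    interpret R: prob_space "distr ?\<mu> borel (nrm d)" by (intro prob_space_distr measurable_nrm_std_gaussian)
    have "G \<in> borel_measurable (distr ?\<mu> ?\<mu> ?dir \<Otimes>\<^sub>M distr ?\<mu> borel (nrm d))"
      using Gm by (simp cong: measurable_cong_sets sets_pair_measure_cong)
    from R.nn_integral_fst[OF this] show ?thesis unfolding prod by simp
  qed
  also have "\<dots> = (\<integral>\<^sup>+u. \<integral>\<^sup>+y. G (u, nrm d y) \<partial>?\<mu> \<partial>distr ?\<mu> ?\<mu> ?dir)"
  proof (rule nn_integral_cong)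
    fix u assume "u \<in> space (distr ?\<mu> ?\<mu> ?dir)"
    then have "(\<lambda>r. G (u, r)) \<in> borel_measurable borel" using Gm by (intro measurable_compose[OF _ Gm]) auto
    then show "(\<integral>\<^sup>+r. G (u, r) \<partial>distr ?\<mu> borel (nrm d)) = (\<integral>\<^sup>+y. G (u, nrm d y) \<partial>?\<mu>)"
      by (intro nn_integral_distr measurable_nrm_std_gaussian) (simp only: measurable_distr_eq1)
  qed
  also have "\<dots> = (\<integral>\<^sup>+x. \<integral>\<^sup>+y. G (?dir x, nrm d y) \<partial>?\<mu> \<partial>?\<mu>)"
  proof (rule nn_integral_distr[OF dm])
    have "(\<lambda>p. (fst p, nrm d (snd p))) \<in> measurable (?\<mu> \<Otimes>\<^sub>M ?\<mu>) (?\<mu> \<Otimes>\<^sub>M borel)"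
      by (intro measurable_Pair measurable_fst measurable_compose[OF measurable_snd measurable_nrm_std_gaussian])
    from measurable_compose[OF this Gm] have "(\<lambda>(u, y). G (u, nrm d y)) \<in> borel_measurable (?\<mu> \<Otimes>\<^sub>M ?\<mu>)"
      by (simp add: case_prod_beta')
    then have "(\<lambda>u. \<integral>\<^sup>+y. G (u, nrm d y) \<partial>?\<mu>) \<in> borel_measurable ?\<mu>"
      by (rule borel_measurable_nn_integral)
    then show "(\<lambda>u. \<integral>\<^sup>+y. G (u, nrm d y) \<partial>?\<mu>) \<in> borel_measurable (distr ?\<mu> ?\<mu> ?dir)" by simp
  qed
  also have "\<dots> = (\<integral>\<^sup>+x. \<integral>\<^sup>+y. f (rescale d y x) \<partial>?\<mu> \<partial>?\<mu>)"
  proof -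
    have "(\<lambda>i\<in>{..<d}. nrm d y * ?dir x i) = rescale d y x" for x y
      unfolding rescale_def by (rule restrict_ext) simp
    then show ?thesis by (simp add: G_def)
  qed
  finally show ?thesis .
qed

lemma measurable_rescale:
  "(\<lambda>p. rescale d (snd p) (fst p)) \<in> measurable (std_gaussian d \<Otimes>\<^sub>M std_gaussian d) (std_gaussian d)"
  unfolding rescale_def
proof (rule measurable_into_std_gaussian)
  let ?P = "std_gaussian d \<Otimes>\<^sub>M std_gaussian d"
  fix i assume i: "i < d"
  have "(\<lambda>p. fst p i) \<in> borel_measurable ?P" "(\<lambda>p. nrm d (fst p)) \<in> borel_measurable ?P" "(\<lambda>p. nrm d (snd p)) \<in> borel_measurable ?P"
    by (rule measurable_compose[OF measurable_fst measurable_std_gaussian_component[OF i]]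
      measurable_compose[OF measurable_fst measurable_nrm_std_gaussian]
      measurable_compose[OF measurable_snd measurable_nrm_std_gaussian])+
  then show "(\<lambda>p. nrm d (snd p) * (fst p i / nrm d (fst p))) \<in> borel_measurable ?P" by measurable
qed

definition rescale_all :: "nat \<Rightarrow> nat \<Rightarrow> (nat \<Rightarrow> nat \<Rightarrow> real) \<Rightarrow> (nat \<Rightarrow> nat \<Rightarrow> real) \<Rightarrow> nat \<Rightarrow> nat \<Rightarrow> real" where
  "rescale_all d m \<zeta> \<xi> = (\<lambda>j\<in>{..<m}. rescale d (\<zeta> j) (\<xi> j))"

lemma measurable_rescale_all:
  "(\<lambda>p. rescale_all d m (snd p) (fst p)) \<in> measurable (iid_gaussian_samples d m \<Otimes>\<^sub>M iid_gaussian_samples d m) (iid_gaussian_samples d m)"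
  unfolding rescale_all_def iid_gaussian_samples_def
proof (rule measurable_restrict)
  let ?P = "PiM {..<m} (\<lambda>_. std_gaussian d) \<Otimes>\<^sub>M PiM {..<m} (\<lambda>_. std_gaussian d)"
  fix j assume "j \<in> {..<m}"
  then have "(\<lambda>p. (fst p j, snd p j)) \<in> measurable ?P (std_gaussian d \<Otimes>\<^sub>M std_gaussian d)"
    by (intro measurable_Pair measurable_compose[OF measurable_fst measurable_component_singleton]
      measurable_compose[OF measurable_snd measurable_component_singleton])
  from measurable_compose[OF this measurable_rescale]
  show "(\<lambda>p. rescale d (snd p j) (fst p j)) \<in> measurable ?P (std_gaussian d)" by simp
qed

text \<open>Conditioning on the directions without conditional measures: \<xi> supplies the
  directions and an independent \<zeta> the radii, which makes the probability an iterated integral.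
  The law of the recombined samples is checked on boxes, where the integrals factor over the
  samples.\<close>

lemma iid_gaussian_rescale:
  assumes S: "S \<in> sets (iid_gaussian_samples d m)"
  shows "emeasure (iid_gaussian_samples d m) S =
    (\<integral>\<^sup>+\<xi>. emeasure (iid_gaussian_samples d m) {\<zeta> \<in> space (iid_gaussian_samples d m). rescale_all d m \<zeta> \<xi> \<in> S} \<partial>iid_gaussian_samples d m)"
proof -
  let ?\<mu> = "std_gaussian d" and ?Q = "iid_gaussian_samples d m"
  interpret mu: prob_space ?\<mu> by (rule prob_space_std_gaussian)
  interpret Q: prob_space ?Q by (rule prob_space_iid_gaussian_samples)
  interpret PS: product_sigma_finite "\<lambda>_::nat. ?\<mu>"
    by (simp add: product_sigma_finite_def mu.sigma_finite_measure_axioms)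
  let ?P = "distr (?Q \<Otimes>\<^sub>M ?Q) ?Q (\<lambda>p. rescale_all d m (snd p) (fst p))"
  have val: "emeasure ?P S = (\<integral>\<^sup>+\<xi>. emeasure ?Q {\<zeta> \<in> space ?Q. rescale_all d m \<zeta> \<xi> \<in> S} \<partial>?Q)"
    if S: "S \<in> sets ?Q" for S
  proof -
    let ?X = "(\<lambda>p. rescale_all d m (snd p) (fst p)) -` S \<inter> space (?Q \<Otimes>\<^sub>M ?Q)"
    have "emeasure ?P S = emeasure (?Q \<Otimes>\<^sub>M ?Q) ?X"
      by (rule emeasure_distr[OF measurable_rescale_all S])
    also have "\<dots> = (\<integral>\<^sup>+\<xi>. emeasure ?Q (Pair \<xi> -` ?X) \<partial>?Q)"
      by (rule Q.emeasure_pair_measure_alt) (rule measurable_sets[OF measurable_rescale_all S])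
    also have "\<dots> = (\<integral>\<^sup>+\<xi>. emeasure ?Q {\<zeta> \<in> space ?Q. rescale_all d m \<zeta> \<xi> \<in> S} \<partial>?Q)"
      by (intro nn_integral_cong arg_cong2[where f = emeasure] refl) (auto simp: space_pair_measure)
    finally show ?thesis .
  qed
  have "?P = PiM {..<m} (\<lambda>_. ?\<mu>)"
  proof (rule PS.PiM_eqI)
    fix A assume A: "\<And>j. j \<in> {..<m} \<Longrightarrow> A j \<in> sets ?\<mu>"
    have inner: "(\<lambda>x. \<integral>\<^sup>+y. indicator (A j) (rescale d y x) \<partial>?\<mu>) \<in> borel_measurable ?\<mu>" 
      "x \<in> space ?\<mu> \<Longrightarrow> (\<lambda>y. indicator (A j) (rescale d y x) :: ennreal) \<in> borel_measurable ?\<mu>" if "j \<in> {..<m}" for j x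
    proof -
      have m: "(\<lambda>p. indicator (A j) (rescale d (snd p) (fst p)) :: ennreal) \<in> borel_measurable (?\<mu> \<Otimes>\<^sub>M ?\<mu>)"
        by (rule measurable_compose[OF measurable_rescale borel_measurable_indicator[OF A[OF that]]])
      then have "(\<lambda>(x, y). indicator (A j) (rescale d y x) :: ennreal) \<in> borel_measurable (?\<mu> \<Otimes>\<^sub>M ?\<mu>)"
        by (simp add: case_prod_beta')
      then show "(\<lambda>x. \<integral>\<^sup>+y. indicator (A j) (rescale d y x) \<partial>?\<mu>) \<in> borel_measurable ?\<mu>"
        by (rule mu.borel_measurable_nn_integral)
      show "(\<lambda>y. indicator (A j) (rescale d y x) :: ennreal) \<in> borel_measurable ?\<mu>" if "x \<in> space ?\<mu>"
        using measurable_compose[OF measurable_Pair1'[OF that] m] by simp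
    qed
    have box: "Pi\<^sub>E {..<m} A \<in> sets ?Q" unfolding iid_gaussian_samples_def
      by (rule sets_PiM_I_finite) (use A in simp_all)
    have "emeasure ?P (Pi\<^sub>E {..<m} A) = (\<integral>\<^sup>+\<xi>. emeasure ?Q {\<zeta> \<in> space ?Q. rescale_all d m \<zeta> \<xi> \<in> Pi\<^sub>E {..<m} A} \<partial>?Q)"
      by (rule val[OF box])
    also have "\<dots> = (\<integral>\<^sup>+\<xi>. (\<Prod>j<m. \<integral>\<^sup>+y. indicator (A j) (rescale d y (\<xi> j)) \<partial>?\<mu>) \<partial>?Q)"
    proof (rule nn_integral_cong)
      fix \<xi> assume \<xi>: "\<xi> \<in> space ?Q"
      then have \<xi>j: "\<xi> j \<in> space ?\<mu>" if "j < m" for j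
        using that by (auto simp: iid_gaussian_samples_def space_PiM PiE_iff)
      have "{\<zeta> \<in> space ?Q. rescale_all d m \<zeta> \<xi> \<in> Pi\<^sub>E {..<m} A} \<in> sets ?Q"
      proof -
        have "(\<lambda>\<zeta>. rescale_all d m \<zeta> \<xi>) \<in> measurable ?Q ?Q"
          using measurable_compose[OF measurable_Pair1'[OF \<xi>] measurable_rescale_all] by simp
        from measurable_sets[OF this box] show ?thesis by (simp add: vimage_def Int_def conj_commute)
      qed
      then have "emeasure ?Q {\<zeta> \<in> space ?Q. rescale_all d m \<zeta> \<xi> \<in> Pi\<^sub>E {..<m} A} =
          (\<integral>\<^sup>+\<zeta>. indicator {\<zeta> \<in> space ?Q. rescale_all d m \<zeta> \<xi> \<in> Pi\<^sub>E {..<m} A} \<zeta> \<partial>?Q)" by simp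
      also have "\<dots> = (\<integral>\<^sup>+\<zeta>. (\<Prod>j<m. indicator (A j) (rescale d (\<zeta> j) (\<xi> j))) \<partial>?Q)"
      proof (rule nn_integral_cong)
        fix \<zeta> assume "\<zeta> \<in> space ?Q"
        have "rescale_all d m \<zeta> \<xi> \<in> Pi\<^sub>E {..<m} A \<longleftrightarrow> (\<forall>j<m. rescale d (\<zeta> j) (\<xi> j) \<in> A j)"
          unfolding rescale_all_def restrict_PiE_iff by auto
        then show "indicator {\<zeta> \<in> space ?Q. rescale_all d m \<zeta> \<xi> \<in> Pi\<^sub>E {..<m} A} \<zeta> = (\<Prod>j<m. indicator (A j) (rescale d (\<zeta> j) (\<xi> j)) :: ennreal)"
          using \<open>\<zeta> \<in> space ?Q\<close> by (auto simp: indicator_def)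
      qed
      also have "\<dots> = (\<Prod>j<m. \<integral>\<^sup>+y. indicator (A j) (rescale d y (\<xi> j)) \<partial>?\<mu>)"
        unfolding iid_gaussian_samples_def
        by (rule PS.product_nn_integral_prod[where f = "\<lambda>j y. indicator (A j) (rescale d y (\<xi> j))"])
          (use inner(2) \<xi>j in auto)
      finally show "emeasure ?Q {\<zeta> \<in> space ?Q. rescale_all d m \<zeta> \<xi> \<in> Pi\<^sub>E {..<m} A} =
          (\<Prod>j<m. \<integral>\<^sup>+y. indicator (A j) (rescale d y (\<xi> j)) \<partial>?\<mu>)" .
    qed
    also have "\<dots> = (\<Prod>j<m. \<integral>\<^sup>+x. \<integral>\<^sup>+y. indicator (A j) (rescale d y x) \<partial>?\<mu> \<partial>?\<mu>)"
      unfolding iid_gaussian_samples_def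
      by (rule PS.product_nn_integral_prod[where f = "\<lambda>j x. \<integral>\<^sup>+y. indicator (A j) (rescale d y x) \<partial>?\<mu>"])
        (use inner(1) in auto)
    also have "\<dots> = (\<Prod>j<m. emeasure ?\<mu> (A j))"
    proof (rule prod.cong[OF refl])
      fix j assume "j \<in> {..<m}"
      then have "A j \<in> sets ?\<mu>" by (rule A)
      then show "(\<integral>\<^sup>+x. \<integral>\<^sup>+y. indicator (A j) (rescale d y x) \<partial>?\<mu> \<partial>?\<mu>) = emeasure ?\<mu> (A j)"
        using std_gaussian_rescale[of "indicator (A j)" d, symmetric] by simp
    qed
    finally show "emeasure ?P (Pi\<^sub>E {..<m} A) = (\<Prod>j\<in>{..<m}. emeasure ?\<mu> (A j))" .
  qed (simp_all add: iid_gaussian_samples_def)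
  then have "emeasure ?Q S = emeasure ?P S" by (simp add: iid_gaussian_samples_def)
  then show ?thesis using val[OF S] by simp
qed

section \<open>The Gram matrix of the samples on the sphere\<close>

text \<open>For \<open>u = sqrt d x / |x|\<close> and \<open>v = sqrt d y / |y|\<close> on the sphere of radius \<open>sqrt d\<close>,
  \<open>kern d x y\<close> is the inner product of the traceless matrices \<open>u u\<^sup>T - I\<close> and \<open>v v\<^sup>T - I\<close>.\<close>

definition kern :: "nat \<Rightarrow> (nat \<Rightarrow> real) \<Rightarrow> (nat \<Rightarrow> real) \<Rightarrow> real" where
  "kern d x y = (real d)\<^sup>2 * (ip {..<d} x y)\<^sup>2 / (ip {..<d} x x * ip {..<d} y y) - real d"

definition Kmat :: "nat \<Rightarrow> (nat \<Rightarrow> nat \<Rightarrow> real) \<Rightarrow> nat \<Rightarrow> nat \<Rightarrow> real" where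
  "Kmat d \<xi> i j = (if i = j then 0 else kern d (\<xi> i) (\<xi> j))"

text \<open>The event to which trace moments are restricted. As it refers to the samples in V only,
  it passes to subsets and is unaffected by resampling an index outside V, so the recursion can drop
  an index and then average over it. The lower bound on the norms lets Gaussian moments stand in for
  moments on the sphere.\<close>

definition Good :: "nat \<Rightarrow> real \<Rightarrow> nat set \<Rightarrow> (nat \<Rightarrow> nat \<Rightarrow> real) \<Rightarrow> bool" where
  "Good d \<kappa> V \<xi> \<longleftrightarrow> (\<forall>i\<in>V. real d / 2 \<le> ip {..<d} (\<xi> i) (\<xi> i)) \<and>
     (\<forall>i\<in>V. \<forall>j\<in>V. i \<noteq> j \<longrightarrow> \<bar>kern d (\<xi> i) (\<xi> j)\<bar> \<le> \<kappa>)"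

lemma kern_commute: "kern d x y = kern d y x"
  by (simp add: kern_def ip_commute[of _ x y] mult.commute)

lemma Kmat_commute: "Kmat d \<xi> i j = Kmat d \<xi> j i"
  by (simp add: Kmat_def kern_commute)

lemma kern_self: "ip {..<d} x x \<noteq> 0 \<Longrightarrow> kern d x x = (real d)\<^sup>2 - real d"
  by (simp add: kern_def power2_eq_square)

text \<open>With u_j for the direction of \<open>y j\<close> on the sphere of radius sqrt d,
  \<open>W\<close> is the sum of w_j (u_j u_j^T - I). A combination of kernels is thus a single
  quadratic form in x, up to the radial factor d / |x|^2.\<close>

lemma kern_combination_quadratic_form:
  fixes J :: "'j set" and w :: "'j \<Rightarrow> real" and y :: "'j \<Rightarrow> nat \<Rightarrow> real"
  assumes x: "ip {..<d} x x > 0"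
  defines "W \<equiv> \<lambda>a b. \<Sum>j\<in>J. w j * (real d * y j a * y j b / ip {..<d} (y j) (y j) - of_bool (a = b))"
  shows "(\<Sum>j\<in>J. w j * kern d x (y j)) = real d / ip {..<d} x x * (\<Sum>a<d. \<Sum>b<d. W a b * x a * x b)"
proof -
  have one: "(\<Sum>a<d. \<Sum>b<d. (real d * y j a * y j b / ip {..<d} (y j) (y j) - of_bool (a = b)) * x a * x b)
      = real d * (ip {..<d} x (y j))\<^sup>2 / ip {..<d} (y j) (y j) - ip {..<d} x x" for j
  proof -
    have "(\<Sum>a<d. \<Sum>b<d. (real d * y j a * y j b / ip {..<d} (y j) (y j) - of_bool (a = b)) * x a * x b)
        = real d / ip {..<d} (y j) (y j) * (\<Sum>a<d. \<Sum>b<d. (x a * y j a) * (x b * y j b)) - (\<Sum>a<d. \<Sum>b<d. if b = a then x a * x b else 0)"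
      unfolding sum_distrib_left sum_subtractf[symmetric]
      by (intro sum.cong refl) (auto simp: field_simps)
    also have "(\<Sum>a<d. \<Sum>b<d. (x a * y j a) * (x b * y j b)) = (ip {..<d} x (y j))\<^sup>2"
      by (simp add: ip_def power2_eq_square sum_product)
    also have "(\<Sum>a<d. \<Sum>b<d. if b = a then x a * x b else 0) = ip {..<d} x x"
      by (simp add: ip_def)
    finally show ?thesis by simp
  qed
  have "(\<Sum>a<d. \<Sum>b<d. W a b * x a * x b) =
      (\<Sum>j\<in>J. w j * (\<Sum>a<d. \<Sum>b<d. (real d * y j a * y j b / ip {..<d} (y j) (y j) - of_bool (a = b)) * x a * x b))"
  proof -
    have "(\<Sum>a<d. \<Sum>b<d. W a b * x a * x b) = (\<Sum>a<d. \<Sum>b<d. \<Sum>j\<in>J. w j * ((real d * y j a * y j b / ip {..<d} (y j) (y j) - of_bool (a = b)) * x a * x b))"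
      by (simp add: W_def sum_distrib_right mult.assoc)
    also have "\<dots> = (\<Sum>a<d. \<Sum>j\<in>J. \<Sum>b<d. w j * ((real d * y j a * y j b / ip {..<d} (y j) (y j) - of_bool (a = b)) * x a * x b))"
      by (intro sum.cong refl sum.swap)
    also have "\<dots> = (\<Sum>j\<in>J. \<Sum>a<d. \<Sum>b<d. w j * ((real d * y j a * y j b / ip {..<d} (y j) (y j) - of_bool (a = b)) * x a * x b))"
      by (rule sum.swap)
    finally show ?thesis by (simp add: sum_distrib_left)
  qed
  then have "real d / ip {..<d} x x * (\<Sum>a<d. \<Sum>b<d. W a b * x a * x b) =
      (\<Sum>j\<in>J. w j * (real d / ip {..<d} x x * (real d * (ip {..<d} x (y j))\<^sup>2 / ip {..<d} (y j) (y j) - ip {..<d} x x)))"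
    unfolding one by (simp add: sum_distrib_left mult_ac)
  also have "\<dots> = (\<Sum>j\<in>J. w j * kern d x (y j))"
    using x by (intro sum.cong refl) (simp add: kern_def power2_eq_square right_diff_distrib mult_ac)
  finally show ?thesis ..
qed

text \<open>\<open>kern\<close> is the Frobenius inner product of the matrices u u^T - I, so the
  squared norm of a combination is the corresponding Gram form. The trace vanishes because u has
  squared norm d.\<close>

lemma kern_combination_frobenius:
  fixes J :: "'j set" and w :: "'j \<Rightarrow> real" and y :: "'j \<Rightarrow> nat \<Rightarrow> real"
  assumes y: "\<And>j. j \<in> J \<Longrightarrow> ip {..<d} (y j) (y j) > 0"
  defines "W \<equiv> \<lambda>a b. \<Sum>j\<in>J. w j * (real d * y j a * y j b / ip {..<d} (y j) (y j) - of_bool (a = b))"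
  shows "(\<Sum>a<d. \<Sum>b<d. (W a b)\<^sup>2) = (\<Sum>j\<in>J. \<Sum>l\<in>J. w j * w l * kern d (y j) (y l))"
    and "(\<Sum>a<d. W a a) = 0"
proof -
  define U where "U j a b = real d * y j a * y j b / ip {..<d} (y j) (y j) - of_bool (a = b)" for j a b
  have inner: "(\<Sum>a<d. \<Sum>b<d. U j a b * U l a b) = kern d (y j) (y l)" if "j \<in> J" "l \<in> J" for j l
  proof -
    let ?p = "ip {..<d} (y j) (y j)" and ?q = "ip {..<d} (y l) (y l)"
    have "(\<Sum>a<d. \<Sum>b<d. U j a b * U l a b) =
      (\<Sum>a<d. \<Sum>b<d. (real d)\<^sup>2 / (?p * ?q) * ((y j a * y l a) * (y j b * y l b)))
       - (\<Sum>a<d. \<Sum>b<d. if b = a then real d / ?p * (y j a * y j b) else 0)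
       - (\<Sum>a<d. \<Sum>b<d. if b = a then real d / ?q * (y l a * y l b) else 0)
       + (\<Sum>a<d. \<Sum>b<d. if b = a then 1 else 0)"
      unfolding sum_subtractf[symmetric] sum.distrib[symmetric]
      by (intro sum.cong refl) (auto simp: U_def power2_eq_square left_diff_distrib right_diff_distrib mult_ac)
    also have "(\<Sum>a<d. \<Sum>b<d. (real d)\<^sup>2 / (?p * ?q) * ((y j a * y l a) * (y j b * y l b))) = (real d)\<^sup>2 / (?p * ?q) * (ip {..<d} (y j) (y l))\<^sup>2"
    proof -
      have "(\<Sum>a<d. \<Sum>b<d. (y j a * y l a) * (y j b * y l b)) = (ip {..<d} (y j) (y l))\<^sup>2"
        by (simp add: ip_def power2_eq_square sum_product)
      then show ?thesis by (simp only: sum_distrib_left[symmetric])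
    qed
    also have "(\<Sum>a<d. \<Sum>b<d. if b = a then real d / ?p * (y j a * y j b) else 0) = real d / ?p * ?p"
      by (simp add: ip_def sum_distrib_left)
    also have "(\<Sum>a<d. \<Sum>b<d. if b = a then real d / ?q * (y l a * y l b) else 0) = real d / ?q * ?q"
      by (simp add: ip_def sum_distrib_left)
    also have "(\<Sum>a<d. \<Sum>b<d. if b = a then 1 else 0) = real d" by simp
    finally show ?thesis using y[OF that(1)] y[OF that(2)] by (simp add: kern_def)
  qed
  have W: "W a b = (\<Sum>j\<in>J. w j * U j a b)" for a b by (simp add: W_def U_def)
  have "(\<Sum>a<d. \<Sum>b<d. (W a b)\<^sup>2) = (\<Sum>a<d. \<Sum>b<d. \<Sum>j\<in>J. \<Sum>l\<in>J. w j * w l * (U j a b * U l a b))"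
    unfolding W power2_eq_square sum_product by (intro sum.cong refl) (simp add: mult_ac)
  also have "\<dots> = (\<Sum>a<d. \<Sum>j\<in>J. \<Sum>b<d. \<Sum>l\<in>J. w j * w l * (U j a b * U l a b))"
    by (intro sum.cong refl sum.swap)
  also have "\<dots> = (\<Sum>j\<in>J. \<Sum>a<d. \<Sum>b<d. \<Sum>l\<in>J. w j * w l * (U j a b * U l a b))"
    by (rule sum.swap)
  also have "\<dots> = (\<Sum>j\<in>J. \<Sum>a<d. \<Sum>l\<in>J. \<Sum>b<d. w j * w l * (U j a b * U l a b))"
    by (intro sum.cong refl sum.swap)
  also have "\<dots> = (\<Sum>j\<in>J. \<Sum>l\<in>J. \<Sum>a<d. \<Sum>b<d. w j * w l * (U j a b * U l a b))"
    by (intro sum.cong refl sum.swap)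
  also have "\<dots> = (\<Sum>j\<in>J. \<Sum>l\<in>J. w j * w l * kern d (y j) (y l))"
    by (intro sum.cong refl) (simp add: sum_distrib_left[symmetric] inner)
  finally show "(\<Sum>a<d. \<Sum>b<d. (W a b)\<^sup>2) = (\<Sum>j\<in>J. \<Sum>l\<in>J. w j * w l * kern d (y j) (y l))" .
  have "(\<Sum>a<d. W a a) = (\<Sum>j\<in>J. \<Sum>a<d. w j * U j a a)" unfolding W by (rule sum.swap)
  also have "\<dots> = (\<Sum>j\<in>J. w j * 0)"
  proof (intro sum.cong refl)
    fix j assume j: "j \<in> J"
    have "(\<Sum>a<d. U j a a) = real d / ip {..<d} (y j) (y j) * ip {..<d} (y j) (y j) - real d"
      by (simp add: U_def sum_subtractf ip_def sum_distrib_left mult.assoc)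
    then have "(\<Sum>a<d. U j a a) = 0" using y[OF j] by simp
    then show "(\<Sum>a<d. w j * U j a a) = w j * 0" by (simp add: sum_distrib_left[symmetric])
  qed
  finally show "(\<Sum>a<d. W a a) = 0" by simp
qed

lemma kern_gram:
  assumes fin: "finite J" and y: "\<And>j. j \<in> J \<Longrightarrow> ip {..<d} (\<xi> j) (\<xi> j) > 0"
  shows "(\<Sum>j\<in>J. \<Sum>l\<in>J. w j * w l * kern d (\<xi> j) (\<xi> l)) = ((real d)\<^sup>2 - real d) * ip J w w + ip J w (mv J (Kmat d \<xi>) w)"
proof -
  have "(\<Sum>l\<in>J. w j * w l * kern d (\<xi> j) (\<xi> l)) = ((real d)\<^sup>2 - real d) * (w j * w j) + w j * mv J (Kmat d \<xi>) w j" if j: "j \<in> J" for j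
  proof -
    have "(\<Sum>l\<in>J. w j * w l * kern d (\<xi> j) (\<xi> l)) = (\<Sum>l\<in>J. (if l = j then ((real d)\<^sup>2 - real d) * (w j * w j) else 0) + w j * (Kmat d \<xi> j l * w l))"
      using y[OF j] by (intro sum.cong refl) (auto simp: Kmat_def kern_self)
    then show ?thesis using fin j by (simp add: sum.distrib mv_def sum_distrib_left)
  qed
  then show ?thesis by (simp add: ip_def sum.distrib sum_distrib_left)
qed

text \<open>Where |x|^2 is at least d / 2, the squared radial factor is at most 4, and a traceless
  quadratic form has second moment twice its squared Frobenius norm; hence the 8. Truncation and
  Gaussian moments replace integrals over the sphere.\<close>

lemma kern_combination_second_moment:
  assumes fin: "finite J" and y: "\<And>j. j \<in> J \<Longrightarrow> ip {..<d} (\<xi> j) (\<xi> j) > 0" and d: "d \<ge> 1"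
  shows "(\<integral>\<^sup>+x. ennreal (of_bool (real d / 2 \<le> ip {..<d} x x) * (\<Sum>j\<in>J. w j * kern d x (\<xi> j))\<^sup>2) \<partial>std_gaussian d)
    \<le> ennreal (8 * (((real d)\<^sup>2 - real d) * ip J w w + ip J w (mv J (Kmat d \<xi>) w)))"
proof -
  define W where "W a b = (\<Sum>j\<in>J. w j * (real d * \<xi> j a * \<xi> j b / ip {..<d} (\<xi> j) (\<xi> j) - of_bool (a = b)))" for a b
  have m: "(\<lambda>x. \<Sum>a<d. \<Sum>b<d. W a b * x a * x b) \<in> borel_measurable (std_gaussian d)"
    by (intro borel_measurable_sum borel_measurable_times borel_measurable_const measurable_std_gaussian_component) auto
  have "(\<integral>\<^sup>+x. ennreal (of_bool (real d / 2 \<le> ip {..<d} x x) * (\<Sum>j\<in>J. w j * kern d x (\<xi> j))\<^sup>2) \<partial>std_gaussian d)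
    \<le> (\<integral>\<^sup>+x. ennreal 4 * ennreal ((\<Sum>a<d. \<Sum>b<d. W a b * x a * x b)\<^sup>2) \<partial>std_gaussian d)"
  proof (rule nn_integral_mono)
    fix x
    have "of_bool (real d / 2 \<le> ip {..<d} x x) * (\<Sum>j\<in>J. w j * kern d x (\<xi> j))\<^sup>2 \<le> 4 * (\<Sum>a<d. \<Sum>b<d. W a b * x a * x b)\<^sup>2"
    proof (cases "real d / 2 \<le> ip {..<d} x x")
      case True
      then have p: "ip {..<d} x x > 0" using d by linarith
      have "(\<Sum>j\<in>J. w j * kern d x (\<xi> j))\<^sup>2 = (real d / ip {..<d} x x)\<^sup>2 * (\<Sum>a<d. \<Sum>b<d. W a b * x a * x b)\<^sup>2"
        unfolding kern_combination_quadratic_form[OF p] W_def by (rule power_mult_distrib)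
      also have "\<dots> \<le> 2\<^sup>2 * (\<Sum>a<d. \<Sum>b<d. W a b * x a * x b)\<^sup>2"
        using True p d by (intro mult_right_mono power_mono) (auto simp: field_simps)
      finally show ?thesis using True by simp
    qed simp
    then show "ennreal (of_bool (real d / 2 \<le> ip {..<d} x x) * (\<Sum>j\<in>J. w j * kern d x (\<xi> j))\<^sup>2)
        \<le> ennreal 4 * ennreal ((\<Sum>a<d. \<Sum>b<d. W a b * x a * x b)\<^sup>2)"
      by (subst ennreal_mult[symmetric]) (auto intro: ennreal_leI)
  qed
  also have "\<dots> = ennreal 4 * ennreal (2 * (\<Sum>a<d. \<Sum>b<d. (W a b)\<^sup>2))"
  proof (subst nn_integral_cmult)
    show "(\<lambda>x. ennreal ((\<Sum>a<d. \<Sum>b<d. W a b * x a * x b)\<^sup>2)) \<in> borel_measurable (std_gaussian d)"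
      using m by measurable
    have "W a b = W b a" for a b by (simp add: W_def mult_ac eq_commute)
    moreover have "(\<Sum>a<d. W a a) = 0"
      using kern_combination_frobenius(2)[of J d \<xi> w] y by (simp add: W_def)
    ultimately show "ennreal 4 * (\<integral>\<^sup>+x. ennreal ((\<Sum>a<d. \<Sum>b<d. W a b * x a * x b)\<^sup>2) \<partial>std_gaussian d) =
        ennreal 4 * ennreal (2 * (\<Sum>a<d. \<Sum>b<d. (W a b)\<^sup>2))"
      by (subst std_gaussian_quadratic_form) auto
  qed
  also have "\<dots> = ennreal (8 * (\<Sum>a<d. \<Sum>b<d. (W a b)\<^sup>2))"
    by (subst ennreal_mult[symmetric]) (auto intro!: sum_nonneg)
  also have "(\<Sum>a<d. \<Sum>b<d. (W a b)\<^sup>2) = ((real d)\<^sup>2 - real d) * ip J w w + ip J w (mv J (Kmat d \<xi>) w)"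
    using kern_combination_frobenius(1)[of J d \<xi> w] kern_gram[OF fin y] y by (simp add: W_def)
  finally show ?thesis .
qed

section \<open>Measurability of iterates, kernels and good events\<close>

lemma mv_funpow_cong:
  assumes "\<And>i k. i \<in> J \<Longrightarrow> k \<in> J \<Longrightarrow> A i k = A' i k" "\<And>i. i \<in> J \<Longrightarrow> v i = v' i"
  shows "i \<in> J \<Longrightarrow> (mv J A ^^ n) v i = (mv J A' ^^ n) v' i"
proof (induction n arbitrary: i)
  case (Suc n)
  have "mv J A ((mv J A ^^ n) v) i = mv J A' ((mv J A' ^^ n) v') i"
    unfolding mv_def[of J A "(mv J A ^^ n) v"] mv_def[of J A' "(mv J A' ^^ n) v'"]
    by (intro sum.cong refl) (simp add: assms Suc)
  then show ?case by simp
qed (simp add: assms)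

lemma measurable_mv_funpow:
  assumes A: "\<And>i k. i \<in> J \<Longrightarrow> k \<in> J \<Longrightarrow> (\<lambda>x. A x i k) \<in> borel_measurable M"
    and v: "\<And>i. i \<in> J \<Longrightarrow> (\<lambda>x. v x i) \<in> borel_measurable M"
  shows "i \<in> J \<Longrightarrow> (\<lambda>x. (mv J (A x) ^^ n) (v x) i) \<in> borel_measurable M"
proof (induction n arbitrary: i)
  case (Suc n)
  have "(mv J (A x) ^^ Suc n) (v x) i = (\<Sum>k\<in>J. A x i k * (mv J (A x) ^^ n) (v x) k)" for x
    by (simp only: funpow.simps o_apply) (rule mv_apply)
  moreover have "(\<lambda>x. \<Sum>k\<in>J. A x i k * (mv J (A x) ^^ n) (v x) k) \<in> borel_measurable M"
    using Suc A by (intro borel_measurable_sum borel_measurable_times) auto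
  ultimately show ?case by (simp only:)
qed (simp add: v)

lemma measurable_ip:
  assumes "\<And>i. i \<in> J \<Longrightarrow> (\<lambda>x. v x i) \<in> borel_measurable M" "\<And>i. i \<in> J \<Longrightarrow> (\<lambda>x. w x i) \<in> borel_measurable M"
  shows "(\<lambda>x. ip J (v x) (w x)) \<in> borel_measurable M"
  unfolding ip_def using assms by (intro borel_measurable_sum borel_measurable_times) auto

lemma measurable_kern:
  assumes "\<And>a. a < d \<Longrightarrow> (\<lambda>x. v x a) \<in> borel_measurable M" "\<And>a. a < d \<Longrightarrow> (\<lambda>x. w x a) \<in> borel_measurable M"
  shows "(\<lambda>x. kern d (v x) (w x)) \<in> borel_measurable M"
  unfolding kern_def
  by (intro borel_measurable_diff borel_measurable_divide borel_measurable_times borel_measurable_power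
      borel_measurable_const measurable_ip) (use assms in auto)

lemma measurable_iid_component:
  assumes "j < m" "a < d"
  shows "(\<lambda>\<xi>. \<xi> j a) \<in> borel_measurable (iid_gaussian_samples d m)"
proof -
  have "(\<lambda>\<xi>. \<xi> j) \<in> measurable (iid_gaussian_samples d m) (std_gaussian d)"
    unfolding iid_gaussian_samples_def using assms by (intro measurable_component_singleton) auto
  then show ?thesis by (rule measurable_compose[OF _ measurable_std_gaussian_component[OF assms(2)]])
qed

lemma measurable_Kmat:
  assumes "i < m" "j < m"
  shows "(\<lambda>\<xi>. Kmat d \<xi> i j) \<in> borel_measurable (iid_gaussian_samples d m)"
  using assms by (cases "i = j") (auto simp: Kmat_def intro!: measurable_kern measurable_iid_component)

lemma sets_Good:
  assumes "V \<subseteq> {..<m}"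
  shows "{\<xi> \<in> space (iid_gaussian_samples d m). Good d \<kappa> V \<xi>} \<in> sets (iid_gaussian_samples d m)"
proof -
  have fin: "finite V" using assms finite_subset by blast
  have i: "{\<xi> \<in> space (iid_gaussian_samples d m). real d / 2 \<le> ip {..<d} (\<xi> i) (\<xi> i)} \<in> sets (iid_gaussian_samples d m)"
    if "i \<in> V" for i
  proof -
    have "(\<lambda>\<xi>. ip {..<d} (\<xi> i) (\<xi> i)) \<in> borel_measurable (iid_gaussian_samples d m)"
      using that assms by (auto intro!: measurable_ip measurable_iid_component)
    then show ?thesis by (intro borel_measurable_le borel_measurable_const)
  qed
  have ij: "{\<xi> \<in> space (iid_gaussian_samples d m). \<bar>kern d (\<xi> i) (\<xi> j)\<bar> \<le> \<kappa>} \<in> sets (iid_gaussian_samples d m)"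
    if "i \<in> V" "j \<in> V" for i j
  proof -
    have "(\<lambda>\<xi>. kern d (\<xi> i) (\<xi> j)) \<in> borel_measurable (iid_gaussian_samples d m)"
      using that assms by (auto intro!: measurable_kern measurable_iid_component)
    then show ?thesis by (intro borel_measurable_le borel_measurable_const borel_measurable_abs)
  qed
  show ?thesis unfolding Good_def
    by (intro sets.sets_Collect_conj sets.sets_Collect_finite_All sets.sets_Collect_imp sets.sets_Collect_const i ij fin)
qed

section \<open>The recursion for the truncated trace moments\<close>

definition tau :: "nat \<Rightarrow> nat \<Rightarrow> nat set \<Rightarrow> (nat \<Rightarrow> nat \<Rightarrow> real) \<Rightarrow> real" where
  "tau d n V \<xi> = hs V (mv V (Kmat d \<xi>) ^^ n) (mv V (Kmat d \<xi>) ^^ n)"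

lemma tau_nonneg [simp]: "0 \<le> tau d n V \<xi>"
  by (simp add: tau_def)

lemma measurable_tau:
  assumes "V \<subseteq> {..<m}"
  shows "tau d n V \<in> borel_measurable (iid_gaussian_samples d m)"
  unfolding tau_def[abs_def] hs_def using assms
  by (intro borel_measurable_sum measurable_ip measurable_mv_funpow measurable_Kmat) auto

text \<open>The moments are kept for all index sets V, since the recursion passes from V to
  \<open>V - {i}\<close>; values in the extended reals make integrability a consequence of the
  bounds.\<close>

definition Phi :: "nat \<Rightarrow> nat \<Rightarrow> real \<Rightarrow> nat \<Rightarrow> nat set \<Rightarrow> ennreal" where
  "Phi d m \<kappa> n V = (\<integral>\<^sup>+\<xi>. ennreal (of_bool (Good d \<kappa> V \<xi>) * tau d n V \<xi>) \<partial>iid_gaussian_samples d m)"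

lemma borel_measurable_of_bool:
  assumes "{x \<in> space M. P x} \<in> sets M"
  shows "(\<lambda>x. of_bool (P x) :: real) \<in> borel_measurable M"
proof -
  have "(\<lambda>x. indicator {x \<in> space M. P x} x :: real) \<in> borel_measurable M"
    using assms by (rule borel_measurable_indicator)
  then show ?thesis by (subst measurable_cong[where g = "indicator {x \<in> space M. P x}"]) auto
qed

lemma borel_measurable_ennreal_affine:
  fixes f :: "'a \<Rightarrow> ennreal"
  assumes [measurable]: "f \<in> borel_measurable M"
  shows "(\<lambda>x. f x + b) \<in> borel_measurable M" "(\<lambda>x. c * (f x + b)) \<in> borel_measurable M"
  by measurable

lemma ennreal_lincomb:
  assumes "0 \<le> a" "0 \<le> b" "0 \<le> x" "0 \<le> y"
  shows "ennreal a * ennreal x + ennreal b * ennreal y = ennreal (a * x + b * y)"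
  using assms by (simp add: ennreal_mult)

text \<open>The operator on \<open>V - {i}\<close> does not involve sample i, so with the other
  samples fixed each coordinate of w is a linear combination of kernels in that sample. Its second
  moment is a quadratic form in the coefficients \<open>e l\<close>; summed over l it gives moments
  of order n and, through the \<open>Kmat\<close> part, of order n + 1 over the smaller index
  set.\<close>

lemma Phi_row_bound:
  fixes n :: nat
  assumes d: "d \<ge> 1" and V: "V \<subseteq> {..<m}" "i \<in> V"
  defines "w \<equiv> \<lambda>\<xi>. (mv (V - {i}) (Kmat d \<xi>) ^^ n) (\<lambda>l. Kmat d \<xi> l i)"
  shows "(\<integral>\<^sup>+\<xi>. ennreal (of_bool (Good d \<kappa> V \<xi>) * ip (V - {i}) (w \<xi>) (w \<xi>)) \<partial>iid_gaussian_samples d m)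
    \<le> ennreal (12 * (real d)\<^sup>2) * Phi d m \<kappa> n (V - {i}) + ennreal (4 / (real d)\<^sup>2) * Phi d m \<kappa> (Suc n) (V - {i})"
proof -
  let ?Q = "iid_gaussian_samples d m" and ?\<mu> = "std_gaussian d" and ?J = "V - {i}"
  have fin: "finite ?J" using V finite_subset by blast
  have J: "?J \<subseteq> {..<m}" and im: "i < m" using V by auto
  define F where "F \<xi> = ennreal (of_bool (Good d \<kappa> ?J \<xi>) * (of_bool (real d / 2 \<le> ip {..<d} (\<xi> i) (\<xi> i)) * ip ?J (w \<xi>) (w \<xi>)))" for \<xi>
  have wm: "(\<lambda>\<xi>. ip ?J (w \<xi>) (w \<xi>)) \<in> borel_measurable ?Q"
    unfolding w_def using J im by (intro measurable_ip measurable_mv_funpow measurable_Kmat) auto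
  have Gm: "(\<lambda>\<xi>. of_bool (Good d \<kappa> ?J \<xi>) :: real) \<in> borel_measurable ?Q"
    using sets_Good[OF J] by (intro borel_measurable_of_bool)
  have im': "(\<lambda>\<xi>. of_bool (real d / 2 \<le> ip {..<d} (\<xi> i) (\<xi> i)) :: real) \<in> borel_measurable ?Q"
  proof -
    have "(\<lambda>\<xi>. ip {..<d} (\<xi> i) (\<xi> i)) \<in> borel_measurable ?Q"
      using im by (auto intro!: measurable_ip measurable_iid_component)
    then show ?thesis by measurable
  qed
  have Fm: "F \<in> borel_measurable ?Q"
    unfolding F_def by (intro measurable_compose[OF _ measurable_ennreal] borel_measurable_times wm Gm im')
  have "(\<integral>\<^sup>+\<xi>. ennreal (of_bool (Good d \<kappa> V \<xi>) * ip ?J (w \<xi>) (w \<xi>)) \<partial>?Q) \<le> (\<integral>\<^sup>+\<xi>. F \<xi> \<partial>?Q)"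
    unfolding F_def using V(2) by (intro nn_integral_mono ennreal_leI) (auto simp: Good_def)
  also have "\<dots> = (\<integral>\<^sup>+\<xi>. \<integral>\<^sup>+x. F (\<xi>(i := x)) \<partial>?\<mu> \<partial>?Q)"
    using Fm im unfolding iid_gaussian_samples_def
    by (intro resample_nn_integral prob_space_std_gaussian) auto
  also have "\<dots> \<le> (\<integral>\<^sup>+\<xi>. ennreal (12 * (real d)\<^sup>2) * ennreal (of_bool (Good d \<kappa> ?J \<xi>) * tau d n ?J \<xi>)
      + ennreal (4 / (real d)\<^sup>2) * ennreal (of_bool (Good d \<kappa> ?J \<xi>) * tau d (Suc n) ?J \<xi>) \<partial>?Q)"
  proof (rule nn_integral_mono)
    fix \<xi>
    let ?A = "mv ?J (Kmat d \<xi>)"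
    have A: "sadj ?J ?A" by (rule sadj_mv[OF fin]) (rule Kmat_commute)
    define e where "e l = (?A ^^ n) (bvec l)" for l
    have Good_upd: "Good d \<kappa> ?J (\<xi>(i := x)) = Good d \<kappa> ?J \<xi>" for x
      unfolding Good_def by auto
    show "(\<integral>\<^sup>+x. F (\<xi>(i := x)) \<partial>?\<mu>) \<le> ennreal (12 * (real d)\<^sup>2) * ennreal (of_bool (Good d \<kappa> ?J \<xi>) * tau d n ?J \<xi>)
      + ennreal (4 / (real d)\<^sup>2) * ennreal (of_bool (Good d \<kappa> ?J \<xi>) * tau d (Suc n) ?J \<xi>)"
    proof (cases "Good d \<kappa> ?J \<xi>")
      case False
      then show ?thesis by (simp add: F_def Good_upd)
    next
      case True
      have pos: "ip {..<d} (\<xi> j) (\<xi> j) > 0" if "j \<in> ?J" for j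
      proof -
        have "real d / 2 \<le> ip {..<d} (\<xi> j) (\<xi> j)" using True that by (auto simp: Good_def)
        then show ?thesis using d by linarith
      qed
      \<comment> \<open>Self-adjointness moves the power from column i, which carries the new
        sample, to a basis vector.\<close>
      have w: "w (\<xi>(i := x)) l = (\<Sum>j\<in>?J. e l j * kern d x (\<xi> j))" if l: "l \<in> ?J" for x l
      proof -
        have "w (\<xi>(i := x)) l = (?A ^^ n) (\<lambda>j. kern d x (\<xi> j)) l"
          unfolding w_def by (rule mv_funpow_cong[OF _ _ l]) (auto simp: Kmat_def kern_commute)
        also have "\<dots> = ip ?J (\<lambda>j. kern d x (\<xi> j)) (e l)"
          using ip_funpow[OF A] ip_bvec[OF fin l] unfolding e_def by metis
        finally show ?thesis by (simp add: ip_def mult.commute)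
      qed
      have "F (\<xi>(i := x)) = (\<Sum>l\<in>?J. ennreal (of_bool (real d / 2 \<le> ip {..<d} x x) * (\<Sum>j\<in>?J. e l j * kern d x (\<xi> j))\<^sup>2))" for x
      proof -
        have "F (\<xi>(i := x)) = ennreal (of_bool (real d / 2 \<le> ip {..<d} x x) * ip ?J (w (\<xi>(i := x))) (w (\<xi>(i := x))))"
          by (simp add: F_def Good_upd True)
        also have "ip ?J (w (\<xi>(i := x))) (w (\<xi>(i := x))) = (\<Sum>l\<in>?J. (\<Sum>j\<in>?J. e l j * kern d x (\<xi> j))\<^sup>2)"
          unfolding ip_def by (intro sum.cong refl) (simp only: w power2_eq_square)
        also have "ennreal (of_bool (real d / 2 \<le> ip {..<d} x x) * (\<Sum>l\<in>?J. (\<Sum>j\<in>?J. e l j * kern d x (\<xi> j))\<^sup>2))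
            = (\<Sum>l\<in>?J. ennreal (of_bool (real d / 2 \<le> ip {..<d} x x) * (\<Sum>j\<in>?J. e l j * kern d x (\<xi> j))\<^sup>2))"
          by (subst sum_ennreal) (simp, simp only: sum_distrib_left[symmetric])
        finally show ?thesis .
      qed
      then have "(\<integral>\<^sup>+x. F (\<xi>(i := x)) \<partial>?\<mu>) =
          (\<Sum>l\<in>?J. \<integral>\<^sup>+x. ennreal (of_bool (real d / 2 \<le> ip {..<d} x x) * (\<Sum>j\<in>?J. e l j * kern d x (\<xi> j))\<^sup>2) \<partial>?\<mu>)"
      proof (simp only:, intro nn_integral_sum)
        fix l
        have k: "(\<lambda>x. kern d x (\<xi> j)) \<in> borel_measurable ?\<mu>" for j
          by (intro measurable_kern borel_measurable_const measurable_std_gaussian_component)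
        show "(\<lambda>x. ennreal (of_bool (real d / 2 \<le> ip {..<d} x x) * (\<Sum>j\<in>?J. e l j * kern d x (\<xi> j))\<^sup>2)) \<in> borel_measurable ?\<mu>"
          by (intro measurable_compose[OF _ measurable_ennreal] borel_measurable_times borel_measurable_power
              borel_measurable_sum borel_measurable_const k) measurable
      qed
      also have "\<dots> \<le> (\<Sum>l\<in>?J. ennreal (12 * (real d)\<^sup>2 * ip ?J (e l) (e l) + 4 / (real d)\<^sup>2 * ip ?J (?A (e l)) (?A (e l))))"
      proof (rule sum_mono)
        fix l
        have "(\<integral>\<^sup>+x. ennreal (of_bool (real d / 2 \<le> ip {..<d} x x) * (\<Sum>j\<in>?J. e l j * kern d x (\<xi> j))\<^sup>2) \<partial>?\<mu>)
            \<le> ennreal (8 * (((real d)\<^sup>2 - real d) * ip ?J (e l) (e l) + ip ?J (e l) (?A (e l))))"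
          by (rule kern_combination_second_moment[OF fin pos d])
        also have "\<dots> \<le> ennreal (12 * (real d)\<^sup>2 * ip ?J (e l) (e l) + 4 / (real d)\<^sup>2 * ip ?J (?A (e l)) (?A (e l)))"
        proof (rule ennreal_leI)
          \<comment> \<open>The weight d^2 is the scale expected of \<open>?A\<close>: the moment of
            order n keeps a factor of order d^2, and the one of order n + 1 gets the small factor 4
            / d^2.\<close>
          have "2 * ip ?J (e l) (?A (e l)) \<le> (real d)\<^sup>2 * ip ?J (e l) (e l) + ip ?J (?A (e l)) (?A (e l)) / (real d)\<^sup>2"
            using d by (intro ip_AMGM) simp
          moreover have "((real d)\<^sup>2 - real d) * ip ?J (e l) (e l) \<le> (real d)\<^sup>2 * ip ?J (e l) (e l)"
            by (intro mult_right_mono) auto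
          ultimately show "8 * (((real d)\<^sup>2 - real d) * ip ?J (e l) (e l) + ip ?J (e l) (?A (e l)))
              \<le> 12 * (real d)\<^sup>2 * ip ?J (e l) (e l) + 4 / (real d)\<^sup>2 * ip ?J (?A (e l)) (?A (e l))"
            by simp
        qed
        finally show "(\<integral>\<^sup>+x. ennreal (of_bool (real d / 2 \<le> ip {..<d} x x) * (\<Sum>j\<in>?J. e l j * kern d x (\<xi> j))\<^sup>2) \<partial>?\<mu>)
            \<le> ennreal (12 * (real d)\<^sup>2 * ip ?J (e l) (e l) + 4 / (real d)\<^sup>2 * ip ?J (?A (e l)) (?A (e l)))" .
      qed
      also have "\<dots> = ennreal (12 * (real d)\<^sup>2 * tau d n ?J \<xi> + 4 / (real d)\<^sup>2 * tau d (Suc n) ?J \<xi>)"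
        by (subst sum_ennreal) (auto simp: tau_def hs_def e_def sum.distrib sum_distrib_left)
      also have "\<dots> = ennreal (12 * (real d)\<^sup>2) * ennreal (of_bool (Good d \<kappa> ?J \<xi>) * tau d n ?J \<xi>)
          + ennreal (4 / (real d)\<^sup>2) * ennreal (of_bool (Good d \<kappa> ?J \<xi>) * tau d (Suc n) ?J \<xi>)"
        using True by (subst ennreal_lincomb) simp_all
      finally show ?thesis .
    qed
  qed
  also have "\<dots> = ennreal (12 * (real d)\<^sup>2) * Phi d m \<kappa> n ?J + ennreal (4 / (real d)\<^sup>2) * Phi d m \<kappa> (Suc n) ?J"
  proof -
    have "(\<lambda>\<xi>. ennreal (of_bool (Good d \<kappa> ?J \<xi>) * tau d k ?J \<xi>)) \<in> borel_measurable ?Q" for k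
      by (intro measurable_compose[OF _ measurable_ennreal] borel_measurable_times Gm measurable_tau[OF J])
    then show ?thesis unfolding Phi_def by (subst nn_integral_add) (auto simp: nn_integral_cmult)
  qed
  finally show ?thesis .
qed

text \<open>On the good event a column of \<open>Kmat\<close> has at most m entries of size at most
  \<kappa>, so s bounds its norm. \<open>hs_funpow_recursion\<close> then reduces the trace to
  vectors whose mean squares are those of \<open>Phi_row_bound\<close>.\<close>

lemma Phi_step:
  assumes d: "d \<ge> 1" and V: "V \<subseteq> {..<m}" and \<kappa>: "0 \<le> \<kappa>" and s: "0 < s" "real m * \<kappa>\<^sup>2 \<le> s\<^sup>2"
  shows "Phi d m \<kappa> (Suc n) V \<le> (\<Sum>i\<in>V. ennreal (3 * (2 * real n + 1)) *
    (ennreal (12 * (real d)\<^sup>2) * Phi d m \<kappa> n (V - {i}) + ennreal (4 / (real d)\<^sup>2) * Phi d m \<kappa> (Suc n) (V - {i})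
      + ennreal (s\<^sup>2 * (2 * real n * s) ^ (2 * n))))"
proof -
  let ?Q = "iid_gaussian_samples d m"
  interpret Q: prob_space ?Q by (rule prob_space_iid_gaussian_samples)
  have fin: "finite V" using V finite_subset by blast
  define w where "w i \<xi> = (mv (V - {i}) (Kmat d \<xi>) ^^ n) (\<lambda>l. Kmat d \<xi> l i)" for i \<xi>
  let ?c = "3 * (2 * real n + 1)" and ?b = "s\<^sup>2 * (2 * real n * s) ^ (2 * n)"
  let ?g = "\<lambda>i \<xi>. of_bool (Good d \<kappa> V \<xi>) * ip (V - {i}) (w i \<xi>) (w i \<xi>)"
  have b0: "0 \<le> ?b" using s by simp
  have gm: "(\<lambda>\<xi>. ennreal (?g i \<xi>)) \<in> borel_measurable ?Q" if "i \<in> V" for i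
  proof (intro measurable_compose[OF _ measurable_ennreal] borel_measurable_times)
    show "(\<lambda>\<xi>. of_bool (Good d \<kappa> V \<xi>) :: real) \<in> borel_measurable ?Q"
      using sets_Good[OF V] by (intro borel_measurable_of_bool)
    show "(\<lambda>\<xi>. ip (V - {i}) (w i \<xi>) (w i \<xi>)) \<in> borel_measurable ?Q"
      unfolding w_def using V that by (intro measurable_ip measurable_mv_funpow measurable_Kmat) auto
  qed
  have "Phi d m \<kappa> (Suc n) V \<le> (\<integral>\<^sup>+\<xi>. (\<Sum>i\<in>V. ennreal ?c * (ennreal (?g i \<xi>) + ennreal ?b)) \<partial>?Q)"
    unfolding Phi_def
  proof (rule nn_integral_mono)
    fix \<xi>
    have "of_bool (Good d \<kappa> V \<xi>) * tau d (Suc n) V \<xi> \<le> (\<Sum>i\<in>V. ?c * (?g i \<xi> + ?b))"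
    proof (cases "Good d \<kappa> V \<xi>")
      case False
      then show ?thesis using b0 by (auto intro!: sum_nonneg)
    next
      case True
      have "tau d (Suc n) V \<xi> \<le> (\<Sum>i\<in>V. ?c * (ip (V - {i}) (w i \<xi>) (w i \<xi>) + ?b))"
        unfolding tau_def w_def
      proof (rule hs_funpow_recursion[OF fin _ _ s(1)])
        fix i assume i: "i \<in> V"
        have "Kmat d \<xi> l i * Kmat d \<xi> l i \<le> \<kappa>\<^sup>2" if "l \<in> V - {i}" for l
        proof -
          have "\<bar>Kmat d \<xi> l i\<bar> \<le> \<kappa>" using True i that by (auto simp: Good_def Kmat_def)
          then have "\<bar>Kmat d \<xi> l i\<bar> * \<bar>Kmat d \<xi> l i\<bar> \<le> \<kappa> * \<kappa>" by (intro mult_mono) auto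
          then show ?thesis by (simp add: power2_eq_square)
        qed
        then have "ip (V - {i}) (\<lambda>l. Kmat d \<xi> l i) (\<lambda>l. Kmat d \<xi> l i) \<le> (\<Sum>l\<in>V - {i}. \<kappa>\<^sup>2)"
          unfolding ip_def by (rule sum_mono)
        also have "\<dots> \<le> real m * \<kappa>\<^sup>2"
        proof -
          have "card (V - {i}) \<le> card {..<m}" using V by (intro card_mono) auto
          then show ?thesis by (simp add: mult_right_mono)
        qed
        finally show "ip (V - {i}) (\<lambda>l. Kmat d \<xi> l i) (\<lambda>l. Kmat d \<xi> l i) \<le> s\<^sup>2" using s(2) by simp
      qed (auto simp: Kmat_commute Kmat_def)
      then show ?thesis using True by simp
    qed
    then have "ennreal (of_bool (Good d \<kappa> V \<xi>) * tau d (Suc n) V \<xi>) \<le> ennreal (\<Sum>i\<in>V. ?c * (?g i \<xi> + ?b))"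
      by (rule ennreal_leI)
    also have "\<dots> = (\<Sum>i\<in>V. ennreal (?c * (?g i \<xi> + ?b)))"
      using b0 by (intro sum_ennreal[symmetric]) simp
    also have "\<dots> = (\<Sum>i\<in>V. ennreal ?c * (ennreal (?g i \<xi>) + ennreal ?b))"
      using b0 by (intro sum.cong refl) (subst ennreal_plus[symmetric], simp, simp, subst ennreal_mult[symmetric], simp_all)
    finally show "ennreal (of_bool (Good d \<kappa> V \<xi>) * tau d (Suc n) V \<xi>) \<le> (\<Sum>i\<in>V. ennreal ?c * (ennreal (?g i \<xi>) + ennreal ?b))" .
  qed
  also have "\<dots> = (\<Sum>i\<in>V. ennreal ?c * ((\<integral>\<^sup>+\<xi>. ennreal (?g i \<xi>) \<partial>?Q) + ennreal ?b))"
  proof (subst nn_integral_sum)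
    show "(\<lambda>\<xi>. ennreal ?c * (ennreal (?g i \<xi>) + ennreal ?b)) \<in> borel_measurable ?Q" if "i \<in> V" for i
      by (rule borel_measurable_ennreal_affine(2)[OF gm[OF that]])
    show "(\<Sum>i\<in>V. \<integral>\<^sup>+\<xi>. ennreal ?c * (ennreal (?g i \<xi>) + ennreal ?b) \<partial>?Q) = (\<Sum>i\<in>V. ennreal ?c * ((\<integral>\<^sup>+\<xi>. ennreal (?g i \<xi>) \<partial>?Q) + ennreal ?b))"
    proof (intro sum.cong refl)
      fix i assume i: "i \<in> V"
      have "(\<integral>\<^sup>+\<xi>. ennreal (?g i \<xi>) + ennreal ?b \<partial>?Q) = (\<integral>\<^sup>+\<xi>. ennreal (?g i \<xi>) \<partial>?Q) + ennreal ?b"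
        by (subst nn_integral_add[OF gm[OF i]]) (auto simp: Q.emeasure_space_1)
      moreover have "(\<integral>\<^sup>+\<xi>. ennreal ?c * (ennreal (?g i \<xi>) + ennreal ?b) \<partial>?Q) = ennreal ?c * (\<integral>\<^sup>+\<xi>. ennreal (?g i \<xi>) + ennreal ?b \<partial>?Q)"
        by (rule nn_integral_cmult[OF borel_measurable_ennreal_affine(1)[OF gm[OF i]]])
      ultimately show "(\<integral>\<^sup>+\<xi>. ennreal ?c * (ennreal (?g i \<xi>) + ennreal ?b) \<partial>?Q) = ennreal ?c * ((\<integral>\<^sup>+\<xi>. ennreal (?g i \<xi>) \<partial>?Q) + ennreal ?b)"
        by simp
    qed
  qed
  also have "\<dots> \<le> (\<Sum>i\<in>V. ennreal ?c * (ennreal (12 * (real d)\<^sup>2) * Phi d m \<kappa> n (V - {i}) + ennreal (4 / (real d)\<^sup>2) * Phi d m \<kappa> (Suc n) (V - {i}) + ennreal ?b))"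
    unfolding w_def by (intro sum_mono mult_left_mono add_right_mono Phi_row_bound d V) auto
  finally show ?thesis .
qed

lemma Phi_zero: "V \<subseteq> {..<m} \<Longrightarrow> Phi d m \<kappa> 0 V \<le> ennreal (real m)"
proof -
  assume V: "V \<subseteq> {..<m}"
  interpret Q: prob_space "iid_gaussian_samples d m" by (rule prob_space_iid_gaussian_samples)
  have fin: "finite V" using V finite_subset by blast
  have "card V \<le> card {..<m}" using V by (intro card_mono) auto
  moreover have "tau d 0 V \<xi> = real (card V)" for \<xi>
  proof -
    have "bvec l l = 1" for l :: nat by (simp add: bvec_def)
    then show ?thesis using fin by (simp add: tau_def hs_def ip_bvec)
  qed
  ultimately have "of_bool (Good d \<kappa> V \<xi>) * tau d 0 V \<xi> \<le> real m" for \<xi> by simp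
  then have "Phi d m \<kappa> 0 V \<le> (\<integral>\<^sup>+\<xi>. ennreal (real m) \<partial>iid_gaussian_samples d m)"
    unfolding Phi_def by (intro nn_integral_mono ennreal_leI)
  then show ?thesis by (simp add: Q.emeasure_space_1)
qed

text \<open>Induction on n and, for fixed order, on the size of V, because a step refers to the same
  order over a smaller set. Measured in m R^(2n + 2), the three terms of the step contribute at most
  1 by \<open>R2\<close>, 2 by the bound on P m, which makes the coefficient of the repeated order
  at most 1 / 2, and 1 by \<open>R1\<close>; the sum reproduces the constant 4.\<close>

lemma Phi_bound:
  assumes d: "d \<ge> 1" and \<kappa>: "0 \<le> \<kappa>" and s: "0 < s" "real m * \<kappa>\<^sup>2 \<le> s\<^sup>2"
    and R1: "4 * real P * s \<le> R" and R2: "288 * real P * real m * (real d)\<^sup>2 \<le> R\<^sup>2" and P: "48 * real P * real m \<le> (real d)\<^sup>2"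
  shows "n \<le> P \<Longrightarrow> V \<subseteq> {..<m} \<Longrightarrow> Phi d m \<kappa> n V \<le> ennreal (4 * real m * R ^ (2 * n))"
proof (induction n arbitrary: V)
  case 0
  have "Phi d m \<kappa> 0 V \<le> ennreal (real m)" by (rule Phi_zero[OF 0(2)])
  also have "\<dots> \<le> ennreal (4 * real m * R ^ (2 * 0))" by (intro ennreal_leI) simp
  finally show ?case .
next
  case (Suc n)
  have nP: "n < P" "n \<le> P" "P \<ge> 1" using Suc.prems by auto
  have R0: "R \<ge> 0" using R1 s nP by (intro order_trans[OF _ R1]) auto
  let ?E = "real m * R ^ (2 * n) * R\<^sup>2"
  have E: "real m * R ^ (2 * Suc n) = ?E" by (simp add: power2_eq_square)
  have E0: "0 \<le> ?E" by simp
  have E4: "4 * real m * R ^ (2 * Suc n) = 4 * ?E" using E by (simp only: mult.assoc)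
  show ?case
    using Suc.prems(2)
  proof (induction "card V" arbitrary: V rule: less_induct)
    case less
    have fin: "finite V" using less.prems finite_subset by blast
    let ?c = "3 * (2 * real n + 1)" and ?b = "s\<^sup>2 * (2 * real n * s) ^ (2 * n)"
    let ?X = "?c * (12 * (real d)\<^sup>2 * (4 * real m * R ^ (2 * n)) + 4 / (real d)\<^sup>2 * (4 * ?E) + ?b)"
    have b0: "0 \<le> ?b" using s by simp
    have "real n + 1 \<le> real P" using nP(1) by simp
    then have c: "?c \<le> 6 * real P" by simp
    have "Phi d m \<kappa> (Suc n) V \<le> (\<Sum>i\<in>V. ennreal ?c * (ennreal (12 * (real d)\<^sup>2) * Phi d m \<kappa> n (V - {i}) + ennreal (4 / (real d)\<^sup>2) * Phi d m \<kappa> (Suc n) (V - {i}) + ennreal ?b))"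
      by (rule Phi_step[OF d less.prems \<kappa> s])
    also have "\<dots> \<le> (\<Sum>i\<in>V. ennreal ?X)"
    proof (rule sum_mono)
      fix i assume i: "i \<in> V"
      have "Phi d m \<kappa> n (V - {i}) \<le> ennreal (4 * real m * R ^ (2 * n))"
        using less.prems nP by (intro Suc.IH) auto
      moreover have "Phi d m \<kappa> (Suc n) (V - {i}) \<le> ennreal (4 * ?E)"
      proof -
        have "card (V - {i}) < card V" using fin i by (rule card_Diff1_less)
        then have "Phi d m \<kappa> (Suc n) (V - {i}) \<le> ennreal (4 * real m * R ^ (2 * Suc n))"
          using less.prems by (intro less.hyps) auto
        then show ?thesis by (simp only: E4)
      qed
      ultimately have "ennreal ?c * (ennreal (12 * (real d)\<^sup>2) * Phi d m \<kappa> n (V - {i}) + ennreal (4 / (real d)\<^sup>2) * Phi d m \<kappa> (Suc n) (V - {i}) + ennreal ?b)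
         \<le> ennreal ?c * (ennreal (12 * (real d)\<^sup>2) * ennreal (4 * real m * R ^ (2 * n)) + ennreal (4 / (real d)\<^sup>2) * ennreal (4 * ?E) + ennreal ?b)"
        by (intro mult_left_mono add_mono) auto
      also have "\<dots> = ennreal ?X"
      proof -
        have "ennreal (12 * (real d)\<^sup>2) * ennreal (4 * real m * R ^ (2 * n)) + ennreal (4 / (real d)\<^sup>2) * ennreal (4 * ?E) + ennreal ?b
            = ennreal (12 * (real d)\<^sup>2 * (4 * real m * R ^ (2 * n)) + 4 / (real d)\<^sup>2 * (4 * ?E)) + ennreal ?b"
          using R0 E0 by (subst ennreal_lincomb) simp_all
        also have "\<dots> = ennreal (12 * (real d)\<^sup>2 * (4 * real m * R ^ (2 * n)) + 4 / (real d)\<^sup>2 * (4 * ?E) + ?b)"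
          using R0 E0 b0 by (intro ennreal_plus[symmetric] add_nonneg_nonneg mult_nonneg_nonneg) simp_all
        finally show ?thesis
          using R0 E0 b0 by (simp only:) (intro ennreal_mult[symmetric] add_nonneg_nonneg mult_nonneg_nonneg; simp)
      qed
      finally show "ennreal ?c * (ennreal (12 * (real d)\<^sup>2) * Phi d m \<kappa> n (V - {i}) + ennreal (4 / (real d)\<^sup>2) * Phi d m \<kappa> (Suc n) (V - {i}) + ennreal ?b) \<le> ennreal ?X" .
    qed
    also have "\<dots> = ennreal (real (card V) * ?X)"
      using R0 b0 by (simp add: ennreal_of_nat_eq_real_of_nat ennreal_mult)
    also have "\<dots> \<le> ennreal (4 * real m * R ^ (2 * Suc n))"
    proof (rule ennreal_leI)
      have X0: "0 \<le> ?X" using R0 b0 by (intro mult_nonneg_nonneg add_nonneg_nonneg) auto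
      have "card V \<le> card {..<m}" using less.prems by (intro card_mono) auto
      then have "real (card V) * ?X \<le> real m * ?X" using X0 by (intro mult_right_mono) auto
      also have "real m * ?X = (?c * 12 * (real d)\<^sup>2 * real m) * (4 * (real m * R ^ (2 * n))) + (?c * real m * 4 / (real d)\<^sup>2) * (4 * ?E) + (?c * ?b) * real m"
        by (simp add: algebra_simps)
      also have "\<dots> \<le> (R\<^sup>2 / 4) * (4 * (real m * R ^ (2 * n))) + (1 / 2) * (4 * ?E) + (R\<^sup>2 * R ^ (2 * n)) * real m"
      proof (intro add_mono mult_right_mono)
        have "?c * 12 * (real d)\<^sup>2 * real m = ?c * (12 * (real d)\<^sup>2 * real m)" by simp
        also have "\<dots> \<le> (6 * real P) * (12 * (real d)\<^sup>2 * real m)" using c by (intro mult_right_mono) auto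
        also have "\<dots> \<le> R\<^sup>2 / 4" using R2 by (simp add: mult_ac)
        finally show "?c * 12 * (real d)\<^sup>2 * real m \<le> R\<^sup>2 / 4" .
        have "?c * (real m * 4) \<le> (6 * real P) * (real m * 4)" using c by (intro mult_right_mono) auto
        also have "\<dots> \<le> (real d)\<^sup>2 / 2" using P by (simp add: mult_ac)
        finally show "?c * real m * 4 / (real d)\<^sup>2 \<le> 1 / 2" using d by (simp add: field_simps)
        have "?c * ?b = (?c * s\<^sup>2) * (2 * real n * s) ^ (2 * n)" by simp
        also have "\<dots> \<le> R\<^sup>2 * R ^ (2 * n)"
        proof (intro mult_mono power_mono)
          have "6 * real P \<le> (4 * real P)\<^sup>2"
          proof -
            have "6 * real P * 1 \<le> 16 * real P * real P" using nP by (intro mult_mono) auto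
            then show ?thesis by (simp add: power2_eq_square)
          qed
          then have "?c * s\<^sup>2 \<le> (4 * real P)\<^sup>2 * s\<^sup>2" using c by (intro mult_right_mono) auto
          also have "\<dots> = (4 * real P * s)\<^sup>2" by (simp add: power_mult_distrib)
          also have "\<dots> \<le> R\<^sup>2" using R1 s by (intro power_mono) auto
          finally show "?c * s\<^sup>2 \<le> R\<^sup>2" .
          have "2 * real n * s \<le> 4 * real P * s" using nP s by (intro mult_right_mono) auto
          then show "2 * real n * s \<le> R" using R1 by linarith
        qed (use s in auto)
        finally show "?c * ?b \<le> R\<^sup>2 * R ^ (2 * n)" .
      qed (use R0 in auto)
      also have "\<dots> = 4 * ?E" by (simp add: algebra_simps)
      also have "\<dots> = 4 * real m * R ^ (2 * Suc n)" by (rule E4[symmetric])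
      finally show "real (card V) * ?X \<le> 4 * real m * R ^ (2 * Suc n)" .
    qed
    finally show ?case .
  qed
qed

text \<open>Markov's inequality at level \<Lambda>^(2P); the good event stays part of the event, as
  the moments are truncated to it.\<close>

lemma Kmat_norm_tail:
  assumes d: "d \<ge> 1" and \<kappa>: "0 \<le> \<kappa>" and s: "0 < s" "real m * \<kappa>\<^sup>2 \<le> s\<^sup>2"
    and R1: "4 * real P * s \<le> R" and R2: "288 * real P * real m * (real d)\<^sup>2 \<le> R\<^sup>2" and P: "48 * real P * real m \<le> (real d)\<^sup>2"
    and \<Lambda>: "0 < \<Lambda>"
  shows "emeasure (iid_gaussian_samples d m) {\<xi> \<in> space (iid_gaussian_samples d m). Good d \<kappa> {..<m} \<xi> \<and> \<Lambda> ^ (2 * P) < tau d P {..<m} \<xi>}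
    \<le> ennreal (4 * real m * (R / \<Lambda>) ^ (2 * P))"
proof -
  let ?Q = "iid_gaussian_samples d m"
  let ?f = "\<lambda>\<xi>. ennreal (1 / \<Lambda> ^ (2 * P)) * ennreal (of_bool (Good d \<kappa> {..<m} \<xi>) * tau d P {..<m} \<xi>)"
  have Gm: "{\<xi> \<in> space ?Q. Good d \<kappa> {..<m} \<xi>} \<in> sets ?Q" by (rule sets_Good) simp
  have tm: "tau d P {..<m} \<in> borel_measurable ?Q" by (rule measurable_tau) simp
  have "emeasure ?Q {\<xi> \<in> space ?Q. Good d \<kappa> {..<m} \<xi> \<and> \<Lambda> ^ (2 * P) < tau d P {..<m} \<xi>} \<le> (\<integral>\<^sup>+\<xi>. ?f \<xi> \<partial>?Q)"
  proof (rule emeasure_le_nn_integral)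
    show "{\<xi> \<in> space ?Q. Good d \<kappa> {..<m} \<xi> \<and> \<Lambda> ^ (2 * P) < tau d P {..<m} \<xi>} \<in> sets ?Q"
      by (intro sets.sets_Collect_conj Gm borel_measurable_less borel_measurable_const tm)
    fix \<xi> assume "\<xi> \<in> {\<xi> \<in> space ?Q. Good d \<kappa> {..<m} \<xi> \<and> \<Lambda> ^ (2 * P) < tau d P {..<m} \<xi>}"
    then have "1 \<le> 1 / \<Lambda> ^ (2 * P) * (of_bool (Good d \<kappa> {..<m} \<xi>) * tau d P {..<m} \<xi>)"
      using \<Lambda> by (simp add: field_simps)
    then have "ennreal 1 \<le> ennreal (1 / \<Lambda> ^ (2 * P) * (of_bool (Good d \<kappa> {..<m} \<xi>) * tau d P {..<m} \<xi>))"
      by (rule ennreal_leI)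
    then show "1 \<le> ?f \<xi>" using \<Lambda> by (simp add: ennreal_mult[symmetric])
  qed
  also have "\<dots> = ennreal (1 / \<Lambda> ^ (2 * P)) * Phi d m \<kappa> P {..<m}"
    unfolding Phi_def
  proof (rule nn_integral_cmult, intro measurable_compose[OF _ measurable_ennreal] borel_measurable_times tm)
    show "(\<lambda>\<xi>. of_bool (Good d \<kappa> {..<m} \<xi>) :: real) \<in> borel_measurable ?Q"
      using Gm by (intro borel_measurable_of_bool)
  qed
  also have "\<dots> \<le> ennreal (1 / \<Lambda> ^ (2 * P)) * ennreal (4 * real m * R ^ (2 * P))"
    by (intro mult_left_mono Phi_bound[OF d \<kappa> s R1 R2 P]) auto
  also have "\<dots> = ennreal (4 * real m * (R / \<Lambda>) ^ (2 * P))"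
    using \<Lambda> by (subst ennreal_mult''[symmetric]) (auto simp: power_divide power_mult zero_le_power2)
  finally show ?thesis .
qed

section \<open>Dual matrices\<close>

text \<open>Coercivity excludes a kernel, so the determinant is non-zero. The bound on the inverse
  is coercivity at \<open>mv {..<m} P y\<close>, combined with the weighted inequality of weight c,
  half of which is absorbed.\<close>

lemma coercive_inverse:
  fixes A :: "nat \<Rightarrow> nat \<Rightarrow> real"
  assumes sym: "\<And>i j. A i j = A j i" and c: "c > 0"
    and coer: "\<And>w. c * ip {..<m} w w \<le> ip {..<m} w (mv {..<m} A w)"
  obtains P where "\<And>i j. i < m \<Longrightarrow> j < m \<Longrightarrow> (\<Sum>k<m. A i k * P k j) = of_bool (i = j)"
    "\<And>i j. i < m \<Longrightarrow> j < m \<Longrightarrow> P i j = P j i"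
    "\<And>y. ip {..<m} (mv {..<m} P y) (mv {..<m} P y) \<le> ip {..<m} y y / c\<^sup>2"
proof -
  define M where "M = mat m m (\<lambda>(i, j). A i j)"
  have M: "M \<in> carrier_mat m m" by (simp add: M_def)
  have "det M \<noteq> 0"
  proof
    assume "det M = 0"
    then obtain v where v: "v \<in> carrier_vec m" "v \<noteq> 0\<^sub>v m" "M *\<^sub>v v = 0\<^sub>v m"
      using det_0_iff_vec_prod_zero_field[OF M] by auto
    define w where "w i = v $ i" for i
    have "mv {..<m} A w i = 0" if "i < m" for i
    proof -
      have "(M *\<^sub>v v) $ i = (\<Sum>k<m. A i k * v $ k)"
        using that v(1) by (auto simp: M_def scalar_prod_def lessThan_atLeast0)
      then show ?thesis using v(3) that by (simp add: mv_def w_def)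
    qed
    then have "ip {..<m} w (mv {..<m} A w) = 0" by (simp add: ip_def)
    then have "c * ip {..<m} w w \<le> 0" using coer[of w] by simp
    then have "ip {..<m} w w = 0" using c by (simp add: mult_le_0_iff order_antisym)
    then have "v $ i = 0" if "i < m" for i using ip_eq_0D[of "{..<m}" w i] that by (simp add: w_def)
    then have "v = 0\<^sub>v m" using v(1) by (intro eq_vecI) auto
    then show False using v(2) by simp
  qed
  then obtain B where B: "B \<in> carrier_mat m m" "M * B = 1\<^sub>m m"
    using det_non_zero_imp_unit[OF M, where b = "()"] by (auto simp: Units_def ring_mat_def)
  define P where "P i j = B $$ (i, j)" for i j
  have AP: "(\<Sum>k<m. A i k * P k j) = of_bool (i = j)" if "i < m" "j < m" for i j
  proof -
    have "(M * B) $$ (i, j) = (\<Sum>k<m. A i k * P k j)"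
      using that B(1) by (auto simp: M_def P_def scalar_prod_def lessThan_atLeast0)
    moreover have "(M * B) $$ (i, j) = of_bool (i = j)" using that by (simp add: B(2))
    ultimately show ?thesis by simp
  qed
  have APy: "mv {..<m} A (mv {..<m} P y) i = y i" if "i < m" for y i
  proof -
    have "mv {..<m} A (mv {..<m} P y) i = (\<Sum>k<m. \<Sum>j<m. A i k * P k j * y j)"
      by (simp add: mv_def sum_distrib_left mult.assoc)
    also have "\<dots> = (\<Sum>j<m. (\<Sum>k<m. A i k * P k j) * y j)"
      by (subst sum.swap) (simp add: sum_distrib_right)
    also have "\<dots> = (\<Sum>j<m. if j = i then y j else 0)"
      using that by (intro sum.cong refl) (auto simp: AP)
    finally show ?thesis using that by simp
  qed
  have A: "sadj {..<m} (mv {..<m} A)" by (rule sadj_mv) (auto intro: sym)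
  have Psym: "P i j = P j i" if ij: "i < m" "j < m" for i j
  proof -
    have col: "mv {..<m} P (bvec j) i = P i j" if "j < m" for i j
    proof -
      have "mv {..<m} P (bvec j) i = (\<Sum>k<m. if k = j then P i k else 0)"
        unfolding mv_def bvec_def by (intro sum.cong refl) auto
      then show ?thesis using that by simp
    qed
    have "P i j = ip {..<m} (bvec i) (mv {..<m} P (bvec j))"
      using ij col by (simp add: ip_commute[of _ "bvec i"] ip_bvec)
    also have "\<dots> = ip {..<m} (mv {..<m} A (mv {..<m} P (bvec i))) (mv {..<m} P (bvec j))"
      by (intro ip_cong) (simp_all add: APy)
    also have "\<dots> = ip {..<m} (mv {..<m} P (bvec i)) (mv {..<m} A (mv {..<m} P (bvec j)))"
      by (rule sadj_ip[OF A])
    also have "\<dots> = ip {..<m} (mv {..<m} P (bvec i)) (bvec j)"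
      by (intro ip_cong) (simp_all add: APy)
    also have "\<dots> = P j i" using ij col by (simp add: ip_bvec)
    finally show ?thesis .
  qed
  have bound: "ip {..<m} (mv {..<m} P y) (mv {..<m} P y) \<le> ip {..<m} y y / c\<^sup>2" for y
  proof -
    let ?w = "mv {..<m} P y"
    have "2 * (c * ip {..<m} ?w ?w) \<le> 2 * ip {..<m} ?w (mv {..<m} A ?w)" using coer[of ?w] by simp
    also have "ip {..<m} ?w (mv {..<m} A ?w) = ip {..<m} ?w y"
      by (intro ip_cong refl) (simp add: APy)
    also have "2 * ip {..<m} ?w y \<le> c * ip {..<m} ?w ?w + ip {..<m} y y / c" by (rule ip_AMGM[OF c])
    finally have "c * ip {..<m} ?w ?w \<le> ip {..<m} y y / c" by simp
    then show ?thesis using c by (simp add: field_simps power2_eq_square)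
  qed
  show ?thesis by (rule that[OF AP Psym bound])
qed

definition sph :: "nat \<Rightarrow> (nat \<Rightarrow> real) \<Rightarrow> nat \<Rightarrow> real" where
  "sph d x a = sqrt (real d) * (x a / nrm d x)"

lemma ip_sph:
  assumes "ip {..<d} x x > 0" "ip {..<d} y y > 0"
  shows "(ip {..<d} (sph d x) (sph d y))\<^sup>2 = real d + kern d x y"
    and "ip {..<d} (sph d x) (sph d x) = real d"
proof -
  have *: "ip {..<d} (sph d x) (sph d y) = real d * ip {..<d} x y / (nrm d x * nrm d y)" for x y
  proof -
    define c where "c = real d / (nrm d x * nrm d y)"
    have "ip {..<d} (sph d x) (sph d y) = (\<Sum>a<d. c * (x a * y a))"
      unfolding ip_def[of _ "sph d x"] by (intro sum.cong refl) (simp add: sph_def c_def)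
    also have "\<dots> = c * ip {..<d} x y" by (simp add: ip_def sum_distrib_left)
    finally show ?thesis by (simp add: c_def)
  qed
  show "(ip {..<d} (sph d x) (sph d y))\<^sup>2 = real d + kern d x y"
    unfolding * using assms by (simp add: kern_def power_mult_distrib power_divide)
  show "ip {..<d} (sph d x) (sph d x) = real d" unfolding * using assms by simp
qed

text \<open>The sum of the u_j u_j^T is m I plus the traceless matrix \<open>W\<close> with all
  weights 1. The Frobenius norm of \<open>W\<close> bounds its operator norm, and its square is the
  sum of all kernels, at most 2 m d^2 by the bound on \<open>Kmat\<close>. As m is at most d^2, m
  itself is at most sqrt m d.\<close>

lemma sph_frame_bound:
  assumes d: "d \<ge> 1" and pos: "\<And>j. j < m \<Longrightarrow> ip {..<d} (\<xi> j) (\<xi> j) > 0" and m: "real m \<le> (real d)\<^sup>2"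
    and K: "\<And>w. ip {..<m} (mv {..<m} (Kmat d \<xi>) w) (mv {..<m} (Kmat d \<xi>) w) \<le> ((real d)\<^sup>2 / 8)\<^sup>2 * ip {..<m} w w"
  shows "(\<Sum>j<m. (ip {..<d} (sph d (\<xi> j)) v)\<^sup>2) \<le> 3 * sqrt (real m) * real d * ip {..<d} v v"
proof -
  define W where "W a b = (\<Sum>j<m. 1 * (real d * \<xi> j a * \<xi> j b / ip {..<d} (\<xi> j) (\<xi> j) - of_bool (a = b)))" for a b
  have frob: "(\<Sum>a<d. \<Sum>b<d. (W a b)\<^sup>2) \<le> 2 * real m * (real d)\<^sup>2"
  proof -
    have "(\<Sum>a<d. \<Sum>b<d. (W a b)\<^sup>2) = (\<Sum>j\<in>{..<m}. \<Sum>l\<in>{..<m}. 1 * 1 * kern d (\<xi> j) (\<xi> l))"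
      unfolding W_def using pos by (intro kern_combination_frobenius(1)) auto
    also have "\<dots> = ((real d)\<^sup>2 - real d) * ip {..<m} (\<lambda>_. 1) (\<lambda>_. 1) + ip {..<m} (\<lambda>_. 1) (mv {..<m} (Kmat d \<xi>) (\<lambda>_. 1))"
      using pos by (intro kern_gram) auto
    also have "\<dots> \<le> (real d)\<^sup>2 * real m + (real d)\<^sup>2 * real m"
    proof (rule add_mono)
      show "((real d)\<^sup>2 - real d) * ip {..<m} (\<lambda>_. 1) (\<lambda>_. 1) \<le> (real d)\<^sup>2 * real m"
        by (simp add: ip_def mult_right_mono)
      let ?u = "\<lambda>_::nat. 1 :: real"
      have "(ip {..<m} ?u (mv {..<m} (Kmat d \<xi>) ?u))\<^sup>2 \<le> ip {..<m} ?u ?u * (((real d)\<^sup>2 / 8)\<^sup>2 * ip {..<m} ?u ?u)"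
        by (rule order_trans[OF ip_Cauchy mult_left_mono[OF K ip_nonneg]])
      also have "\<dots> = ((real d)\<^sup>2 / 8 * real m)\<^sup>2" by (simp add: ip_def power2_eq_square)
      finally have "ip {..<m} ?u (mv {..<m} (Kmat d \<xi>) ?u) \<le> (real d)\<^sup>2 / 8 * real m"
        by (rule power2_le_imp_le) simp
      also have "\<dots> \<le> (real d)\<^sup>2 * real m" by (intro mult_right_mono) auto
      finally show "ip {..<m} ?u (mv {..<m} (Kmat d \<xi>) ?u) \<le> (real d)\<^sup>2 * real m" .
    qed
    finally show ?thesis by simp
  qed
  have key: "(\<Sum>j<m. (ip {..<d} (sph d (\<xi> j)) v)\<^sup>2) = real m * ip {..<d} v v + (\<Sum>a<d. \<Sum>b<d. W a b * v a * v b)"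
  proof -
    have one: "(ip {..<d} (sph d (\<xi> j)) v)\<^sup>2 = ip {..<d} v v +
        (\<Sum>a<d. \<Sum>b<d. (real d * \<xi> j a * \<xi> j b / ip {..<d} (\<xi> j) (\<xi> j) - of_bool (a = b)) * v a * v b)" if j: "j < m" for j
    proof -
      have uu: "sph d (\<xi> j) a * sph d (\<xi> j) b = real d * \<xi> j a * \<xi> j b / ip {..<d} (\<xi> j) (\<xi> j)" for a b
      proof -
        have "sph d (\<xi> j) a * sph d (\<xi> j) b = (sqrt (real d) * sqrt (real d)) * (\<xi> j a * \<xi> j b) / (nrm d (\<xi> j) * nrm d (\<xi> j))"
          by (simp add: sph_def)
        then show ?thesis using pos[OF j] by (simp add: mult.assoc)
      qed
      have "(ip {..<d} (sph d (\<xi> j)) v)\<^sup>2 = (\<Sum>a<d. \<Sum>b<d. (sph d (\<xi> j) a * sph d (\<xi> j) b) * v a * v b)"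
        unfolding ip_def power2_eq_square sum_product by (intro sum.cong refl) (simp add: mult_ac)
      also have "\<dots> = (\<Sum>a<d. \<Sum>b<d. (if b = a then v a * v b else 0) +
          (real d * \<xi> j a * \<xi> j b / ip {..<d} (\<xi> j) (\<xi> j) - of_bool (a = b)) * v a * v b)"
        unfolding uu by (intro sum.cong refl) (auto simp: algebra_simps)
      finally show ?thesis by (simp add: sum.distrib ip_def)
    qed
    have "(\<Sum>a<d. \<Sum>b<d. W a b * v a * v b) = (\<Sum>a<d. \<Sum>b<d. \<Sum>j<m. (real d * \<xi> j a * \<xi> j b / ip {..<d} (\<xi> j) (\<xi> j) - of_bool (a = b)) * v a * v b)"
      by (simp add: W_def sum_distrib_right)
    also have "\<dots> = (\<Sum>a<d. \<Sum>j<m. \<Sum>b<d. (real d * \<xi> j a * \<xi> j b / ip {..<d} (\<xi> j) (\<xi> j) - of_bool (a = b)) * v a * v b)"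
      by (intro sum.cong refl sum.swap)
    also have "\<dots> = (\<Sum>j<m. \<Sum>a<d. \<Sum>b<d. (real d * \<xi> j a * \<xi> j b / ip {..<d} (\<xi> j) (\<xi> j) - of_bool (a = b)) * v a * v b)"
      by (rule sum.swap)
    finally show ?thesis by (simp add: one sum.distrib)
  qed
  have quad: "(\<Sum>a<d. \<Sum>b<d. W a b * v a * v b) \<le> sqrt (2 * real m) * real d * ip {..<d} v v"
  proof -
    have "(\<Sum>a<d. \<Sum>b<d. W a b * v a * v b)\<^sup>2 = (\<Sum>p\<in>{..<d} \<times> {..<d}. W (fst p) (snd p) * (v (fst p) * v (snd p)))\<^sup>2"
      by (simp add: sum.cartesian_product case_prod_beta' mult.assoc)
    also have "\<dots> \<le> (\<Sum>p\<in>{..<d} \<times> {..<d}. (W (fst p) (snd p))\<^sup>2) * (\<Sum>p\<in>{..<d} \<times> {..<d}. (v (fst p) * v (snd p))\<^sup>2)"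
      by (rule Cauchy_Schwarz_ineq_sum)
    also have "(\<Sum>p\<in>{..<d} \<times> {..<d}. (W (fst p) (snd p))\<^sup>2) = (\<Sum>a<d. \<Sum>b<d. (W a b)\<^sup>2)"
      by (simp add: sum.cartesian_product case_prod_beta')
    also have "(\<Sum>p\<in>{..<d} \<times> {..<d}. (v (fst p) * v (snd p))\<^sup>2) = (ip {..<d} v v)\<^sup>2"
    proof -
      have "(ip {..<d} v v)\<^sup>2 = (\<Sum>a<d. \<Sum>b<d. (v a * v b)\<^sup>2)"
        unfolding ip_def power2_eq_square sum_product by (intro sum.cong refl) (simp add: mult_ac)
      then show ?thesis by (simp add: sum.cartesian_product case_prod_beta')
    qed
    also have "(\<Sum>a<d. \<Sum>b<d. (W a b)\<^sup>2) * (ip {..<d} v v)\<^sup>2 \<le> (2 * real m * (real d)\<^sup>2) * (ip {..<d} v v)\<^sup>2"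
      by (intro mult_right_mono frob) simp
    also have "\<dots> = (sqrt (2 * real m) * real d * ip {..<d} v v)\<^sup>2" by (simp add: power_mult_distrib)
    finally show ?thesis by (rule power2_le_imp_le) (simp add: mult_nonneg_nonneg)
  qed
  have "real m = sqrt (real m) * sqrt (real m)" by simp
  also have "\<dots> \<le> sqrt (real m) * real d" using m by (intro mult_left_mono real_le_lsqrt) auto
  finally have m1: "real m \<le> sqrt (real m) * real d" .
  have "sqrt (2 * real m) \<le> 2 * sqrt (real m)"
    by (rule real_le_lsqrt) (auto simp: power_mult_distrib)
  then have "sqrt (2 * real m) * real d \<le> 2 * sqrt (real m) * real d" by (intro mult_right_mono) auto
  then have "real m + sqrt (2 * real m) * real d \<le> 3 * sqrt (real m) * real d" using m1 by linarith
  then have "(real m + sqrt (2 * real m) * real d) * ip {..<d} v v \<le> 3 * sqrt (real m) * real d * ip {..<d} v v"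
    by (intro mult_right_mono) auto
  then show ?thesis using key quad by (simp add: distrib_right)
qed

lemma dual_matrices:
  assumes d: "d \<ge> 2" and pos: "\<And>j. j < m \<Longrightarrow> ip {..<d} (\<xi> j) (\<xi> j) > 0" and m: "real m \<le> (real d)\<^sup>2"
    and K: "\<And>w. ip {..<m} (mv {..<m} (Kmat d \<xi>) w) (mv {..<m} (Kmat d \<xi>) w) \<le> ((real d)\<^sup>2 / 8)\<^sup>2 * ip {..<m} w w"
  obtains D :: "nat \<Rightarrow> nat \<Rightarrow> nat \<Rightarrow> real"
  where "\<And>j a b. D j a b = D j b a"
    "\<And>j l. j < m \<Longrightarrow> l < m \<Longrightarrow> ip {..<d} (sph d (\<xi> l)) (mv {..<d} (D j) (sph d (\<xi> l))) = of_bool (j = l)"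
    "\<And>v. (\<Sum>j<m. ip {..<d} (mv {..<d} (D j) v) (mv {..<d} (D j) v)) \<le> 48 * sqrt (real m) / (real d)\<^sup>2 * ip {..<d} v v"
proof -
  let ?u = "\<lambda>j. sph d (\<xi> j)"
  define A where "A i j = (ip {..<d} (?u i) (?u j))\<^sup>2" for i j
  have Asym: "A i j = A j i" for i j by (simp add: A_def ip_commute)
  have coer: "(real d)\<^sup>2 / 4 * ip {..<m} w w \<le> ip {..<m} w (mv {..<m} A w)" for w
  proof -
    have "ip {..<m} w (mv {..<m} A w) = (\<Sum>i<m. \<Sum>j<m. real d * (w i * w j) + w i * w j * kern d (\<xi> i) (\<xi> j))"
      unfolding ip_def mv_def sum_distrib_left
      by (intro sum.cong refl) (simp add: A_def ip_sph(1) pos algebra_simps)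
    also have "\<dots> = real d * (\<Sum>i<m. w i)\<^sup>2 + (\<Sum>i<m. \<Sum>j<m. w i * w j * kern d (\<xi> i) (\<xi> j))"
    proof -
      have "(\<Sum>i<m. w i)\<^sup>2 = (\<Sum>i<m. \<Sum>j<m. w i * w j)" by (simp add: power2_eq_square sum_product)
      then show ?thesis by (simp only: sum.distrib sum_distrib_left)
    qed
    also have "(\<Sum>i<m. \<Sum>j<m. w i * w j * kern d (\<xi> i) (\<xi> j)) = ((real d)\<^sup>2 - real d) * ip {..<m} w w + ip {..<m} w (mv {..<m} (Kmat d \<xi>) w)"
      by (rule kern_gram) (auto simp: pos)
    finally have e: "ip {..<m} w (mv {..<m} A w) = real d * (\<Sum>i<m. w i)\<^sup>2 + ((real d)\<^sup>2 - real d) * ip {..<m} w w + ip {..<m} w (mv {..<m} (Kmat d \<xi>) w)"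
      by simp
    have "(ip {..<m} w (mv {..<m} (Kmat d \<xi>) w))\<^sup>2 \<le> ip {..<m} w w * (((real d)\<^sup>2 / 8)\<^sup>2 * ip {..<m} w w)"
      by (rule order_trans[OF ip_Cauchy mult_left_mono[OF K ip_nonneg]])
    also have "\<dots> = ((real d)\<^sup>2 / 8 * ip {..<m} w w)\<^sup>2" by (simp add: power2_eq_square)
    finally have "\<bar>ip {..<m} w (mv {..<m} (Kmat d \<xi>) w)\<bar> \<le> (real d)\<^sup>2 / 8 * ip {..<m} w w"
      by (intro power2_le_imp_le[of "\<bar>_\<bar>"]) (auto simp: mult_nonneg_nonneg)
    then have 1: "- ((real d)\<^sup>2 / 8 * ip {..<m} w w) \<le> ip {..<m} w (mv {..<m} (Kmat d \<xi>) w)" by linarith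
    have "2 * real d \<le> real d * real d" using d by (intro mult_right_mono) auto
    then have "(real d)\<^sup>2 / 2 \<le> (real d)\<^sup>2 - real d" by (simp add: power2_eq_square)
    then have 2: "(real d)\<^sup>2 / 2 * ip {..<m} w w \<le> ((real d)\<^sup>2 - real d) * ip {..<m} w w" by (intro mult_right_mono) auto
    have 3: "0 \<le> real d * (\<Sum>i<m. w i)\<^sup>2" by simp
    have 4: "0 \<le> (real d)\<^sup>2 * ip {..<m} w w" by (simp add: mult_nonneg_nonneg)
    show ?thesis unfolding e using 1 2 3 4 by linarith
  qed
  have c: "(real d)\<^sup>2 / 4 > 0" using d by simp
  obtain P where AP: "\<And>i j. i < m \<Longrightarrow> j < m \<Longrightarrow> (\<Sum>k<m. A i k * P k j) = of_bool (i = j)"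
    and Psym: "\<And>i j. i < m \<Longrightarrow> j < m \<Longrightarrow> P i j = P j i"
    and Pb: "\<And>y. ip {..<m} (mv {..<m} P y) (mv {..<m} P y) \<le> ip {..<m} y y / ((real d)\<^sup>2 / 4)\<^sup>2"
    using coercive_inverse[OF Asym c coer] by blast
  define D where "D j a b = (\<Sum>i<m. P i j * (?u i a * ?u i b))" for j a b
  have Dv: "mv {..<d} (D j) v a = (\<Sum>i<m. P i j * (ip {..<d} (?u i) v * ?u i a))" for j v a
  proof -
    have "mv {..<d} (D j) v a = (\<Sum>b<d. \<Sum>i<m. P i j * (?u i b * v b * ?u i a))"
      by (simp add: mv_def D_def sum_distrib_left mult_ac)
    also have "\<dots> = (\<Sum>i<m. \<Sum>b<d. P i j * (?u i b * v b * ?u i a))" by (rule sum.swap)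
    finally show ?thesis by (simp add: ip_def sum_distrib_left sum_distrib_right)
  qed
  show ?thesis
  proof (rule that)
    show "D j a b = D j b a" for j a b by (simp add: D_def mult.commute)
    show "ip {..<d} (?u l) (mv {..<d} (D j) (?u l)) = of_bool (j = l)" if "j < m" "l < m" for j l
    proof -
      have "ip {..<d} (?u l) (mv {..<d} (D j) (?u l)) = ip {..<d} (?u l) (\<lambda>a. \<Sum>i<m. (P i j * ip {..<d} (?u i) (?u l)) * ?u i a)"
        by (intro ip_cong refl) (simp add: Dv mult.assoc)
      also have "\<dots> = (\<Sum>i<m. A l i * P i j)"
        unfolding ip_sum_right A_def power2_eq_square
        by (intro sum.cong refl) (simp add: ip_commute[of _ "?u l"] mult_ac)
      finally show ?thesis using AP[OF that(2,1)] by auto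
    qed
    show "(\<Sum>j<m. ip {..<d} (mv {..<d} (D j) v) (mv {..<d} (D j) v)) \<le> 48 * sqrt (real m) / (real d)\<^sup>2 * ip {..<d} v v" for v
    proof -
      \<comment> \<open>Exchanging the sums over j and over coordinates turns the left side into
        squared norms of \<open>mv {..<m} P (y a)\<close>, to which the bound on the inverse applies
        for each coordinate a. The constant 48 is 16 from that bound times 3 from the frame
        bound.\<close>
      define y where "y a i = ip {..<d} (?u i) v * ?u i a" for a i
      have "(\<Sum>j<m. ip {..<d} (mv {..<d} (D j) v) (mv {..<d} (D j) v)) = (\<Sum>a<d. ip {..<m} (mv {..<m} P (y a)) (mv {..<m} P (y a)))"
      proof -
        have "mv {..<d} (D j) v a = mv {..<m} P (y a) j" if "j < m" for j a
          unfolding Dv unfolding mv_def y_def using that by (intro sum.cong refl) (simp add: Psym)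
        then show ?thesis unfolding ip_def by (subst sum.swap) simp
      qed
      also have "\<dots> \<le> (\<Sum>a<d. ip {..<m} (y a) (y a) / ((real d)\<^sup>2 / 4)\<^sup>2)" by (intro sum_mono Pb)
      also have "\<dots> = (\<Sum>i<m. (ip {..<d} (?u i) v)\<^sup>2 * ip {..<d} (?u i) (?u i)) / ((real d)\<^sup>2 / 4)\<^sup>2"
        unfolding sum_divide_distrib[symmetric] ip_def[of "{..<m}"]
        by (subst sum.swap) (simp add: y_def ip_def[of _ "?u _" "?u _"] sum_distrib_left power2_eq_square mult_ac)
      also have "\<dots> = (\<Sum>i<m. (ip {..<d} (?u i) v)\<^sup>2) * (16 / (real d)^3)"
      proof -
        have "(\<Sum>i<m. (ip {..<d} (?u i) v)\<^sup>2 * ip {..<d} (?u i) (?u i)) = (\<Sum>i<m. (ip {..<d} (?u i) v)\<^sup>2) * real d"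
          unfolding sum_distrib_right by (intro sum.cong refl) (simp add: ip_sph(2)[OF pos pos])
        then show ?thesis using d by (simp add: power2_eq_square power3_eq_cube field_simps)
      qed
      also have "\<dots> \<le> (3 * sqrt (real m) * real d * ip {..<d} v v) * (16 / (real d)^3)"
        using d by (intro mult_right_mono sph_frame_bound pos m K) auto
      also have "\<dots> = 48 * sqrt (real m) / (real d)\<^sup>2 * ip {..<d} v v"
        using d by (simp add: power2_eq_square power3_eq_cube field_simps)
      finally show ?thesis .
    qed
  qed
qed

section \<open>Existence of the ellipsoid for a given set of directions\<close>

text \<open>The existence of an ellipsoid with the matrix as a plain function, so that
  \<open>ip\<close> and \<open>mv\<close> apply; \<open>ellipsoid_iff_fits\<close> is the
  translation.\<close>

definition fits :: "nat \<Rightarrow> nat \<Rightarrow> (nat \<Rightarrow> nat \<Rightarrow> real) \<Rightarrow> bool" where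
  "fits d m \<xi> \<longleftrightarrow> (\<exists>N. (\<forall>a b. N a b = N b a) \<and>
     (\<forall>v. (\<exists>a<d. v a \<noteq> 0) \<longrightarrow> 0 < ip {..<d} v (mv {..<d} N v)) \<and>
     (\<forall>j<m. ip {..<d} (\<xi> j) (mv {..<d} N (\<xi> j)) = 1))"

text \<open>The quantity dictated by the radius is d / |y|^2. Clamping makes it bounded for every y,
  so that it can be centered by its exact mean and used in the Khintchine bound; with high
  probability the clamp is inactive.\<close>

definition clamp_dev :: "nat \<Rightarrow> real \<Rightarrow> (nat \<Rightarrow> real) \<Rightarrow> real" where
  "clamp_dev d \<delta> y = max (1 - \<delta>) (min (1 + \<delta>) (real d / ip {..<d} y y))"

lemma clamp_dev_bounds: "0 \<le> \<delta> \<Longrightarrow> 1 - \<delta> \<le> clamp_dev d \<delta> y" "0 \<le> \<delta> \<Longrightarrow> clamp_dev d \<delta> y \<le> 1 + \<delta>"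
  by (auto simp: clamp_dev_def)

text \<open>A relative error of \<delta> / 2 in |y|^2 becomes a relative error of at most \<delta>
  in the reciprocal when \<delta> is at most 1 / 2, so the clamp is inactive.\<close>

lemma clamp_dev_eq:
  assumes d: "d \<ge> 1" and \<delta>: "0 < \<delta>" "\<delta> \<le> 1 / 2" and y: "\<bar>ip {..<d} y y - real d\<bar> \<le> real d * \<delta> / 2"
  shows "ip {..<d} y y > 0" "clamp_dev d \<delta> y * ip {..<d} y y = real d"
proof -
  define r where "r = ip {..<d} y y"
  have d0: "real d > 0" using d by simp
  have r1: "real d * (1 - \<delta> / 2) \<le> r" "r \<le> real d * (1 + \<delta> / 2)"
  proof -
    have "r - real d \<le> real d * \<delta> / 2" "- (r - real d) \<le> real d * \<delta> / 2"
      using abs_le_D1[OF y] abs_le_D2[OF y] by (simp_all add: r_def)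
    then show "real d * (1 - \<delta> / 2) \<le> r" "r \<le> real d * (1 + \<delta> / 2)" by (simp_all add: algebra_simps)
  qed
  have "0 < real d * (1 - \<delta> / 2)" using d0 \<delta> by simp
  then have r0: "r > 0" using r1 by linarith
  have "(1 - \<delta>) * r \<le> (1 - \<delta>) * (real d * (1 + \<delta> / 2))" using r1 \<delta> by (intro mult_left_mono) auto
  also have "\<dots> = real d * ((1 - \<delta>) * (1 + \<delta> / 2))" by simp
  also have "(1 - \<delta>) * (1 + \<delta> / 2) \<le> 1"
  proof -
    have "2 * ((1 - \<delta>) * (1 + \<delta> / 2)) = 2 - \<delta> - \<delta> * \<delta>" by (simp add: field_simps)
    moreover have "0 \<le> \<delta> * \<delta>" by simp
    ultimately show ?thesis using \<delta> by linarith
  qed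
  finally have low: "(1 - \<delta>) * r \<le> real d" using d0 by (simp add: mult_left_mono)
  have "1 \<le> (1 + \<delta>) * (1 - \<delta> / 2)"
  proof -
    have "2 * ((1 + \<delta>) * (1 - \<delta> / 2)) = 2 + \<delta> * (1 - \<delta>)" by (simp add: algebra_simps)
    moreover have "0 \<le> \<delta> * (1 - \<delta>)" using \<delta> by simp
    ultimately show ?thesis by linarith
  qed
  then have "real d * 1 \<le> real d * ((1 + \<delta>) * (1 - \<delta> / 2))" using d0 by (intro mult_left_mono) auto
  also have "\<dots> = (1 + \<delta>) * (real d * (1 - \<delta> / 2))" by simp
  also have "\<dots> \<le> (1 + \<delta>) * r" using r1 \<delta> by (intro mult_left_mono) auto
  finally have high: "real d \<le> (1 + \<delta>) * r" by simp
  show "ip {..<d} y y > 0" using r0 by (simp add: r_def)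
  have "1 - \<delta> \<le> real d / r" "real d / r \<le> 1 + \<delta>" using low high r0 by (simp_all add: field_simps)
  then have "clamp_dev d \<delta> y = real d / r" unfolding clamp_dev_def r_def by simp
  then show "clamp_dev d \<delta> y * ip {..<d} y y = real d" using r0 by (simp add: r_def)
qed

lemma measurable_clamp_dev: "clamp_dev d \<delta> \<in> borel_measurable (std_gaussian d)"
  unfolding clamp_dev_def[abs_def]
  by (intro borel_measurable_max borel_measurable_min borel_measurable_const borel_measurable_divide measurable_std_gaussian_ip(2))

text \<open>For \<open>N\<close> equal to s / d times I + X, duality gives direction u_l the value
  \<gamma>_l: the identity contributes d, and X contributes d (\<gamma>_l / s - 1). The squared
  radius factor |\<zeta>_l|^2 / d turns this into 1, and the norm bound 1 / 2 on X keeps I + X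
  positive.\<close>

lemma fits_from_duals:
  assumes d: "d \<ge> 1" and pos: "\<And>j. j < m \<Longrightarrow> ip {..<d} (\<xi> j) (\<xi> j) > 0"
    and Dsym: "\<And>j a b. D j a b = D j b a"
    and dual: "\<And>j l. j < m \<Longrightarrow> l < m \<Longrightarrow> ip {..<d} (sph d (\<xi> l)) (mv {..<d} (D j) (sph d (\<xi> l))) = of_bool (j = l)"
    and s: "s > 0"
    and \<zeta>: "\<And>j. j < m \<Longrightarrow> ip {..<d} (\<zeta> j) (\<zeta> j) > 0" "\<And>j. j < m \<Longrightarrow> \<gamma> j * ip {..<d} (\<zeta> j) (\<zeta> j) = real d"
    and norm: "\<And>v. ip {..<d} (mv {..<d} (\<lambda>a b. \<Sum>j<m. (real d * (\<gamma> j / s - 1)) * D j a b) v)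
        (mv {..<d} (\<lambda>a b. \<Sum>j<m. (real d * (\<gamma> j / s - 1)) * D j a b) v) \<le> (1 / 2)\<^sup>2 * ip {..<d} v v"
  shows "fits d m (rescale_all d m \<zeta> \<xi>)"
proof -
  let ?I = "{..<d}"
  define X where "X a b = (\<Sum>j<m. (real d * (\<gamma> j / s - 1)) * D j a b)" for a b
  define N where "N a b = s / real d * (of_bool (a = b) + X a b)" for a b
  have d0: "real d > 0" using d by simp
  have quad: "ip ?I v (mv ?I N v) = s / real d * (ip ?I v v + ip ?I v (mv ?I X v))" for v
  proof -
    have "mv ?I N v a = s / real d * (v a + mv ?I X v a)" if "a < d" for a
    proof -
      have "mv ?I N v a = s / real d * (\<Sum>b<d. (if b = a then v b else 0) + X a b * v b)"
        unfolding mv_def sum_distrib_left by (intro sum.cong refl) (auto simp: N_def algebra_simps)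
      then show ?thesis using that by (simp add: sum.distrib mv_def)
    qed
    then have "ip ?I v (mv ?I N v) = ip ?I v (\<lambda>a. s / real d * (v a + mv ?I X v a))" by (intro ip_cong) auto
    also have "\<dots> = s / real d * (ip ?I v v + ip ?I v (mv ?I X v))"
      unfolding ip_def sum.distrib[symmetric] sum_distrib_left by (intro sum.cong refl) (simp add: algebra_simps)
    finally show ?thesis .
  qed
  have Xlow: "- (1 / 2 * ip ?I v v) \<le> ip ?I v (mv ?I X v)" for v
  proof -
    have "(ip ?I v (mv ?I X v))\<^sup>2 \<le> ip ?I v v * ((1 / 2)\<^sup>2 * ip ?I v v)"
      using norm[of v] by (intro order_trans[OF ip_Cauchy mult_left_mono]) (simp_all add: X_def[abs_def])
    also have "\<dots> = (1 / 2 * ip ?I v v)\<^sup>2" by (simp add: power2_eq_square)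
    finally have "\<bar>ip ?I v (mv ?I X v)\<bar> \<le> 1 / 2 * ip ?I v v"
      by (intro power2_le_imp_le[of "\<bar>_\<bar>"]) auto
    then show ?thesis by linarith
  qed
  show ?thesis
    unfolding fits_def
  proof (intro exI[of _ N] conjI allI impI)
    show "N a b = N b a" for a b
      unfolding N_def X_def by (auto simp: Dsym[of _ a b])
    show "0 < ip ?I v (mv ?I N v)" if v: "\<exists>a<d. v a \<noteq> 0" for v
    proof -
      have "ip ?I v v \<noteq> 0" using v ip_eq_0D[of ?I v] by auto
      then have "0 < ip ?I v v" by (simp add: order_less_le)
      then have "0 < ip ?I v v + ip ?I v (mv ?I X v)" using Xlow[of v] by linarith
      then show ?thesis unfolding quad using s d0 by simp
    qed
    fix l assume l: "l < m"
    let ?u = "sph d (\<xi> l)" and ?r = "nrm d (\<zeta> l)"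
    define t where "t = ?r / sqrt (real d)"
    have t2: "t\<^sup>2 = ip ?I (\<zeta> l) (\<zeta> l) / real d" by (simp add: t_def power_divide)
    let ?z = "rescale_all d m \<zeta> \<xi> l"
    have z: "?z a = t * ?u a" if "a < d" for a
      using that l d0 by (simp add: rescale_all_def rescale_def sph_def t_def)
    have "mv ?I N ?z a = t * mv ?I N ?u a" for a
      unfolding mv_def sum_distrib_left by (intro sum.cong refl) (simp add: z)
    then have "ip ?I ?z (mv ?I N ?z) = (\<Sum>a<d. (t * ?u a) * (t * mv ?I N ?u a))"
      unfolding ip_def by (intro sum.cong refl) (simp add: z)
    also have "\<dots> = t\<^sup>2 * ip ?I ?u (mv ?I N ?u)"
      by (simp add: ip_def sum_distrib_left power2_eq_square mult_ac)
    also have "ip ?I ?u (mv ?I X ?u) = real d * (\<gamma> l / s - 1)"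
    proof -
      have "mv ?I X ?u a = (\<Sum>j<m. (real d * (\<gamma> j / s - 1)) * mv ?I (D j) ?u a)" for a
        unfolding mv_def X_def sum_distrib_left sum_distrib_right
        by (subst sum.swap) (simp add: mult_ac)
      then have "ip ?I ?u (mv ?I X ?u) = ip ?I ?u (\<lambda>a. \<Sum>j<m. (real d * (\<gamma> j / s - 1)) * mv ?I (D j) ?u a)" by (simp add: ip_def)
      also have "\<dots> = (\<Sum>j<m. (real d * (\<gamma> j / s - 1)) * of_bool (j = l))"
        unfolding ip_sum_right using l by (intro sum.cong refl) (simp add: dual)
      also have "\<dots> = (\<Sum>j<m. if j = l then real d * (\<gamma> j / s - 1) else 0)"
        by (intro sum.cong refl) auto
      finally show ?thesis using l by simp
    qed
    then have "ip ?I ?u (mv ?I N ?u) = \<gamma> l"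
      unfolding quad ip_sph(2)[OF pos[OF l] pos[OF l]] using s d0 by (simp add: field_simps)
    finally have "ip ?I ?z (mv ?I N ?z) = t\<^sup>2 * \<gamma> l" .
    also have "\<dots> = 1" using \<zeta>(2)[OF l] d0 by (simp add: t2 mult.commute)
    finally show "ip ?I ?z (mv ?I N ?z) = 1" .
  qed
qed

lemma emeasure_norm_deviation:
  assumes t: "0 < t" "t \<le> real d" and j: "j < m"
  shows "emeasure (iid_gaussian_samples d m) {\<zeta> \<in> space (iid_gaussian_samples d m). t \<le> \<bar>ip {..<d} (\<zeta> j) (\<zeta> j) - real d\<bar>}
    \<le> ennreal (2 * exp (- t\<^sup>2 / (16 * real d)))"
proof -
  let ?\<mu> = "std_gaussian d" and ?Q = "iid_gaussian_samples d m"
  let ?A = "{x \<in> space ?\<mu>. t \<le> \<bar>ip {..<d} x x - real d\<bar>}"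
  have Am: "?A \<in> sets ?\<mu>" by measurable
  have cm: "(\<lambda>\<zeta>. \<zeta> j) \<in> measurable ?Q ?\<mu>" unfolding iid_gaussian_samples_def using j by (intro measurable_component_singleton) auto
  have "emeasure ?Q {\<zeta> \<in> space ?Q. t \<le> \<bar>ip {..<d} (\<zeta> j) (\<zeta> j) - real d\<bar>} = emeasure (distr ?Q ?\<mu> (\<lambda>\<zeta>. \<zeta> j)) ?A"
    using Am measurable_space[OF cm] by (subst emeasure_distr[OF cm]) (auto intro!: arg_cong2[where f = emeasure])
  also have "distr ?Q ?\<mu> (\<lambda>\<zeta>. \<zeta> j) = ?\<mu>"
    unfolding iid_gaussian_samples_def using j by (intro distr_PiM_component prob_space_std_gaussian) auto
  also have "emeasure ?\<mu> ?A \<le> ennreal (2 * exp (- t\<^sup>2 / (16 * real d)))"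
    by (rule std_gaussian_norm_tail[OF t])
  finally show ?thesis .
qed

text \<open>With \<xi> fixed the duals are deterministic and only the radii \<zeta> are random.
  Failure requires a radius outside the window in which the clamp is inactive, or a trace moment of
  X that reaches (1 / 2)^(2P).\<close>

lemma conditional_failure_bound:
  assumes d: "d \<ge> 2" and pos: "\<And>j. j < m \<Longrightarrow> ip {..<d} (\<xi> j) (\<xi> j) > 0" and m: "real m \<le> (real d)\<^sup>2"
    and K: "\<And>w. ip {..<m} (mv {..<m} (Kmat d \<xi>) w) (mv {..<m} (Kmat d \<xi>) w) \<le> ((real d)\<^sup>2 / 8)\<^sup>2 * ip {..<m} w w"
    and \<delta>: "0 < \<delta>" "\<delta> \<le> 1 / 2" and P: "P \<ge> 1"
    and S: "S \<subseteq> {\<zeta> \<in> space (iid_gaussian_samples d m). \<not> fits d m (rescale_all d m \<zeta> \<xi>)}"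
  shows "emeasure (iid_gaussian_samples d m) S \<le>
    ennreal (real m * (2 * exp (- real d * \<delta>\<^sup>2 / 64)) + real d * (24576 * \<delta>\<^sup>2 * real P * sqrt (real m)) ^ P)"
proof -
  let ?Q = "iid_gaussian_samples d m" and ?\<mu> = "std_gaussian d" and ?I = "{..<d}"
  interpret mu: prob_space ?\<mu> by (rule prob_space_std_gaussian)
  interpret Q: prob_space ?Q by (rule prob_space_iid_gaussian_samples)
  obtain D where Dsym: "\<And>j a b. D j a b = D j b a"
    and dual: "\<And>j l. j < m \<Longrightarrow> l < m \<Longrightarrow> ip ?I (sph d (\<xi> l)) (mv ?I (D j) (sph d (\<xi> l))) = of_bool (j = l)"
    and \<sigma>: "\<And>v. (\<Sum>j<m. ip ?I (mv ?I (D j) v) (mv ?I (D j) v)) \<le> 48 * sqrt (real m) / (real d)\<^sup>2 * ip ?I v v"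
    using dual_matrices[OF d pos m K] by blast
  \<comment> \<open>Dividing by the mean s makes the coefficients \<beta> exactly centered; the
    ellipsoid absorbs s as an overall scale.\<close>
  define s where "s = (\<integral>y. clamp_dev d \<delta> y \<partial>?\<mu>)"
  have d1: "d \<ge> 1" and d0: "real d > 0" using d by auto
  have cb: "bmeas ?\<mu> (clamp_dev d \<delta>)"
  proof -
    have "\<bar>clamp_dev d \<delta> y\<bar> \<le> 2" for y
      using clamp_dev_bounds[of \<delta> d y] \<delta> by (auto simp: abs_le_iff)
    then show ?thesis using measurable_clamp_dev by (auto simp: bmeas_def)
  qed
  note ci = mu.bmeas_integrable[OF cb]
  have s: "1 - \<delta> \<le> s" "s \<le> 1 + \<delta>"
    unfolding s_def using \<delta> clamp_dev_bounds[of \<delta> d]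
    by (auto intro!: mu.integral_ge_const mu.integral_le_const ci)
  have s0: "s \<ge> 1 / 2" "s > 0" using s \<delta> by linarith+
  define \<beta> where "\<beta> y = real d * (clamp_dev d \<delta> y / s - 1)" for y
  \<comment> \<open>\<open>clamp_dev\<close> and its mean s both lie within \<delta> of 1, so they
    differ by at most 2 \<delta>; division by s, which is at least 1 / 2, at most doubles
    this.\<close>
  define B where "B = 4 * \<delta> * real d"
  have \<beta>m: "\<beta> \<in> borel_measurable ?\<mu>" unfolding \<beta>_def using measurable_clamp_dev by measurable
  have \<beta>B: "\<bar>\<beta> y\<bar> \<le> B" for y
  proof -
    have "\<bar>clamp_dev d \<delta> y - s\<bar> \<le> 2 * \<delta>"
      using clamp_dev_bounds[of \<delta> d y] s \<delta> by (auto simp: abs_le_iff)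
    also have "\<dots> \<le> 4 * \<delta> * s" using s0 \<delta> by simp
    finally have "\<bar>clamp_dev d \<delta> y - s\<bar> / s \<le> 4 * \<delta>" using s0 by (simp add: field_simps)
    then have "real d * (\<bar>clamp_dev d \<delta> y - s\<bar> / s) \<le> real d * (4 * \<delta>)" using d0 by (intro mult_left_mono) auto
    moreover have "\<bar>\<beta> y\<bar> = real d * (\<bar>clamp_dev d \<delta> y - s\<bar> / s)"
    proof -
      have "\<beta> y = real d * ((clamp_dev d \<delta> y - s) / s)" unfolding \<beta>_def using s0 by (simp add: diff_divide_distrib)
      then show ?thesis using s0 d0 by (simp add: abs_mult)
    qed
    ultimately show ?thesis by (simp add: B_def mult_ac)
  qed
  have \<beta>0: "(\<integral>y. \<beta> y \<partial>?\<mu>) = 0"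
  proof -
    have "(\<integral>y. \<beta> y \<partial>?\<mu>) = real d * ((\<integral>y. clamp_dev d \<delta> y \<partial>?\<mu>) / s - 1)"
      unfolding \<beta>_def using ci by (simp add: mu.prob_space)
    then show ?thesis using s0 by (simp add: s_def[symmetric])
  qed
  define X where "X \<zeta> = mv ?I (\<lambda>a b. \<Sum>j<m. \<beta> (\<zeta> j) * D j a b)" for \<zeta> :: "nat \<Rightarrow> nat \<Rightarrow> real"
  have Xadj: "sadj ?I (X \<zeta>)" for \<zeta>
    unfolding X_def by (rule sadj_mv) (auto intro!: sum.cong simp: Dsym)
  let ?\<sigma> = "48 * sqrt (real m) / (real d)\<^sup>2"
  define h where "h \<zeta> = hs ?I (X \<zeta> ^^ P) (X \<zeta> ^^ P)" for \<zeta>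
  have hb: "bmeas ?Q h"
    unfolding h_def X_def iid_gaussian_samples_def
    by (rule Khintchine_step(2)[OF mu.prob_space_axioms _ _ \<beta>m \<beta>B \<beta>0 _ \<sigma>]) (auto simp: Dsym)
  have hE: "(\<integral>\<zeta>. h \<zeta> \<partial>?Q) \<le> real (card ?I) * (8 * B\<^sup>2 * real P * ?\<sigma>) ^ P"
    unfolding h_def X_def iid_gaussian_samples_def
    by (rule Khintchine_moment[OF mu.prob_space_axioms _ _ \<beta>m \<beta>B \<beta>0 _ \<sigma>]) (auto simp: Dsym)
  let ?T = "\<lambda>j. {\<zeta> \<in> space ?Q. real d * \<delta> / 2 \<le> \<bar>ip ?I (\<zeta> j) (\<zeta> j) - real d\<bar>}"
  let ?H = "{\<zeta> \<in> space ?Q. (1 / 2) ^ (2 * P) \<le> h \<zeta>}"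
  have Tm: "?T j \<in> sets ?Q" if "j < m" for j
  proof -
    have "(\<lambda>\<zeta>. ip ?I (\<zeta> j) (\<zeta> j)) \<in> borel_measurable ?Q"
      using that by (auto intro!: measurable_ip measurable_iid_component)
    then show ?thesis by (intro borel_measurable_le borel_measurable_const borel_measurable_abs borel_measurable_diff)
  qed
  have Hm: "?H \<in> sets ?Q" using bmeas_measurable[OF hb] by (intro borel_measurable_le borel_measurable_const)
  have "S \<subseteq> (\<Union>j<m. ?T j) \<union> ?H"
  proof
    fix \<zeta> assume "\<zeta> \<in> S"
    then have \<zeta>: "\<zeta> \<in> space ?Q" "\<not> fits d m (rescale_all d m \<zeta> \<xi>)" using S by auto
    show "\<zeta> \<in> (\<Union>j<m. ?T j) \<union> ?H"
    proof (rule ccontr)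
      assume "\<zeta> \<notin> (\<Union>j<m. ?T j) \<union> ?H"
      then have T: "\<bar>ip ?I (\<zeta> j) (\<zeta> j) - real d\<bar> \<le> real d * \<delta> / 2" if "j < m" for j
        using that \<zeta>(1) by (auto simp: not_le intro: less_imp_le)
      have H: "h \<zeta> \<le> (1 / 2) ^ (2 * P)" using \<open>\<zeta> \<notin> _\<close> \<zeta>(1) by auto
      have "fits d m (rescale_all d m \<zeta> \<xi>)"
      proof (rule fits_from_duals[OF d1 pos Dsym dual s0(2), where \<gamma> = "\<lambda>j. clamp_dev d \<delta> (\<zeta> j)"])
        show "0 < ip ?I (\<zeta> j) (\<zeta> j)" "clamp_dev d \<delta> (\<zeta> j) * ip ?I (\<zeta> j) (\<zeta> j) = real d" if "j < m" for j
          using clamp_dev_eq[OF d1 \<delta> T[OF that]] by auto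
        have "ip ?I (X \<zeta> v) (X \<zeta> v) \<le> (1 / 2)\<^sup>2 * ip ?I v v" for v
          using H P by (intro opnorm_from_hs[OF _ Xadj]) (auto simp: h_def)
        then show "ip ?I (mv ?I (\<lambda>a b. \<Sum>j<m. (real d * (clamp_dev d \<delta> (\<zeta> j) / s - 1)) * D j a b) v)
            (mv ?I (\<lambda>a b. \<Sum>j<m. (real d * (clamp_dev d \<delta> (\<zeta> j) / s - 1)) * D j a b) v) \<le> (1 / 2)\<^sup>2 * ip ?I v v" for v
          by (simp add: X_def \<beta>_def)
      qed
      then show False using \<zeta>(2) by simp
    qed
  qed
  then have "emeasure ?Q S \<le> emeasure ?Q ((\<Union>j<m. ?T j) \<union> ?H)"
    using Tm Hm by (intro emeasure_mono) auto
  also have "\<dots> \<le> emeasure ?Q (\<Union>j<m. ?T j) + emeasure ?Q ?H"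
    using Tm Hm by (intro emeasure_subadditive) auto
  finally have split: "emeasure ?Q S \<le> emeasure ?Q (\<Union>j<m. ?T j) + emeasure ?Q ?H" .
  have "emeasure ?Q (\<Union>j<m. ?T j) \<le> (\<Sum>j<m. emeasure ?Q (?T j))"
    using Tm by (intro emeasure_subadditive_finite) auto
  also have "\<dots> \<le> (\<Sum>j<m. ennreal (2 * exp (- real d * \<delta>\<^sup>2 / 64)))"
  proof (rule sum_mono)
    fix j assume "j \<in> {..<m}"
    then have "emeasure ?Q (?T j) \<le> ennreal (2 * exp (- (real d * \<delta> / 2)\<^sup>2 / (16 * real d)))"
      using \<delta> d0 by (intro emeasure_norm_deviation) auto
    also have "- (real d * \<delta> / 2)\<^sup>2 / (16 * real d) = - real d * \<delta>\<^sup>2 / 64"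
      using d0 by (simp add: power2_eq_square field_simps)
    finally show "emeasure ?Q (?T j) \<le> ennreal (2 * exp (- real d * \<delta>\<^sup>2 / 64))" .
  qed
  also have "\<dots> = ennreal (real m * (2 * exp (- real d * \<delta>\<^sup>2 / 64)))"
    by (simp add: ennreal_of_nat_eq_real_of_nat ennreal_mult)
  finally have Tb: "emeasure ?Q (\<Union>j<m. ?T j) \<le> ennreal (real m * (2 * exp (- real d * \<delta>\<^sup>2 / 64)))" .
  have Hb: "emeasure ?Q ?H \<le> ennreal (real d * (24576 * \<delta>\<^sup>2 * real P * sqrt (real m)) ^ P)"
  proof -
    have "emeasure ?Q ?H \<le> ennreal (1 / (1 / 2) ^ (2 * P) * (\<integral>\<zeta>. h \<zeta> \<partial>?Q))"
      by (rule integral_Markov_inequality[OF Q.bmeas_integrable[OF hb]]) (auto simp: h_def)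
    also have "\<dots> \<le> ennreal (4 ^ P * (real d * (8 * B\<^sup>2 * real P * ?\<sigma>) ^ P))"
    proof (rule ennreal_leI)
      have "(1 :: real) / (1 / 2) ^ (2 * P) = 4 ^ P" by (simp add: power_mult power_divide)
      then show "1 / (1 / 2) ^ (2 * P) * (\<integral>\<zeta>. h \<zeta> \<partial>?Q) \<le> 4 ^ P * (real d * (8 * B\<^sup>2 * real P * ?\<sigma>) ^ P)"
        using hE by (simp add: mult_left_mono)
    qed
    also have "4 ^ P * (real d * (8 * B\<^sup>2 * real P * ?\<sigma>) ^ P) = real d * (4 * (8 * B\<^sup>2 * real P * ?\<sigma>)) ^ P"
    proof -
      have "4 ^ P * (r * z ^ P) = r * (4 * z) ^ P" for r z :: real by (simp add: power_mult_distrib)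
      then show ?thesis .
    qed
    \<comment> \<open>24576 is 4 * 8 * 16 * 48: Markov at level 1 / 2, the Khintchine constant, the
      square of B and the dual bound; d^2 cancels between the last two.\<close>
    also have "4 * (8 * B\<^sup>2 * real P * ?\<sigma>) = 24576 * \<delta>\<^sup>2 * real P * sqrt (real m)"
      using d0 by (simp add: B_def power2_eq_square field_simps)
    finally show ?thesis .
  qed
  have "emeasure ?Q S \<le> ennreal (real m * (2 * exp (- real d * \<delta>\<^sup>2 / 64))) + ennreal (real d * (24576 * \<delta>\<^sup>2 * real P * sqrt (real m)) ^ P)"
    by (rule order_trans[OF split add_mono[OF Tb Hb]])
  also have "\<dots> = ennreal (real m * (2 * exp (- real d * \<delta>\<^sup>2 / 64)) + real d * (24576 * \<delta>\<^sup>2 * real P * sqrt (real m)) ^ P)"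
    by (rule ennreal_plus[symmetric]) auto
  finally show ?thesis .
qed

section \<open>Measurability of the event\<close>

text \<open>Matrices are functions on all pairs of naturals. Pinning the entries outside the d by d
  block to 0 makes the set a product of compact sets, compact by Tychonoff's theorem.\<close>

definition box_mats :: "nat \<Rightarrow> real \<Rightarrow> (nat \<Rightarrow> nat \<Rightarrow> real) set" where
  "box_mats d k = PiE UNIV (\<lambda>a. PiE UNIV (\<lambda>b. if a < d \<and> b < d then {-k..k} else {0}))"

lemma compact_PiE_UNIV:
  fixes B :: "'a \<Rightarrow> 'b::topological_space set"
  assumes "\<And>a. compact (B a)"
  shows "compact (PiE UNIV B)"
proof -
  have "compactin (product_topology (\<lambda>_. euclidean) UNIV) (PiE UNIV B)"
    using assms by (subst compactin_PiE) (auto simp: compactin_euclidean_iff)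
  then show ?thesis by (simp add: euclidean_product_topology compactin_euclidean_iff)
qed

lemma compact_box_mats: "compact (box_mats d k)"
  unfolding box_mats_def by (intro compact_PiE_UNIV) auto

lemma continuous_on_entry: "continuous_on S (\<lambda>N :: nat \<Rightarrow> nat \<Rightarrow> real. N a b)"
proof -
  have "continuous_on S (\<lambda>N :: nat \<Rightarrow> nat \<Rightarrow> real. N a)"
    by (rule continuous_on_subset[OF continuous_on_product_coordinates]) simp
  then show ?thesis by (rule continuous_on_product_then_coordinatewise)
qed

lemma continuous_on_quadratic: "continuous_on S (\<lambda>N. ip {..<d::nat} v (mv {..<d} N v))"
  unfolding ip_def mv_def by (intro continuous_intros continuous_on_entry)

text \<open>Strict positivity does not cut out a closed set; its quantitative form with a fixed
  constant k does, so the set is compact.\<close>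

definition pd_mats :: "nat \<Rightarrow> real \<Rightarrow> (nat \<Rightarrow> nat \<Rightarrow> real) set" where
  "pd_mats d k = box_mats d k \<inter> {N. (\<forall>a b. N a b = N b a) \<and> (\<forall>v. ip {..<d} v v \<le> k * ip {..<d} v (mv {..<d} N v))}"

lemma compact_pd_mats: "compact (pd_mats d k)"
proof -
  have "closed {N :: nat \<Rightarrow> nat \<Rightarrow> real. (\<forall>a b. N a b = N b a) \<and> (\<forall>v. ip {..<d} v v \<le> k * ip {..<d} v (mv {..<d} N v))}"
    by (intro closed_Collect_conj closed_Collect_all closed_Collect_eq closed_Collect_le continuous_on_entry
        continuous_on_const continuous_on_mult continuous_on_quadratic)
  then show ?thesis unfolding pd_mats_def by (intro compact_Int_closed compact_box_mats)
qed

text \<open>The quadratic form attains a positive minimum on the unit sphere, which is realised as a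
  compact set of functions vanishing from d on; k is the reciprocal of this minimum.\<close>

lemma positive_definite_uniform:
  fixes d :: nat
  assumes pd: "\<And>v. \<exists>a<d. v a \<noteq> 0 \<Longrightarrow> 0 < ip {..<d} v (mv {..<d} N v)"
  obtains k where "k > 0" "\<And>v. ip {..<d} v v \<le> k * ip {..<d} v (mv {..<d} N v)"
proof (cases "d = 0")
  case True
  then show ?thesis by (intro that[of 1]) (auto simp: ip_def)
next
  case False
  define S where "S = PiE UNIV (\<lambda>a. if a < d then {-1..1::real} else {0}) \<inter> {v. ip {..<d} v v = 1}"
  have c: "continuous_on T (\<lambda>v :: nat \<Rightarrow> real. v a)" for a T
    by (rule continuous_on_subset[OF continuous_on_product_coordinates]) simp
  have "closed {v :: nat \<Rightarrow> real. ip {..<d} v v = 1}"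
    unfolding ip_def by (intro closed_Collect_eq continuous_intros c)
  then have "compact S" unfolding S_def by (intro compact_Int_closed compact_PiE_UNIV) auto
  moreover have "bvec 0 \<in> S"
    using False by (auto simp: S_def bvec_def ip_def if_distrib cong: if_cong)
  moreover have "continuous_on S (\<lambda>v. ip {..<d} v (mv {..<d} N v))"
    unfolding ip_def mv_def by (intro continuous_intros c)
  ultimately obtain v0 where v0: "v0 \<in> S" "\<And>v. v \<in> S \<Longrightarrow> ip {..<d} v0 (mv {..<d} N v0) \<le> ip {..<d} v (mv {..<d} N v)"
    using continuous_attains_inf[of S] by blast
  let ?\<mu> = "ip {..<d} v0 (mv {..<d} N v0)"
  have "\<exists>a<d. v0 a \<noteq> 0"
  proof (rule ccontr)
    assume "\<not> ?thesis"
    then have "ip {..<d} v0 v0 = 0" by (simp add: ip_def)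
    then show False using v0(1) by (simp add: S_def)
  qed
  then have \<mu>: "?\<mu> > 0" by (rule pd)
  show ?thesis
  proof (rule that[of "1 / ?\<mu>"])
    show "1 / ?\<mu> > 0" using \<mu> by simp
    show "ip {..<d} v v \<le> 1 / ?\<mu> * ip {..<d} v (mv {..<d} N v)" for v
    proof (cases "ip {..<d} v v = 0")
      case True
      then have "v a = 0" if "a < d" for a using ip_eq_0D[of "{..<d}" v a] that by simp
      then show ?thesis by (simp add: ip_def)
    next
      case False
      then have pos: "ip {..<d} v v > 0" by (simp add: order_less_le)
      define r where "r = nrm d v"
      have r: "r > 0" "r * r = ip {..<d} v v" using pos by (simp_all add: r_def)
      define u where "u a = (if a < d then v a / r else 0)" for a
      have uu: "ip {..<d} u u = 1"
      proof -
        have "ip {..<d} u u = (\<Sum>a<d. v a * v a) / (r * r)"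
          unfolding ip_def sum_divide_distrib by (intro sum.cong refl) (simp add: u_def)
        then show ?thesis using r pos by (simp add: ip_def)
      qed
      have "u \<in> S"
      proof -
        have "\<bar>u a\<bar> \<le> 1" if "a < d" for a
        proof -
          have "u a * u a \<le> ip {..<d} u u" unfolding ip_def using that by (intro member_le_sum) auto
          then have "\<bar>u a\<bar>\<^sup>2 \<le> 1\<^sup>2" using uu by (simp add: power2_eq_square)
          then show ?thesis by (rule power2_le_imp_le) simp
        qed
        then have "- 1 \<le> u a" "u a \<le> 1" if "a < d" for a using that by (simp_all add: abs_le_iff minus_le_iff)
        moreover have "u a = 0" if "\<not> a < d" for a using that by (simp add: u_def)
        ultimately show ?thesis using uu by (auto simp: S_def)
      qed
      then have "?\<mu> \<le> ip {..<d} u (mv {..<d} N u)" by (rule v0(2))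
      also have "\<dots> = ip {..<d} v (mv {..<d} N v) / (r * r)"
      proof -
        have "mv {..<d} N u a = mv {..<d} N v a / r" for a
          unfolding mv_def sum_divide_distrib by (intro sum.cong refl) (simp add: u_def)
        then show ?thesis
          unfolding ip_def sum_divide_distrib by (intro sum.cong refl) (simp add: u_def)
      qed
      finally have "?\<mu> * ip {..<d} v v \<le> ip {..<d} v (mv {..<d} N v)"
        using pos unfolding r(2) by (simp add: field_simps)
      then show ?thesis using \<mu> by (simp add: field_simps)
    qed
  qed
qed

text \<open>The admissible matrices are exhausted by countably many compact sets, k being taken
  above all entries and above the constant of uniform positivity. The m equations are merged into
  one continuous function by summing absolute values.\<close>

lemma fits_iff_pd_mats:
  "fits d m \<xi> \<longleftrightarrow> (\<exists>k::nat. \<exists>N\<in>pd_mats d (real k). (\<Sum>j<m. \<bar>ip {..<d} (\<xi> j) (mv {..<d} N (\<xi> j)) - 1\<bar>) = 0)"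
proof
  assume "fits d m \<xi>"
  then obtain N where N: "\<And>a b. N a b = N b a" "\<And>v. \<exists>a<d. v a \<noteq> 0 \<Longrightarrow> 0 < ip {..<d} v (mv {..<d} N v)"
    "\<And>j. j < m \<Longrightarrow> ip {..<d} (\<xi> j) (mv {..<d} N (\<xi> j)) = 1"
    unfolding fits_def by blast
  define N' where "N' a b = (if a < d \<and> b < d then N a b else 0)" for a b
  have q: "ip {..<d} v (mv {..<d} N' v) = ip {..<d} v (mv {..<d} N v)" for v
    by (simp add: ip_def mv_def N'_def)
  obtain k0 where k0: "k0 > 0" "\<And>v. ip {..<d} v v \<le> k0 * ip {..<d} v (mv {..<d} N v)"
    using positive_definite_uniform[of d N] N(2) by blast
  define K where "K = k0 + (\<Sum>a<d. \<Sum>b<d. \<bar>N a b\<bar>)"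
  obtain k :: nat where k: "K \<le> real k" using real_arch_simple by blast
  have S0: "0 \<le> (\<Sum>a<d. \<Sum>b<d. \<bar>N a b\<bar>)" by (intro sum_nonneg) auto
  have Nk: "\<bar>N a b\<bar> \<le> real k" if "a < d" "b < d" for a b
  proof -
    have "\<bar>N a b\<bar> \<le> (\<Sum>b<d. \<bar>N a b\<bar>)" using that by (intro member_le_sum) auto
    also have "\<dots> \<le> (\<Sum>a<d. \<Sum>b<d. \<bar>N a b\<bar>)" using that by (intro member_le_sum[of a "{..<d}" "\<lambda>a. \<Sum>b<d. \<bar>N a b\<bar>"]) (auto intro: sum_nonneg)
    finally show ?thesis using k k0(1) unfolding K_def by linarith
  qed
  have qnn: "0 \<le> ip {..<d} v (mv {..<d} N v)" for v
  proof -
    have "0 \<le> k0 * ip {..<d} v (mv {..<d} N v)" using k0(2)[of v] ip_nonneg[of "{..<d}" v] by linarith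
    then show ?thesis using k0(1) by (simp add: zero_le_mult_iff)
  qed
  have "N' \<in> pd_mats d (real k)"
    unfolding pd_mats_def
  proof (intro IntI CollectI conjI allI)
    have "N' a b \<in> {- real k..real k}" if "a < d" "b < d" for a b
      using Nk[OF that] that by (auto simp: N'_def abs_le_iff)
    moreover have "N' a b = 0" if "\<not> (a < d \<and> b < d)" for a b using that by (auto simp: N'_def)
    ultimately show "N' \<in> box_mats d (real k)" unfolding box_mats_def by (simp add: PiE_iff)
    show "N' a b = N' b a" for a b using N(1)[of a b] by (simp add: N'_def)
    show "ip {..<d} v v \<le> real k * ip {..<d} v (mv {..<d} N' v)" for v
    proof -
      have "k0 \<le> real k" using k S0 unfolding K_def by linarith
      then have "k0 * ip {..<d} v (mv {..<d} N v) \<le> real k * ip {..<d} v (mv {..<d} N v)"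
        using qnn by (intro mult_right_mono)
      then show ?thesis using k0(2)[of v] unfolding q by linarith
    qed
  qed
  moreover have "(\<Sum>j<m. \<bar>ip {..<d} (\<xi> j) (mv {..<d} N' (\<xi> j)) - 1\<bar>) = 0"
    unfolding q using N(3) by simp
  ultimately show "\<exists>k::nat. \<exists>N\<in>pd_mats d (real k). (\<Sum>j<m. \<bar>ip {..<d} (\<xi> j) (mv {..<d} N (\<xi> j)) - 1\<bar>) = 0" by blast
next
  assume "\<exists>k::nat. \<exists>N\<in>pd_mats d (real k). (\<Sum>j<m. \<bar>ip {..<d} (\<xi> j) (mv {..<d} N (\<xi> j)) - 1\<bar>) = 0"
  then obtain k :: nat and N where N: "N \<in> pd_mats d (real k)" and z: "(\<Sum>j<m. \<bar>ip {..<d} (\<xi> j) (mv {..<d} N (\<xi> j)) - 1\<bar>) = 0"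
    by blast
  have N': "\<And>a b. N a b = N b a" "\<And>v. ip {..<d} v v \<le> real k * ip {..<d} v (mv {..<d} N v)"
    using N unfolding pd_mats_def by auto
  show "fits d m \<xi>" unfolding fits_def
  proof (intro exI[of _ N] conjI allI impI)
    show "N a b = N b a" for a b by (rule N')
    show "0 < ip {..<d} v (mv {..<d} N v)" if v: "\<exists>a<d. v a \<noteq> 0" for v
    proof -
      have "ip {..<d} v v \<noteq> 0" using v ip_eq_0D[of "{..<d}" v] by auto
      then have "0 < ip {..<d} v v" by (simp add: order_less_le)
      then have "0 < real k * ip {..<d} v (mv {..<d} N v)" using N'(2)[of v] by linarith
      then show ?thesis by (simp add: zero_less_mult_iff)
    qed
    show "ip {..<d} (\<xi> j) (mv {..<d} N (\<xi> j)) = 1" if "j < m" for j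
      using z that by (subst (asm) sum_nonneg_eq_0_iff) auto
  qed
qed

text \<open>Existentially quantifying over a compact set of matrices keeps the event measurable:
  a continuous function with values arbitrarily close to 0 on a countable dense subset vanishes somewhere.\<close>

lemma sets_fits: "{\<xi> \<in> space (iid_gaussian_samples d m). fits d m \<xi>} \<in> sets (iid_gaussian_samples d m)"
proof -
  let ?Q = "iid_gaussian_samples d m"
  define g where "g \<xi> N = (\<Sum>j<m. \<bar>ip {..<d} (\<xi> j) (mv {..<d} N (\<xi> j)) - 1\<bar>)" for \<xi> :: "nat \<Rightarrow> nat \<Rightarrow> real" and N
  have gc: "continuous_on T (g \<xi>)" for \<xi> T
    unfolding g_def by (intro continuous_intros continuous_on_quadratic)
  have g0: "0 \<le> g \<xi> N" for \<xi> N by (simp add: g_def sum_nonneg)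
  have gm: "(\<lambda>\<xi>. g \<xi> N) \<in> borel_measurable ?Q" for N
  proof -
    have "(\<lambda>\<xi>. mv {..<d} N (\<xi> j) a) \<in> borel_measurable ?Q" if "j < m" for j a
      unfolding mv_def using that by (intro borel_measurable_sum borel_measurable_times borel_measurable_const measurable_iid_component) auto
    then show ?thesis unfolding g_def
      by (intro borel_measurable_sum borel_measurable_abs borel_measurable_diff borel_measurable_const measurable_ip measurable_iid_component) auto
  qed
  have "\<exists>T. countable T \<and> T \<subseteq> pd_mats d (real k) \<and> pd_mats d (real k) \<subseteq> closure T" for k
    by (metis separable)
  then obtain T where T: "\<And>k. countable (T k)" "\<And>k. T k \<subseteq> pd_mats d (real k)" "\<And>k. pd_mats d (real k) \<subseteq> closure (T k)"
    by metis
  have eq: "(\<exists>N\<in>pd_mats d (real k). g \<xi> N = 0) \<longleftrightarrow> (\<forall>n. \<exists>N\<in>T k. g \<xi> N < 1 / real (Suc n))" for k \<xi>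
  proof
    assume "\<exists>N\<in>pd_mats d (real k). g \<xi> N = 0"
    then obtain N where N: "N \<in> pd_mats d (real k)" "g \<xi> N = 0" by blast
    show "\<forall>n. \<exists>N\<in>T k. g \<xi> N < 1 / real (Suc n)"
    proof
      fix n
      have "open {N. g \<xi> N < 1 / real (Suc n)}"
        by (intro open_Collect_less gc continuous_on_const)
      moreover have "N \<in> {N. g \<xi> N < 1 / real (Suc n)}" using N(2) by simp
      moreover have "N \<in> closure (T k)" using N(1) T(3) by blast
      ultimately have "{N. g \<xi> N < 1 / real (Suc n)} \<inter> T k \<noteq> {}"
        using open_Int_closure_eq_empty by blast
      then show "\<exists>N\<in>T k. g \<xi> N < 1 / real (Suc n)" by blast
    qed
  next
    assume a: "\<forall>n. \<exists>N\<in>T k. g \<xi> N < 1 / real (Suc n)"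
    then have "pd_mats d (real k) \<noteq> {}" using T(2) by blast
    then obtain N where N: "N \<in> pd_mats d (real k)" "\<And>N'. N' \<in> pd_mats d (real k) \<Longrightarrow> g \<xi> N \<le> g \<xi> N'"
      using continuous_attains_inf[OF compact_pd_mats _ gc] by blast
    have "\<not> 0 < g \<xi> N"
    proof
      assume "0 < g \<xi> N"
      then obtain n where "1 / real (Suc n) < g \<xi> N" using nat_approx_posE by blast
      moreover obtain N' where "N' \<in> T k" "g \<xi> N' < 1 / real (Suc n)" using a by blast
      ultimately show False using N(2)[of N'] T(2) by force
    qed
    then have "g \<xi> N = 0" using g0[of \<xi> N] by linarith
    then show "\<exists>N\<in>pd_mats d (real k). g \<xi> N = 0" using N(1) by blast
  qed
  have "{\<xi> \<in> space ?Q. \<exists>k::nat. \<forall>n. \<exists>N\<in>T k. g \<xi> N < 1 / real (Suc n)} \<in> sets ?Q"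
    by (intro sets.sets_Collect_countable_Ex sets.sets_Collect_countable_All sets.sets_Collect_countable_Ex' T
        borel_measurable_less gm borel_measurable_const)
  moreover have "fits d m \<xi> \<longleftrightarrow> (\<exists>k::nat. \<forall>n. \<exists>N\<in>T k. g \<xi> N < 1 / real (Suc n))" for \<xi>
    unfolding fits_iff_pd_mats eq[symmetric] by (simp add: g_def)
  ultimately show ?thesis by simp
qed

text \<open>A matrix determines a function on pairs below d only; filling the other entries with 0
  gives the symmetry for all indices that \<open>fits\<close> demands.\<close>

lemma ellipsoid_iff_fits:
  "(\<exists>E. origin_centered_ellipsoid d E \<and> (\<forall>j<m. vec d (\<xi> j) \<in> E)) \<longleftrightarrow> fits d m \<xi>"
proof -
  have sp: "scalar_prod (vec d v) (N *\<^sub>v vec d v) = ip {..<d} v (mv {..<d} (\<lambda>a b. N $$ (a, b)) v)"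
    if "N \<in> carrier_mat d d" for N v
    using that by (auto simp: scalar_prod_def ip_def mv_def lessThan_atLeast0 intro!: sum.cong)
  show ?thesis
  proof
    assume "\<exists>E. origin_centered_ellipsoid d E \<and> (\<forall>j<m. vec d (\<xi> j) \<in> E)"
    then obtain N where N: "positive_definite_mat d N" "\<And>j. j < m \<Longrightarrow> vec d (\<xi> j) \<in> ellipsoid_of_mat d N"
      unfolding origin_centered_ellipsoid_def by auto
    have Nc: "N \<in> carrier_mat d d" and Nt: "transpose_mat N = N"
      and Np: "\<And>v. v \<in> carrier_vec d \<Longrightarrow> v \<noteq> 0\<^sub>v d \<Longrightarrow> scalar_prod v (N *\<^sub>v v) > 0"
      using N(1) by (auto simp: positive_definite_mat_def)
    define N' where "N' a b = (if a < d \<and> b < d then N $$ (a, b) else 0)" for a b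
    have q: "ip {..<d} v (mv {..<d} N' v) = scalar_prod (vec d v) (N *\<^sub>v vec d v)" for v
      unfolding sp[OF Nc] by (simp add: ip_def mv_def N'_def)
    show "fits d m \<xi>" unfolding fits_def
    proof (intro exI[of _ N'] conjI allI impI)
      show "N' a b = N' b a" for a b
      proof (cases "a < d \<and> b < d")
        case True
        then have "N $$ (a, b) = transpose_mat N $$ (b, a)" using Nc by simp
        then show ?thesis using True Nt by (simp add: N'_def)
      qed (auto simp: N'_def)
      show "0 < ip {..<d} v (mv {..<d} N' v)" if v: "\<exists>a<d. v a \<noteq> 0" for v
      proof -
        obtain a where a: "a < d" "v a \<noteq> 0" using v by blast
        have "vec d v \<noteq> 0\<^sub>v d"
        proof
          assume "vec d v = 0\<^sub>v d"
          then have "vec_index (vec d v) a = vec_index (0\<^sub>v d) a" by simp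
          then show False using a by simp
        qed
        then show ?thesis unfolding q by (intro Np) auto
      qed
      show "ip {..<d} (\<xi> j) (mv {..<d} N' (\<xi> j)) = 1" if "j < m" for j
        using N(2)[OF that] unfolding q by (simp add: ellipsoid_of_mat_def)
    qed
  next
    assume "fits d m \<xi>"
    then obtain N where N: "\<And>a b. N a b = N b a" "\<And>v. \<exists>a<d. v a \<noteq> 0 \<Longrightarrow> 0 < ip {..<d} v (mv {..<d} N v)"
      "\<And>j. j < m \<Longrightarrow> ip {..<d} (\<xi> j) (mv {..<d} N (\<xi> j)) = 1"
      unfolding fits_def by blast
    define M where "M = mat d d (\<lambda>(a, b). N a b)"
    have Mc: "M \<in> carrier_mat d d" by (simp add: M_def)
    have q: "scalar_prod (vec d v) (M *\<^sub>v vec d v) = ip {..<d} v (mv {..<d} N v)" for v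
      unfolding sp[OF Mc] by (simp add: ip_def mv_def M_def)
    have "positive_definite_mat d M"
      unfolding positive_definite_mat_def
    proof (intro conjI ballI impI Mc)
      show "transpose_mat M = M" by (intro eq_matI) (auto simp: M_def N(1))
      fix v :: "real Matrix.vec" assume v: "v \<in> carrier_vec d" "v \<noteq> 0\<^sub>v d"
      have vv: "vec d (\<lambda>a. vec_index v a) = v" using v(1) by auto
      have "\<exists>a<d. vec_index v a \<noteq> 0"
      proof (rule ccontr)
        assume "\<not> ?thesis"
        then have "v = 0\<^sub>v d" using v(1) by (intro eq_vecI) auto
        then show False using v(2) by simp
      qed
      then have "0 < ip {..<d} (\<lambda>a. vec_index v a) (mv {..<d} N (\<lambda>a. vec_index v a))" by (rule N(2))
      then show "0 < scalar_prod v (M *\<^sub>v v)" using q[of "\<lambda>a. vec_index v a"] by (simp add: vv)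
    qed
    moreover have "vec d (\<xi> j) \<in> ellipsoid_of_mat d M" if "j < m" for j
      using N(3)[OF that] by (simp add: ellipsoid_of_mat_def q)
    ultimately show "\<exists>E. origin_centered_ellipsoid d E \<and> (\<forall>j<m. vec d (\<xi> j) \<in> E)"
      unfolding origin_centered_ellipsoid_def by blast
  qed
qed

section \<open>The failure probability\<close>

text \<open>With sample j fixed and of squared norm at most v, the inner product is Gaussian in
  sample i, and averaging over that sample alone gives the tail.\<close>

lemma emeasure_correlation:
  assumes t: "0 < t" and v: "v > 0" and ij: "i < m" "j < m" "i \<noteq> j"
  shows "emeasure (iid_gaussian_samples d m) {\<xi> \<in> space (iid_gaussian_samples d m). ip {..<d} (\<xi> j) (\<xi> j) \<le> v \<and> t \<le> \<bar>ip {..<d} (\<xi> i) (\<xi> j)\<bar>}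
    \<le> ennreal (2 * exp (- t\<^sup>2 / (2 * v)))"
proof -
  let ?\<mu> = "std_gaussian d" and ?Q = "iid_gaussian_samples d m"
  interpret Q: prob_space ?Q by (rule prob_space_iid_gaussian_samples)
  let ?E = "{\<xi> \<in> space ?Q. ip {..<d} (\<xi> j) (\<xi> j) \<le> v \<and> t \<le> \<bar>ip {..<d} (\<xi> i) (\<xi> j)\<bar>}"
  have m: "(\<lambda>\<xi>. ip {..<d} (\<xi> a) (\<xi> b)) \<in> borel_measurable ?Q" if "a < m" "b < m" for a b
    using that by (auto intro!: measurable_ip measurable_iid_component)
  have Em: "?E \<in> sets ?Q"
    by (intro sets.sets_Collect_conj borel_measurable_le borel_measurable_const borel_measurable_abs m ij)
  have "emeasure ?Q ?E = (\<integral>\<^sup>+\<xi>. indicator ?E \<xi> \<partial>?Q)" using Em by simp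
  also have "\<dots> = (\<integral>\<^sup>+\<xi>. \<integral>\<^sup>+x. indicator ?E (\<xi>(i := x)) \<partial>?\<mu> \<partial>?Q)"
    using borel_measurable_indicator[OF Em] ij(1) unfolding iid_gaussian_samples_def
    by (intro resample_nn_integral prob_space_std_gaussian) auto
  also have "\<dots> \<le> (\<integral>\<^sup>+\<xi>. ennreal (2 * exp (- t\<^sup>2 / (2 * v))) \<partial>?Q)"
  proof (rule nn_integral_mono)
    fix \<xi>
    show "(\<integral>\<^sup>+x. indicator ?E (\<xi>(i := x)) \<partial>?\<mu>) \<le> ennreal (2 * exp (- t\<^sup>2 / (2 * v)))"
    proof (cases "ip {..<d} (\<xi> j) (\<xi> j) \<le> v")
      case True
      let ?A = "{x \<in> space ?\<mu>. t \<le> \<bar>ip {..<d} x (\<xi> j)\<bar>}"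
      have "(\<integral>\<^sup>+x. indicator ?E (\<xi>(i := x)) \<partial>?\<mu>) \<le> (\<integral>\<^sup>+x. indicator ?A x \<partial>?\<mu>)"
        using ij(3) by (intro nn_integral_mono) (auto simp: indicator_def)
      also have "\<dots> = emeasure ?\<mu> ?A" by (rule nn_integral_indicator) measurable
      also have "\<dots> \<le> ennreal (2 * exp (- t\<^sup>2 / (2 * v)))" by (rule std_gaussian_ip_tail[OF t True v])
      finally show ?thesis .
    next
      case False
      then have "indicator ?E (\<xi>(i := x)) = (0 :: ennreal)" for x using ij(3) by (auto simp: indicator_def)
      then show ?thesis by simp
    qed
  qed
  also have "\<dots> = ennreal (2 * exp (- t\<^sup>2 / (2 * v)))" by (simp add: Q.emeasure_space_1)
  finally show ?thesis .
qed

text \<open>96 is 4 * 24: squared norms are at least d / 2, so normalising the squared inner product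
  costs a factor of 4. From below \<open>kern\<close> is at least -d, which the same bound covers
  because l is at least 1.\<close>

lemma Good_from_tails:
  assumes d: "d \<ge> 1" and l: "l \<ge> 1"
    and norms: "\<And>i. i \<in> V \<Longrightarrow> \<bar>ip {..<d} (\<xi> i) (\<xi> i) - real d\<bar> \<le> real d / 2"
    and corr: "\<And>i j. i \<in> V \<Longrightarrow> j \<in> V \<Longrightarrow> i \<noteq> j \<Longrightarrow> \<bar>ip {..<d} (\<xi> i) (\<xi> j)\<bar> \<le> sqrt (24 * real d * l)"
  shows "Good d (96 * real d * l) V \<xi>"
  unfolding Good_def
proof (intro conjI ballI impI)
  show low: "real d / 2 \<le> ip {..<d} (\<xi> i) (\<xi> i)" if "i \<in> V" for i
    using abs_le_D2[OF norms[OF that]] by simp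
  fix i j assume ij: "i \<in> V" "j \<in> V" "i \<noteq> j"
  let ?p = "ip {..<d} (\<xi> i) (\<xi> i)" and ?q = "ip {..<d} (\<xi> j) (\<xi> j)" and ?r = "ip {..<d} (\<xi> i) (\<xi> j)"
  have d0: "real d > 0" using d by simp
  have pq: "(real d / 2) * (real d / 2) \<le> ?p * ?q" using low[OF ij(1)] low[OF ij(2)] by (intro mult_mono) auto
  have pq0: "?p * ?q > 0" using pq d0 by (smt (verit) mult_pos_pos half_gt_zero)
  have "?r\<^sup>2 \<le> (sqrt (24 * real d * l))\<^sup>2" using corr[OF ij] by (intro abs_le_square_iff[THEN iffD1]) auto
  then have r: "?r\<^sup>2 \<le> 24 * real d * l" using l by simp
  have "(real d)\<^sup>2 * ?r\<^sup>2 \<le> (real d)\<^sup>2 * (24 * real d * l)" using r by (intro mult_left_mono) auto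
  also have "\<dots> = (96 * real d * l) * ((real d / 2) * (real d / 2))" by (simp add: power2_eq_square)
  also have "\<dots> \<le> (96 * real d * l) * (?p * ?q)" using pq l by (intro mult_left_mono) auto
  finally have up: "(real d)\<^sup>2 * ?r\<^sup>2 / (?p * ?q) \<le> 96 * real d * l" using pq0 by (simp add: pos_divide_le_eq)
  have lo: "0 \<le> (real d)\<^sup>2 * ?r\<^sup>2 / (?p * ?q)" using pq0 by simp
  have "real d * 1 \<le> real d * (96 * l)" using l by (intro mult_left_mono) auto
  then have "real d \<le> 96 * real d * l" by simp
  then show "\<bar>kern d (\<xi> i) (\<xi> j)\<bar> \<le> 96 * real d * l"
    using up lo d0 unfolding kern_def abs_le_iff by linarith
qed

text \<open>The level 24 d l for squared inner products gives each pair a tail 2 exp (- 6 l), which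
  for l = ln d outweighs the at most d^4 pairs when m is at most d^2. The pair events may assume
  squared norms up to 2 d, since outside the norm events these are at most 3 d / 2.\<close>

lemma not_Good_bound:
  assumes d: "d \<ge> 1" and l: "l \<ge> 1"
  shows "emeasure (iid_gaussian_samples d m) {\<xi> \<in> space (iid_gaussian_samples d m). \<not> Good d (96 * real d * l) {..<m} \<xi>}
    \<le> ennreal (real m * (2 * exp (- real d / 64)) + (real m)\<^sup>2 * (2 * exp (- 6 * l)))"
proof -
  let ?Q = "iid_gaussian_samples d m" and ?t = "sqrt (24 * real d * l)"
  have d0: "real d > 0" using d by simp
  have t0: "?t > 0" using d0 l by simp
  let ?T = "\<lambda>j. {\<xi> \<in> space ?Q. real d / 2 \<le> \<bar>ip {..<d} (\<xi> j) (\<xi> j) - real d\<bar>}"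
  let ?E = "\<lambda>i j. {\<xi> \<in> space ?Q. ip {..<d} (\<xi> j) (\<xi> j) \<le> 2 * real d \<and> ?t \<le> \<bar>ip {..<d} (\<xi> i) (\<xi> j)\<bar>}"
  have m: "(\<lambda>\<xi>. ip {..<d} (\<xi> a) (\<xi> b)) \<in> borel_measurable ?Q" if "a < m" "b < m" for a b
    using that by (auto intro!: measurable_ip measurable_iid_component)
  have Tm: "?T j \<in> sets ?Q" if "j < m" for j
    by (intro borel_measurable_le borel_measurable_const borel_measurable_abs borel_measurable_diff m that)
  have Em: "?E i j \<in> sets ?Q" if "i < m" "j < m" for i j
    by (intro sets.sets_Collect_conj borel_measurable_le borel_measurable_const borel_measurable_abs m that)
  let ?O = "{p \<in> {..<m} \<times> {..<m}. fst p \<noteq> snd p}"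
  have Ofin: "finite ?O" by simp
  have TU: "(\<Union>j<m. ?T j) \<in> sets ?Q" using Tm by (intro sets.finite_UN) auto
  have EU: "(\<Union>p\<in>?O. ?E (fst p) (snd p)) \<in> sets ?Q" using Em by (intro sets.finite_UN Ofin) auto
  have "{\<xi> \<in> space ?Q. \<not> Good d (96 * real d * l) {..<m} \<xi>} \<subseteq> (\<Union>j<m. ?T j) \<union> (\<Union>p\<in>?O. ?E (fst p) (snd p))"
  proof
    fix \<xi> assume a: "\<xi> \<in> {\<xi> \<in> space ?Q. \<not> Good d (96 * real d * l) {..<m} \<xi>}"
    show "\<xi> \<in> (\<Union>j<m. ?T j) \<union> (\<Union>p\<in>?O. ?E (fst p) (snd p))"
    proof (rule ccontr)
      assume n: "\<xi> \<notin> (\<Union>j<m. ?T j) \<union> (\<Union>p\<in>?O. ?E (fst p) (snd p))"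
      have norms: "\<bar>ip {..<d} (\<xi> i) (\<xi> i) - real d\<bar> \<le> real d / 2" if "i \<in> {..<m}" for i
        using n a that by (auto simp: not_le intro: less_imp_le)
      have corr: "\<bar>ip {..<d} (\<xi> i) (\<xi> j)\<bar> \<le> ?t" if "i \<in> {..<m}" "j \<in> {..<m}" "i \<noteq> j" for i j
      proof -
        have "ip {..<d} (\<xi> j) (\<xi> j) \<le> 2 * real d" using abs_le_D1[OF norms[OF that(2)]] d0 by linarith
        moreover have "\<xi> \<notin> ?E i j" using n that by force
        ultimately show ?thesis using a by (auto simp: not_le intro: less_imp_le)
      qed
      have "Good d (96 * real d * l) {..<m} \<xi>" by (rule Good_from_tails[OF d l norms corr])
      then show False using a by simp
    qed
  qed
  then have "emeasure ?Q {\<xi> \<in> space ?Q. \<not> Good d (96 * real d * l) {..<m} \<xi>} \<le> emeasure ?Q ((\<Union>j<m. ?T j) \<union> (\<Union>p\<in>?O. ?E (fst p) (snd p)))"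
    using TU EU by (intro emeasure_mono) auto
  also have "\<dots> \<le> emeasure ?Q (\<Union>j<m. ?T j) + emeasure ?Q (\<Union>p\<in>?O. ?E (fst p) (snd p))"
    by (rule emeasure_subadditive[OF TU EU])
  finally have split: "emeasure ?Q {\<xi> \<in> space ?Q. \<not> Good d (96 * real d * l) {..<m} \<xi>} \<le> emeasure ?Q (\<Union>j<m. ?T j) + emeasure ?Q (\<Union>p\<in>?O. ?E (fst p) (snd p))" .
  have "emeasure ?Q (\<Union>j<m. ?T j) \<le> (\<Sum>j<m. emeasure ?Q (?T j))"
    using Tm by (intro emeasure_subadditive_finite) auto
  also have "\<dots> \<le> (\<Sum>j<m. ennreal (2 * exp (- real d / 64)))"
  proof (rule sum_mono)
    fix j assume "j \<in> {..<m}"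
    then have "emeasure ?Q (?T j) \<le> ennreal (2 * exp (- (real d / 2)\<^sup>2 / (16 * real d)))"
      using d0 by (intro emeasure_norm_deviation) auto
    also have "- (real d / 2)\<^sup>2 / (16 * real d) = - real d / 64" using d0 by (simp add: power2_eq_square field_simps)
    finally show "emeasure ?Q (?T j) \<le> ennreal (2 * exp (- real d / 64))" .
  qed
  also have "\<dots> = ennreal (real m * (2 * exp (- real d / 64)))"
    by (simp add: ennreal_of_nat_eq_real_of_nat ennreal_mult)
  finally have Tb: "emeasure ?Q (\<Union>j<m. ?T j) \<le> ennreal (real m * (2 * exp (- real d / 64)))" .
  have "emeasure ?Q (\<Union>p\<in>?O. ?E (fst p) (snd p)) \<le> (\<Sum>p\<in>?O. emeasure ?Q (?E (fst p) (snd p)))"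
    using Em by (intro emeasure_subadditive_finite Ofin) auto
  also have "\<dots> \<le> (\<Sum>p\<in>?O. ennreal (2 * exp (- 6 * l)))"
  proof (rule sum_mono)
    fix p assume "p \<in> ?O"
    then have "emeasure ?Q (?E (fst p) (snd p)) \<le> ennreal (2 * exp (- ?t\<^sup>2 / (2 * (2 * real d))))"
      using t0 d0 by (intro emeasure_correlation) auto
    also have "- ?t\<^sup>2 / (2 * (2 * real d)) = - 6 * l" using d0 l by simp
    finally show "emeasure ?Q (?E (fst p) (snd p)) \<le> ennreal (2 * exp (- 6 * l))" .
  qed
  also have "\<dots> = ennreal (real (card ?O) * (2 * exp (- 6 * l)))"
    by (simp add: ennreal_of_nat_eq_real_of_nat ennreal_mult)
  also have "\<dots> \<le> ennreal ((real m)\<^sup>2 * (2 * exp (- 6 * l)))"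
  proof (intro ennreal_leI mult_right_mono)
    have "card ?O \<le> card ({..<m} \<times> {..<m})" by (intro card_mono) auto
    then have "card ?O \<le> m * m" by simp
    then have "real (card ?O) \<le> real (m * m)" by (rule of_nat_mono)
    then show "real (card ?O) \<le> (real m)\<^sup>2" by (simp add: power2_eq_square)
  qed simp
  finally have Eb: "emeasure ?Q (\<Union>p\<in>?O. ?E (fst p) (snd p)) \<le> ennreal ((real m)\<^sup>2 * (2 * exp (- 6 * l)))" .
  have "emeasure ?Q {\<xi> \<in> space ?Q. \<not> Good d (96 * real d * l) {..<m} \<xi>} \<le> ennreal (real m * (2 * exp (- real d / 64))) + ennreal ((real m)\<^sup>2 * (2 * exp (- 6 * l)))"
    by (rule order_trans[OF split add_mono[OF Tb Eb]])
  also have "\<dots> = ennreal (real m * (2 * exp (- real d / 64)) + (real m)\<^sup>2 * (2 * exp (- 6 * l)))"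
    by (rule ennreal_plus[symmetric]) auto
  finally show ?thesis .
qed

text \<open>The conditional bound is integrated over the directions; where the good event or the
  trace bound fails, the conditional probability is at most 1. \<open>R\<close> is 4 P s for s =
  sqrt m \<kappa>, and the level d^2 / 8 is the norm bound under which dual matrices exist.\<close>

lemma fits_failure_bound:
  fixes d m P :: nat and l \<delta> :: real
  defines "\<kappa> \<equiv> 96 * real d * l" and "R \<equiv> 384 * real P * sqrt (real m) * real d * l"
  assumes d: "d \<ge> 2" and m: "m \<ge> 1" "real m \<le> (real d)\<^sup>2" and l: "l \<ge> 1" and P: "P \<ge> 1"
    and Pm: "48 * real P * real m \<le> (real d)\<^sup>2" and \<delta>: "0 < \<delta>" "\<delta> \<le> 1 / 2"
  shows "emeasure (iid_gaussian_samples d m) {\<xi> \<in> space (iid_gaussian_samples d m). \<not> fits d m \<xi>}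
    \<le> ennreal (real m * (2 * exp (- real d / 64)) + (real m)\<^sup>2 * (2 * exp (- 6 * l))
        + 4 * real m * (R / ((real d)\<^sup>2 / 8)) ^ (2 * P)
        + (real m * (2 * exp (- real d * \<delta>\<^sup>2 / 64)) + real d * (24576 * \<delta>\<^sup>2 * real P * sqrt (real m)) ^ P))"
proof -
  let ?Q = "iid_gaussian_samples d m" and ?\<Lambda> = "(real d)\<^sup>2 / 8"
  interpret Q: prob_space ?Q by (rule prob_space_iid_gaussian_samples)
  have d1: "d \<ge> 1" and d0: "real d > 0" using d by auto
  let ?e = "real m * (2 * exp (- real d * \<delta>\<^sup>2 / 64)) + real d * (24576 * \<delta>\<^sup>2 * real P * sqrt (real m)) ^ P"
  let ?a = "real m * (2 * exp (- real d / 64)) + (real m)\<^sup>2 * (2 * exp (- 6 * l))"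
  let ?b = "4 * real m * (R / ?\<Lambda>) ^ (2 * P)"
  let ?Bad = "{\<xi> \<in> space ?Q. \<not> fits d m \<xi>}"
  let ?B1 = "{\<xi> \<in> space ?Q. \<not> Good d \<kappa> {..<m} \<xi>}"
  let ?B2 = "{\<xi> \<in> space ?Q. Good d \<kappa> {..<m} \<xi> \<and> ?\<Lambda> ^ (2 * P) < tau d P {..<m} \<xi>}"
  have e0: "0 \<le> ?e" by (intro add_nonneg_nonneg mult_nonneg_nonneg zero_le_power) (use \<delta> in auto)
  have Badm: "?Bad \<in> sets ?Q" by (intro sets.sets_Collect_neg sets_fits)
  have Gm: "{\<xi> \<in> space ?Q. Good d \<kappa> {..<m} \<xi>} \<in> sets ?Q" by (rule sets_Good) simp
  have B1m: "?B1 \<in> sets ?Q" by (intro sets.sets_Collect_neg Gm)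
  have B2m: "?B2 \<in> sets ?Q"
    by (intro sets.sets_Collect_conj Gm borel_measurable_less borel_measurable_const measurable_tau) simp
  have B1: "emeasure ?Q ?B1 \<le> ennreal ?a" unfolding \<kappa>_def by (rule not_Good_bound[OF d1 l])
  have B2: "emeasure ?Q ?B2 \<le> ennreal ?b"
  proof (rule Kmat_norm_tail[where s = "sqrt (real m) * \<kappa>", OF d1])
    show "0 \<le> \<kappa>" using l by (simp add: \<kappa>_def)
    show "0 < sqrt (real m) * \<kappa>" using m l d0 by (simp add: \<kappa>_def)
    show "real m * \<kappa>\<^sup>2 \<le> (sqrt (real m) * \<kappa>)\<^sup>2" by (simp add: power_mult_distrib)
    show "4 * real P * (sqrt (real m) * \<kappa>) \<le> R" by (simp add: R_def \<kappa>_def)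
    show "0 < ?\<Lambda>" using d0 by simp
    show "288 * real P * real m * (real d)\<^sup>2 \<le> R\<^sup>2"
    proof -
      have "R\<^sup>2 = (384 * real P * l)\<^sup>2 * (real m * (real d)\<^sup>2)" by (simp add: R_def power_mult_distrib mult_ac)
      moreover have "288 * real P \<le> (384 * real P * l)\<^sup>2"
      proof -
        have "384 * real P * 1 \<le> 384 * real P * l" using l by (intro mult_left_mono) auto
        then have Pl: "288 * real P \<le> 384 * real P * l" "1 \<le> 384 * real P * l" using P by linarith+
        have "(384 * real P * l) * 1 \<le> (384 * real P * l) * (384 * real P * l)" using Pl by (intro mult_left_mono) auto
        then show ?thesis using Pl by (simp add: power2_eq_square)
      qed
      then have "288 * real P * (real m * (real d)\<^sup>2) \<le> (384 * real P * l)\<^sup>2 * (real m * (real d)\<^sup>2)"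
        by (intro mult_right_mono) auto
      ultimately show ?thesis by (simp add: mult.assoc)
    qed
  qed fact
  have "emeasure ?Q ?Bad = (\<integral>\<^sup>+\<xi>. emeasure ?Q {\<zeta> \<in> space ?Q. rescale_all d m \<zeta> \<xi> \<in> ?Bad} \<partial>?Q)"
    by (rule iid_gaussian_rescale[OF Badm])
  also have "\<dots> \<le> (\<integral>\<^sup>+\<xi>. (indicator ?B1 \<xi> + indicator ?B2 \<xi>) + ennreal ?e \<partial>?Q)"
  proof (rule nn_integral_mono)
    fix \<xi> assume \<xi>: "\<xi> \<in> space ?Q"
    let ?S = "{\<zeta> \<in> space ?Q. rescale_all d m \<zeta> \<xi> \<in> ?Bad}"
    show "emeasure ?Q ?S \<le> (indicator ?B1 \<xi> + indicator ?B2 \<xi>) + ennreal ?e"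
    proof (cases "\<xi> \<in> ?B1 \<or> \<xi> \<in> ?B2")
      case True
      then have "(1 :: ennreal) \<le> indicator ?B1 \<xi> + indicator ?B2 \<xi>" by (auto simp: indicator_def)
      also have "\<dots> \<le> (indicator ?B1 \<xi> + indicator ?B2 \<xi>) + ennreal ?e" by simp
      finally show ?thesis using Q.emeasure_le_1 order_trans by blast
    next
      case False
      then have G: "Good d \<kappa> {..<m} \<xi>" and tau: "tau d P {..<m} \<xi> \<le> ?\<Lambda> ^ (2 * P)" using \<xi> by auto
      have pos: "ip {..<d} (\<xi> j) (\<xi> j) > 0" if "j < m" for j
      proof -
        have "real d / 2 \<le> ip {..<d} (\<xi> j) (\<xi> j)" using G that by (simp add: Good_def)
        then show ?thesis using d0 by linarith
      qed
      have "ip {..<m} (mv {..<m} (Kmat d \<xi>) w) (mv {..<m} (Kmat d \<xi>) w) \<le> ?\<Lambda>\<^sup>2 * ip {..<m} w w" for w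
        using tau P d0 unfolding tau_def
        by (intro opnorm_from_hs[where n = P] sadj_mv) (auto simp: Kmat_commute)
      then have "emeasure ?Q ?S \<le> ennreal ?e"
        by (intro conditional_failure_bound[OF d pos m(2) _ \<delta> P]) auto
      then show ?thesis by (simp add: add_increasing)
    qed
  qed
  also have "\<dots> = (emeasure ?Q ?B1 + emeasure ?Q ?B2) + ennreal ?e"
    using B1m B2m by (subst nn_integral_add, simp, simp, subst nn_integral_add) (simp_all add: Q.emeasure_space_1)
  also have "\<dots> \<le> (ennreal ?a + ennreal ?b) + ennreal ?e" by (intro add_mono B1 B2 order_refl)
  also have "\<dots> = ennreal (?a + ?b + ?e)"
  proof -
    have "0 \<le> ?a" "0 \<le> ?b" using l by (auto simp: R_def intro!: mult_nonneg_nonneg zero_le_power)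
    then show ?thesis using e0 by (simp only: ennreal_plus[symmetric] add_nonneg_nonneg)
  qed
  finally show ?thesis .
qed

text \<open>Both moment bounds are P-th or 2P-th powers whose base is a multiple of P sqrt m ln d /
  d. With P close to ln d the base is small exactly when sqrt m (ln d)^2 is small against d, which
  is the hypothesis on m; a base below exp (- 2) or exp (- 3) then beats the polynomial
  prefactors.\<close>

lemma fits_failure_bound_asymptotic:
  assumes d: "d \<ge> 2" and m: "m \<ge> 1" and md: "real m < (1 / 10 ^ 18) * (real d)\<^sup>2 / (ln (real d)) ^ 4"
  shows "emeasure (iid_gaussian_samples d m) {\<xi> \<in> space (iid_gaussian_samples d m). \<not> fits d m \<xi>} \<le> ennreal (11 / (real d)\<^sup>2)"
proof -
  define l where "l = ln (real d)"
  define x where "x = real d"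
  have x2: "x \<ge> 2" using d by (simp add: x_def)
  have l_half: "1 / 2 \<le> l"
  proof -
    have "ln 2 \<le> l" unfolding l_def using d by (subst ln_le_cancel_iff) auto
    then show ?thesis using ln2_ge_two_thirds by linarith
  qed
  have l4: "l ^ 4 > 0" using l_half by (intro zero_less_power) linarith
  have mx: "real m * l ^ 4 * 10 ^ 18 < x\<^sup>2"
    using md l4 unfolding l_def[symmetric] unfolding x_def[symmetric] by (simp add: field_simps)
  \<comment> \<open>For small d no m qualifies: m is at least 1 and ln d at least 1 / 2, so d^2
    exceeds 10^18 / 16.\<close>
  have big: "10 ^ 8 \<le> x"
  proof -
    have "(1 / 2) ^ 4 \<le> l ^ 4" using l_half by (intro power_mono) auto
    then have "1 * (1 / 2) ^ 4 \<le> real m * l ^ 4" using m by (intro mult_mono) auto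
    then have "1 / 16 \<le> real m * l ^ 4" by (simp add: power_divide)
    then have "(10 ^ 8)\<^sup>2 \<le> x\<^sup>2" using mx by simp
    then show ?thesis by (rule power2_le_imp_le) (use x2 in simp)
  qed
  have xpos: "x > 0" using x2 by linarith
  have l1: "l \<ge> 1"
  proof -
    have "3 \<le> x" using big by simp
    then have "exp 1 \<le> x" by (rule order_trans[OF exp_le])
    then have "ln (exp 1) \<le> ln x" using xpos by (subst ln_le_cancel_iff) auto
    then show ?thesis by (simp add: l_def x_def)
  qed
  have exl: "exp l = x" using xpos by (simp add: l_def x_def)
  have l_sqrt: "l \<le> 2 * sqrt x"
  proof -
    have "l = 2 * ln (sqrt x)" using xpos by (simp add: ln_sqrt l_def x_def)
    also have "ln (sqrt x) \<le> sqrt x" using ln_le_minus_one[of "sqrt x"] xpos by simp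
    finally show ?thesis by simp
  qed
  have l1024: "1024 * l \<le> x"
  proof -
    have "2048 \<le> sqrt x" using big by (intro real_le_rsqrt) simp
    then have "2048 * sqrt x \<le> sqrt x * sqrt x" using xpos by (intro mult_right_mono) auto
    then have "2048 * sqrt x \<le> x" using xpos by simp
    then show ?thesis using l_sqrt by linarith
  qed
  have m_le: "real m \<le> x\<^sup>2 / 10 ^ 18"
  proof -
    have "1 ^ 4 \<le> l ^ 4" using l1 by (intro power_mono) auto
    then have "real m * 1 \<le> real m * l ^ 4" by (intro mult_left_mono) auto
    then show ?thesis using mx by simp
  qed
  have m2: "real m \<le> x\<^sup>2" using m_le by (rule order_trans) simp
  have sq: "sqrt (real m) * l\<^sup>2 \<le> x / 10 ^ 9"
  proof (rule power2_le_imp_le)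
    have "(sqrt (real m) * l\<^sup>2)\<^sup>2 = real m * l ^ 4" by (simp add: power_mult_distrib power_mult[symmetric])
    then show "(sqrt (real m) * l\<^sup>2)\<^sup>2 \<le> (x / 10 ^ 9)\<^sup>2" using mx by (simp add: power_divide)
    show "0 \<le> x / 10 ^ 9" using xpos by simp
  qed
  \<comment> \<open>Rounding up turns exponentials in P into negative powers of d, and costs at most
    a factor of 2 because l is at least 1.\<close>
  define P where "P = nat \<lceil>l\<rceil>"
  have Pl: "l \<le> real P" "real P \<le> 2 * l" "P \<ge> 1"
  proof -
    have "real P = of_int \<lceil>l\<rceil>" using l1 by (simp add: P_def)
    then show a: "l \<le> real P" "real P \<le> 2 * l" using l1 by linarith+
    then have "1 \<le> real P" using l1 by linarith
    then show "P \<ge> 1" by simp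
  qed
  have Pm: "48 * real P * real m \<le> (real d)\<^sup>2"
  proof -
    have "l ^ 1 \<le> l ^ 4" using l1 by (intro power_increasing) auto
    then have "48 * real P * real m \<le> (96 * l ^ 4) * real m" using Pl by (intro mult_right_mono) auto
    also have "\<dots> = 96 * (real m * l ^ 4)" by simp
    also have "\<dots> \<le> real m * l ^ 4 * 10 ^ 18" using l4 by simp
    also have "\<dots> \<le> x\<^sup>2" using mx by (rule less_imp_le)
    finally show ?thesis by (simp add: x_def)
  qed
  \<comment> \<open>Chosen so that d \<delta>^2 / 64 is 4 ln d, which makes the radius tail d^(-4);
    \<open>l1024\<close> is the condition that \<delta> is at most 1 / 2.\<close>
  define \<delta> where "\<delta> = 16 * sqrt (l / x)"
  have \<delta>2: "\<delta>\<^sup>2 = 256 * l / x" using l1 xpos by (simp add: \<delta>_def power_mult_distrib)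
  have \<delta>: "0 < \<delta>" "\<delta> \<le> 1 / 2"
  proof -
    show "0 < \<delta>" using l1 xpos by (simp add: \<delta>_def)
    have "\<delta>\<^sup>2 \<le> (1 / 2)\<^sup>2" unfolding \<delta>2 using l1024 xpos by (simp add: field_simps power2_eq_square)
    then show "\<delta> \<le> 1 / 2" by (rule power2_le_imp_le) simp
  qed
  have Psq: "real P * sqrt (real m) * l \<le> 2 * x / 10 ^ 9"
  proof -
    have "real P * (sqrt (real m) * l) \<le> (2 * l) * (sqrt (real m) * l)" using Pl l1 by (intro mult_right_mono) auto
    also have "\<dots> = 2 * (sqrt (real m) * l\<^sup>2)" by (simp add: power2_eq_square)
    finally show ?thesis using sq by simp
  qed
  have e3: "exp (1::real) ^ 3 \<le> 3 ^ 3" using exp_le by (intro power_mono) auto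
  have em3: "1 / 27 \<le> exp (- 3 :: real)"
  proof -
    have "exp (3::real) = exp 1 ^ 3" by (simp add: exp_of_nat_mult[symmetric])
    then have "exp (3::real) \<le> 27" using e3 by simp
    then show ?thesis by (simp add: exp_minus field_simps)
  qed
  have em2: "1 / 27 \<le> exp (- 2 :: real)" by (rule order_trans[OF em3]) simp
  let ?R = "384 * real P * sqrt (real m) * real d * l"
  have x4: "exp (- 4 * l) = 1 / x ^ 4" "exp (- 6 * l) = 1 / x ^ 6" "exp (- 3 * l) = 1 / x ^ 3"
  proof -
    have "exp (- real n * l) = 1 / x ^ n" for n
    proof -
      have "exp (real n * l) = x ^ n" by (simp add: exp_of_nat_mult exl)
      then show ?thesis by (simp add: exp_minus inverse_eq_divide)
    qed
    from this[of 4] this[of 6] this[of 3] show "exp (- 4 * l) = 1 / x ^ 4" "exp (- 6 * l) = 1 / x ^ 6" "exp (- 3 * l) = 1 / x ^ 3"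
      by simp_all
  qed
  have mx4: "real m * (1 / x ^ 4) \<le> 1 / x\<^sup>2"
  proof -
    have "real m * (1 / x ^ 4) \<le> x\<^sup>2 * (1 / x ^ 4)" using m2 by (intro mult_right_mono) auto
    also have "\<dots> = 1 / x\<^sup>2" using xpos by (simp add: field_simps power2_eq_square power4_eq_xxxx)
    finally show ?thesis .
  qed
  have scale: "k * a \<le> k / x\<^sup>2" if "a \<le> 1 / x\<^sup>2" "0 \<le> k" for a k :: real
    using mult_left_mono[OF that] by simp
  have t1: "real m * (2 * exp (- x / 64)) \<le> 2 / x\<^sup>2"
  proof -
    have "256 * l \<le> x" using l1024 l1 by linarith
    then have "exp (- x / 64) \<le> exp (- 4 * l)" by simp
    then have "real m * exp (- x / 64) \<le> real m * (1 / x ^ 4)" unfolding x4 by (intro mult_left_mono) auto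
    from scale[OF order_trans[OF this mx4], of 2] show ?thesis by (simp only: mult.left_commute)
  qed
  have t2: "(real m)\<^sup>2 * (2 * exp (- 6 * l)) \<le> 2 / x\<^sup>2"
  proof -
    have "(real m)\<^sup>2 \<le> (x\<^sup>2)\<^sup>2" using m2 by (intro power_mono) auto
    then have "(real m)\<^sup>2 * (1 / x ^ 6) \<le> (x\<^sup>2)\<^sup>2 * (1 / x ^ 6)" by (intro mult_right_mono) auto
    also have "\<dots> = 1 / x\<^sup>2" using xpos by (simp add: field_simps power_mult[symmetric] power_add[symmetric])
    finally show ?thesis using scale[of _ 2] unfolding x4 mult.left_commute[of _ 2] by simp
  qed
  have t3: "4 * real m * (?R / (x\<^sup>2 / 8)) ^ (2 * P) \<le> 4 / x\<^sup>2"
  proof -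
    have "?R / (x\<^sup>2 / 8) = 3072 * (real P * sqrt (real m) * l) / x"
      unfolding x_def[symmetric] using xpos by (simp add: field_simps power2_eq_square)
    also have "\<dots> \<le> 3072 * (2 * x / 10 ^ 9) / x" using Psq xpos by (intro divide_right_mono mult_left_mono) auto
    also have "\<dots> \<le> 1 / 27" using xpos by simp
    finally have "?R / (x\<^sup>2 / 8) \<le> exp (- 2)" using em2 by linarith
    moreover have "0 \<le> ?R / (x\<^sup>2 / 8)" using l1 by simp
    ultimately have "(?R / (x\<^sup>2 / 8)) ^ (2 * P) \<le> exp (- 2) ^ (2 * P)" by (intro power_mono)
    also have "\<dots> = exp (- 4 * real P)" by (simp add: exp_of_nat_mult[symmetric] mult.commute)
    also have "\<dots> \<le> exp (- 4 * l)" using Pl by simp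
    finally have "real m * (?R / (x\<^sup>2 / 8)) ^ (2 * P) \<le> real m * (1 / x ^ 4)" unfolding x4 by (intro mult_left_mono) auto
    from scale[OF order_trans[OF this mx4], of 4] show ?thesis by (simp only: mult.assoc, simp?)
  qed
  have t4: "real m * (2 * exp (- x * \<delta>\<^sup>2 / 64)) \<le> 2 / x\<^sup>2"
  proof -
    have "- x * \<delta>\<^sup>2 / 64 = - 4 * l" unfolding \<delta>2 using xpos by simp
    then show ?thesis using scale[OF mx4, of 2] by (simp only: x4 mult.left_commute[of _ 2], simp?)
  qed
  have t5: "x * (24576 * \<delta>\<^sup>2 * real P * sqrt (real m)) ^ P \<le> 1 / x\<^sup>2"
  proof -
    have "24576 * \<delta>\<^sup>2 * real P * sqrt (real m) = 6291456 * (real P * sqrt (real m) * l) / x"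
      unfolding \<delta>2 using xpos by (simp add: field_simps)
    also have "\<dots> \<le> 6291456 * (2 * x / 10 ^ 9) / x" using Psq xpos by (intro divide_right_mono mult_left_mono) auto
    also have "\<dots> \<le> 1 / 27" using xpos by simp
    finally have "24576 * \<delta>\<^sup>2 * real P * sqrt (real m) \<le> exp (- 3)" using em3 by linarith
    then have "(24576 * \<delta>\<^sup>2 * real P * sqrt (real m)) ^ P \<le> exp (- 3) ^ P" by (intro power_mono) auto
    also have "\<dots> = exp (- 3 * real P)" by (simp add: exp_of_nat_mult[symmetric] mult.commute)
    also have "\<dots> \<le> exp (- 3 * l)" using Pl by simp
    finally have "x * (24576 * \<delta>\<^sup>2 * real P * sqrt (real m)) ^ P \<le> x * (1 / x ^ 3)" unfolding x4 using xpos by (intro mult_left_mono) auto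
    also have "\<dots> = 1 / x\<^sup>2" using xpos by (simp add: field_simps power2_eq_square power3_eq_cube)
    finally show ?thesis .
  qed
  have "emeasure (iid_gaussian_samples d m) {\<xi> \<in> space (iid_gaussian_samples d m). \<not> fits d m \<xi>}
    \<le> ennreal (real m * (2 * exp (- x / 64)) + (real m)\<^sup>2 * (2 * exp (- 6 * l))
        + 4 * real m * (?R / (x\<^sup>2 / 8)) ^ (2 * P)
        + (real m * (2 * exp (- x * \<delta>\<^sup>2 / 64)) + x * (24576 * \<delta>\<^sup>2 * real P * sqrt (real m)) ^ P))"
    unfolding x_def using m2 by (intro fits_failure_bound d m l1 Pl(3) Pm \<delta>) (simp add: x_def)
  also have "\<dots> \<le> ennreal (11 / x\<^sup>2)"
  proof (rule ennreal_leI)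
    have s: "2 / x\<^sup>2 + 2 / x\<^sup>2 + 4 / x\<^sup>2 + (2 / x\<^sup>2 + 1 / x\<^sup>2) = 11 / x\<^sup>2" by (simp add: add_divide_distrib[symmetric])
    show "real m * (2 * exp (- x / 64)) + (real m)\<^sup>2 * (2 * exp (- 6 * l))
        + 4 * real m * (?R / (x\<^sup>2 / 8)) ^ (2 * P)
        + (real m * (2 * exp (- x * \<delta>\<^sup>2 / 64)) + x * (24576 * \<delta>\<^sup>2 * real P * sqrt (real m)) ^ P) \<le> 11 / x\<^sup>2"
      unfolding s[symmetric] by (intro add_mono t1 t2 t3 t4 t5)
  qed
  finally show ?thesis by (simp add: x_def)
qed

theorem theorem1p1:
  shows "\<exists>(c::real) (\<eta>::nat \<Rightarrow> real). c > 0 \<and> (\<forall>d. \<eta> d \<in> {0..1}) \<and> \<eta> \<longlonglongrightarrow> 0 \<and>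
    (\<forall>(d::nat) (m::nat). d \<ge> 2 \<longrightarrow> m \<ge> 1 \<longrightarrow> real m < c * (real d)\<^sup>2 / (ln (real d)) ^ 4 \<longrightarrow>
       \<P>(\<omega> in iid_gaussian_samples d m.
          \<exists>E. origin_centered_ellipsoid d E \<and> (\<forall>j<m. vec d (\<omega> j) \<in> E)) \<ge> 1 - \<eta> d)"
proof (intro exI conjI allI impI)
  \<comment> \<open>The cap keeps \<eta> in the unit interval for small d; at d = 0 division by 0
    gives the value 0.\<close>
  define \<eta> where "\<eta> d = min 1 (11 / (real d)\<^sup>2)" for d :: nat
  show "(0::real) < 1 / 10 ^ 18" by simp
  show "\<eta> d \<in> {0..1}" for d by (simp add: \<eta>_def)
  show "\<eta> \<longlonglongrightarrow> 0"
  proof -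
    have "(\<lambda>d::nat. 11 / (real d)\<^sup>2) \<longlonglongrightarrow> 0" by real_asymp
    then have "(\<lambda>d::nat. min 1 (11 / (real d)\<^sup>2)) \<longlonglongrightarrow> min 1 0" by (intro tendsto_min tendsto_const)
    then show ?thesis by (simp add: \<eta>_def[abs_def])
  qed
  fix d m :: nat
  assume d: "d \<ge> 2" and m: "m \<ge> 1" and md: "real m < 1 / 10 ^ 18 * (real d)\<^sup>2 / (ln (real d)) ^ 4"
  let ?Q = "iid_gaussian_samples d m"
  interpret Q: prob_space ?Q by (rule prob_space_iid_gaussian_samples)
  have "Q.prob {\<xi> \<in> space ?Q. \<not> fits d m \<xi>} \<le> 11 / (real d)\<^sup>2"
    using fits_failure_bound_asymptotic[OF d m md] by (simp add: Q.emeasure_eq_measure)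
  then have "1 - \<eta> d \<le> 1 - Q.prob {\<xi> \<in> space ?Q. \<not> fits d m \<xi>}"
    by (simp add: \<eta>_def)
  also have "\<dots> = Q.prob {\<xi> \<in> space ?Q. fits d m \<xi>}"
    using Q.prob_neg[OF sets_fits] by simp
  finally show "\<P>(\<omega> in ?Q. \<exists>E. origin_centered_ellipsoid d E \<and> (\<forall>j<m. vec d (\<omega> j) \<in> E)) \<ge> 1 - \<eta> d"
    by (simp only: ellipsoid_iff_fits)
qed

end
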